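(* There exists a positive absolute constant $C$ such that the following is true. Let $n\geqslant C$ be an integer and let $H\geqslant 1$ be an integer. The number of isomorphism classes of number fields with degree $n$ over $\mathbf{Q}$ and discriminant $\leqslant H$ is \[\leqslant n^{C n\log^3 n}\,H^{C\log^3 n}.\]
   Context: The discriminant $d_{\mathbf{K}}$ of a number field $\mathbf{K}$ of degree $n$ is taken to be positive: if $(\alpha_i)_{1\leqslant i\leqslant n}$ is a $\mathbf{Z}$-basis of the ring of integers of $\mathbf{K}$ and $(\tau_j)_{1\leqslant j\leqslant n}$ are the $n$ embeddings of $\mathbf{K}$ in $\mathbf{C}$, then $d_{\mathbf{K}}=|\det(\tau_j(\alpha_i))_{i,j}|^2$. Here $\log^3 n$ means $(\log n)^3$. *)

theory Defs
  imports
    Complex_Main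
    "HOL-Algebra.Algebraic_Closure_Type"
    "Jordan_Normal_Form.Determinant"
begin

text \<open>
  Number fields are realised as subfields of \<open>\<complex>\<close>. Every finite extension of \<open>\<rat>\<close> embeds in
  \<open>\<complex>\<close>, so every isomorphism class of number fields has a representative of this form.
\<close>

abbreviation complex_field :: "complex ring" where
  "complex_field \<equiv> ring_of_type_algebra"

abbreviation subfield_ring :: "complex set \<Rightarrow> complex ring" where
  "subfield_ring K \<equiv> complex_field\<lparr>carrier := K\<rparr>"

definition number_field :: "complex set \<Rightarrow> bool" where
  "number_field K \<longleftrightarrow> subfield K complex_field \<and> ring.finite_dimension complex_field \<rat> K"

definition nf_degree :: "complex set \<Rightarrow> nat" where
  "nf_degree K = ring.dim complex_field \<rat> K"

definition ring_of_integers :: "complex set \<Rightarrow> complex set" where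
  "ring_of_integers K = {x \<in> K. algebraic_int x}"

text \<open>
  A homomorphism only matters on \<open>K\<close>; requiring it to be \<open>undefined\<close> elsewhere makes distinct
  elements of this set distinct embeddings.
\<close>

definition embeddings :: "complex set \<Rightarrow> (complex \<Rightarrow> complex) set" where
  "embeddings K = Ring.ring_hom (subfield_ring K) complex_field \<inter> extensional K"

definition is_integral_basis :: "complex set \<Rightarrow> (nat \<Rightarrow> complex) \<Rightarrow> bool" where
  "is_integral_basis K \<alpha> \<longleftrightarrow>
     bij_betw (\<lambda>c. \<Sum>i<nf_degree K. of_int (c i) * \<alpha> i)
       ({..<nf_degree K} \<rightarrow>\<^sub>E (UNIV :: int set)) (ring_of_integers K)"

text \<open>
  The value does not depend on the integral basis \<open>\<alpha>\<close> or on the enumeration \<open>\<tau>\<close> of the embeddings: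
  changing either multiplies the determinant by \<open>\<plusminus>1\<close>.
\<close>

definition nf_discriminant :: "complex set \<Rightarrow> real" where
  "nf_discriminant K = (THE d. \<exists>\<alpha> \<tau>.
     is_integral_basis K \<alpha> \<and> bij_betw \<tau> {..<nf_degree K} (embeddings K) \<and>
     d = (cmod (det (mat (nf_degree K) (nf_degree K) (\<lambda>(i, j). \<tau> j (\<alpha> i)))))\<^sup>2)"

definition nf_isomorphism :: "(complex set \<times> complex set) set" where
  "nf_isomorphism =
     {(K, L). number_field K \<and> number_field L \<and> subfield_ring K \<simeq> subfield_ring L}"

definition nf_classes :: "nat \<Rightarrow> real \<Rightarrow> complex set set set" where
  "nf_classes n H =
     {K. number_field K \<and> nf_degree K = n \<and> nf_discriminant K \<le> H} // nf_isomorphism"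

end

theory Submission
  imports Defs "HOL-Library.Function_Algebras" "Jordan_Normal_Form.Char_Poly"
begin

text \<open>
  Let \<open>K\<close> be a number field of degree \<open>n\<close> with embeddings \<open>\<tau>\<^sub>1, \<dots>, \<tau>\<^sub>n\<close>, and let \<open>r\<close> be about
  \<open>log\<^sub>2 n\<close>. Elements \<open>\<kappa>\<^sub>1, \<dots>, \<kappa>\<^sub>r\<close> of the ring of integers give \<open>n\<close> conjugate points
  \<open>P\<^sub>i = (\<tau>\<^sub>i \<kappa>\<^sub>1, \<dots>, \<tau>\<^sub>i \<kappa>\<^sub>r)\<close> of \<open>\<complex>\<^sup>r\<close>. For a polynomial \<open>F\<close> with integer coefficients, \<open>\<Sum>\<^sub>i F(P\<^sub>i)\<close>
  is the trace of \<open>F(\<kappa>)\<close>, hence a rational integer, and it is small if the \<open>\<kappa>\<^sub>k\<close> are. The proof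
  encodes \<open>K\<close> by the \<open>N = n r\<close> integers that belong to \<open>N\<close> fixed polynomials \<open>F\<close>, and counts the codes.
  Three things make this work.

  The code determines \<open>K\<close> up to few choices. The \<open>N\<close> sums are polynomials in the \<open>N\<close> coordinates of
  the points, and if their Jacobian determinant does not vanish at the point given by \<open>K\<close>, a weak
  form of Bezout's theorem (\<open>nondegenerate_zeros_bound\<close>) leaves few possible values
  of \<open>\<tau>\<^sub>1 \<kappa>\<close>, where \<open>\<kappa> = \<Sum> 2\<^sup>k \<kappa>\<^sub>k\<close>. If \<open>\<kappa>\<close> generates \<open>K\<close>, this number determines \<open>K\<close> up to
  isomorphism (\<open>image_of_embedding\<close>, \<open>isomorphic_of_common_image\<close>).

  Polynomials with a nonvanishing Jacobian exist in degree \<open>O(log n)\<close>. When the points are vertices of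
  the hypercube \<open>{0, 1}\<^sup>r\<close>, products of cubic Hermite polynomials give sums whose Jacobian matrix is the
  identity (\<open>hermite_jacobian_hypercube\<close>). So the determinant is a nonzero polynomial, of degree
  polynomial in \<open>n\<close>, and as the points fill \<open>\<complex>\<^sup>N\<close> when the \<open>\<kappa>\<^sub>k\<close> run over the complex span of a basis
  of \<open>K\<close>, some \<open>\<kappa>\<^sub>k\<close> that are combinations of that basis with natural coefficients polynomial in \<open>n\<close>
  make it nonzero, and make \<open>\<kappa>\<close> a generator (\<open>generic_small_elements\<close>).

  There is a basis of algebraic integers all of whose conjugates are at most \<open>n\<^sup>O\<^sup>(\<^sup>1\<^sup>) H\<^sup>O\<^sup>(\<^sup>1\<^sup>/\<^sup>n\<^sup>)\<close> in
  absolute value (\<open>small_basis\<close>). Comparing the number of lattice points in a box, bounded below through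
  the discriminant, with the number of points of mutual distance at least \<open>1\<close> that fit into a subspace,
  one finds more than \<open>n/2\<close> independent integers of that size (\<open>many_small_independent\<close>); the products
  of two of them span \<open>K\<close> (\<open>products_span\<close>).

  The sums then are at most \<open>n\<^sup>O\<^sup>(\<^sup>r\<^sup>) H\<^sup>O\<^sup>(\<^sup>r\<^sup>/\<^sup>n\<^sup>)\<close>, so the \<open>n r\<close> of them take at most
  \<open>n\<^sup>O\<^sup>(\<^sup>n\<^sup>r\<^sup>r\<^sup>) H\<^sup>O\<^sup>(\<^sup>r\<^sup>r\<^sup>)\<close> values, which also absorbs the factor from Bezout's theorem; as \<open>r = O(log n)\<close>, this
  is within the bound to be proved.
\<close>

section \<open>Linear systems and indices\<close>

lemma underdetermined_system:
  fixes A :: "nat \<Rightarrow> nat \<Rightarrow> 'a::field"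
  assumes "m < d"
  shows "\<exists>c. (\<exists>i<d. c i \<noteq> 0) \<and> (\<forall>k<m. (\<Sum>i<d. A k i * c i) = 0)"
proof -
  \<comment> \<open>padding with zero rows gives a singular square matrix\<close>
  define M where "M = mat d d (\<lambda>(k,i). if k < m then A k i else 0)"
  have M: "M \<in> carrier_mat d d" by (simp add: M_def)
  have dm: "\<not> d - 1 < m" "d - 1 < d" using assms by auto
  have "det M = (\<Sum>j<d. M $$ (d - 1, j) * cofactor M (d - 1) j)"
    by (rule laplace_expansion_row[OF M dm(2)])
  also have "\<dots> = 0" using dm by (intro sum.neutral) (auto simp: M_def)
  finally have "det M = 0" .
  then obtain v where v: "v \<in> carrier_vec d" "v \<noteq> 0\<^sub>v d" "M *\<^sub>v v = 0\<^sub>v d"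
    using det_0_iff_vec_prod_zero[OF M] by blast
  have "\<exists>i<d. v $ i \<noteq> 0" using v(1,2) by (metis carrier_vecD eq_vecI index_zero_vec)
  moreover have "(\<Sum>i<d. A k i * v $ i) = 0" if "k < m" for k
  proof -
    have "(M *\<^sub>v v) $ k = 0" using v(3) that assms by simp
    then show ?thesis using that assms v(1)
      by (simp add: M_def scalar_prod_def lessThan_atLeast0)
  qed
  ultimately show ?thesis by (intro exI[of _ "\<lambda>i. v $ i"]) auto
qed

lemma det_nonzero_solve:
  fixes A :: "'a::field mat"
  assumes A: "A \<in> carrier_mat N N" "det A \<noteq> 0"
  shows "\<exists>v. \<forall>i<N. (\<Sum>j<N. A $$ (i, j) * v j) = w i"
proof -
  define W where "W = vec N w"
  define V where "V = (1 / det A) \<cdot>\<^sub>v (adj_mat A *\<^sub>v W)"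
  have adj: "adj_mat A \<in> carrier_mat N N" "A * adj_mat A = det A \<cdot>\<^sub>m 1\<^sub>m N" using adj_mat[OF A(1)] by auto
  have W: "W \<in> carrier_vec N" by (simp add: W_def)
  have aW: "adj_mat A *\<^sub>v W \<in> carrier_vec N" using adj(1) W by simp
  have "A *\<^sub>v V = (1 / det A) \<cdot>\<^sub>v (A *\<^sub>v (adj_mat A *\<^sub>v W))"
    unfolding V_def by (rule mult_mat_vec[OF A(1) aW])
  also have "A *\<^sub>v (adj_mat A *\<^sub>v W) = (det A \<cdot>\<^sub>m 1\<^sub>m N) *\<^sub>v W"
    by (simp only: assoc_mult_mat_vec[OF A(1) adj(1) W, symmetric] adj(2))
  also have "\<dots> = det A \<cdot>\<^sub>v W" 
  proof (rule eq_vecI)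
    fix i assume i: "i < dim_vec (det A \<cdot>\<^sub>v W)"
    have "((det A \<cdot>\<^sub>m 1\<^sub>m N) *\<^sub>v W) $ i = (\<Sum>k\<in>{0..<N}. (det A * (if k = i then 1 else 0)) * W $ k)"
      using i W by (auto simp: scalar_prod_def intro!: sum.cong)
    also have "\<dots> = (\<Sum>k\<in>{0..<N}. (if k = i then det A * W $ k else 0))"
      by (intro sum.cong) auto
    finally show "((det A \<cdot>\<^sub>m 1\<^sub>m N) *\<^sub>v W) $ i = (det A \<cdot>\<^sub>v W) $ i" using i W by simp
  qed (use W in simp)
  also have "(1 / det A) \<cdot>\<^sub>v (det A \<cdot>\<^sub>v W) = W" using A(2) by (simp add: smult_smult_assoc)
  finally have AV: "A *\<^sub>v V = W" .
  have "(\<Sum>j<N. A $$ (i, j) * V $ j) = w i" if "i < N" for i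
  proof -
    have "(A *\<^sub>v V) $ i = w i" using that by (simp add: AV W_def)
    moreover have "dim_vec V = N" using adj(1) by (simp add: V_def)
    ultimately show ?thesis using that A(1) by (simp add: scalar_prod_def lessThan_atLeast0)
  qed
  then show ?thesis by (intro exI[of _ "\<lambda>j. V $ j"]) auto
qed

text \<open>A point of \<open>(\<complex>\<^sup>r)\<^sup>n\<close> is encoded as a function on
  \<open>{..<n * r}\<close>: the index \<open>i * r + k\<close> stands for coordinate
  \<open>k\<close> of point \<open>i\<close>.\<close>
lemma sum_split_index:
  fixes f :: "nat \<Rightarrow> 'a::comm_monoid_add"
  shows "(\<Sum>m<n * r. f m) = (\<Sum>i<n. \<Sum>k<r. f (i * r + k))"
proof -
  have "(\<Sum>m<n * r. f m) = (\<Sum>i<n. sum f {i * r..<i * r + r})" by (simp add: sum.nat_group)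
  also have "\<dots> = (\<Sum>i<n. \<Sum>k<r. f (i * r + k))"
  proof (rule sum.cong)
    fix i
    show "sum f {i * r..<i * r + r} = (\<Sum>k<r. f (i * r + k))"
      using sum.shift_bounds_nat_ivl[of f 0 "i * r" r] by (simp add: lessThan_atLeast0 add.commute)
  qed simp
  finally show ?thesis .
qed

lemma index_less:
  fixes i k n r :: nat
  assumes "i < n" "k < r" shows "i * r + k < n * r"
proof -
  have "i * r + k < Suc i * r" using assms(2) by simp
  also have "\<dots> \<le> n * r" using assms(1) by (intro mult_le_mono1) auto
  finally show ?thesis .
qed

text \<open>Stated for families, where two equal members are a relation.\<close>
lemma (in vector_space) family_dependent:
  assumes "finite I" "finite S" "card S < card I" "\<And>i. i \<in> I \<Longrightarrow> f i \<in> span S"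
  shows "\<exists>c. (\<exists>i\<in>I. c i \<noteq> 0) \<and> (\<Sum>i\<in>I. scale (c i) (f i)) = 0"
proof (cases "inj_on f I")
  case False
  then obtain i j where ij: "i \<in> I" "j \<in> I" "i \<noteq> j" "f i = f j" by (auto simp: inj_on_def)
  define c :: "_ \<Rightarrow> 'a" where "c k = (if k = i then 1 else if k = j then - 1 else 0)" for k
  have "(\<Sum>k\<in>I. scale (c k) (f k)) = (\<Sum>k\<in>{i,j}. scale (c k) (f k))"
    using ij assms(1) by (intro sum.mono_neutral_right) (auto simp: c_def)
  also have "\<dots> = 0" using ij by (simp add: c_def)
  finally show ?thesis using ij(1) by (intro exI[of _ c]) (auto simp: c_def)
next
  case True
  have "dependent (f ` I)"
  proof (rule ccontr)
    assume "independent (f ` I)"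
    then have "card (f ` I) \<le> card S" using independent_span_bound[OF assms(2)] assms(4) by auto
    then show False using assms(3) card_image[OF True] by simp
  qed
  then obtain u where u: "(\<exists>v\<in>f ` I. u v \<noteq> 0)" "(\<Sum>v\<in>f ` I. scale (u v) v) = 0"
    using dependent_finite[of "f ` I"] assms(1) by auto
  then show ?thesis
    by (intro exI[of _ "u \<circ> f"]) (auto simp: sum.reindex[OF True])
qed

section \<open>Polynomial functions\<close>

text \<open>Scaling by constants makes the complex functions a vector space, so that relations
  between polynomial functions come from a comparison of dimensions.\<close>
definition fscale :: "complex \<Rightarrow> ((nat \<Rightarrow> complex) \<Rightarrow> complex) \<Rightarrow> (nat \<Rightarrow> complex) \<Rightarrow> complex" where
  "fscale c f = (\<lambda>x. c * f x)"

interpretation fs: vector_space fscale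
  by unfold_locales (auto simp: fscale_def algebra_simps fun_eq_iff)

definition monomial_fun :: "nat \<Rightarrow> (nat \<Rightarrow> nat) \<Rightarrow> (nat \<Rightarrow> complex) \<Rightarrow> complex" where
  "monomial_fun N a = (\<lambda>x. \<Prod>i<N. x i ^ a i)"

text \<open>The degree is bounded by \<open>T\<close> in each of the \<open>N\<close> variables
  separately, which makes the number of monomials the power \<open>(T + 1)\<^sup>N\<close>.\<close>
definition box_poly :: "nat \<Rightarrow> nat \<Rightarrow> ((nat \<Rightarrow> complex) \<Rightarrow> complex) set" where
  "box_poly N T = fs.span (monomial_fun N ` ({..<N} \<rightarrow>\<^sub>E {..T}))"

lemma monomial_in_box_poly: "(\<And>i. i < N \<Longrightarrow> a i \<le> T) \<Longrightarrow> monomial_fun N a \<in> box_poly N T"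
  unfolding box_poly_def
proof (rule fs.span_base)
  assume "\<And>i. i < N \<Longrightarrow> a i \<le> T"
  then have "monomial_fun N a = monomial_fun N (restrict a {..<N})"
    "restrict a {..<N} \<in> {..<N} \<rightarrow>\<^sub>E {..T}"
    by (auto simp: monomial_fun_def)
  then show "monomial_fun N a \<in> monomial_fun N ` ({..<N} \<rightarrow>\<^sub>E {..T})" by blast
qed

lemma box_poly_mono: assumes "T \<le> T'" shows "box_poly N T \<subseteq> box_poly N T'"
  unfolding box_poly_def using assms by (intro fs.span_mono image_mono PiE_mono) auto

lemma box_poly_add: "f \<in> box_poly N T \<Longrightarrow> g \<in> box_poly N T \<Longrightarrow> (\<lambda>x. f x + g x) \<in> box_poly N T"
  using fs.span_add[of f _ g] by (simp add: box_poly_def plus_fun_def)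

lemma box_poly_scale: "f \<in> box_poly N T \<Longrightarrow> (\<lambda>x. c * f x) \<in> box_poly N T"
  using fs.span_scale[of f _ c] by (simp add: box_poly_def fscale_def)

lemma box_poly_const: "(\<lambda>x. c) \<in> box_poly N T"
proof -
  have "monomial_fun N (\<lambda>_. 0) \<in> box_poly N T" by (rule monomial_in_box_poly) auto
  from box_poly_scale[OF this, of c] show ?thesis by (simp add: monomial_fun_def)
qed

lemma box_poly_var: assumes "i < N" "1 \<le> T" shows "(\<lambda>x. x i) \<in> box_poly N T"
proof -
  have "monomial_fun N (\<lambda>j. if j = i then 1 else 0) \<in> box_poly N T"
    using assms by (intro monomial_in_box_poly) auto
  moreover have "monomial_fun N (\<lambda>j. if j = i then 1 else 0) = (\<lambda>x. x i)"
  proof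
    fix x :: "nat \<Rightarrow> complex"
    have "(\<Prod>j<N. x j ^ (if j = i then 1 else 0)) = (\<Prod>j<N. if j = i then x j else 1)"
      by (intro prod.cong) auto
    also have "\<dots> = x i" using assms by (simp add: prod.delta)
    finally show "monomial_fun N (\<lambda>j. if j = i then 1 else 0) x = x i"
      by (simp add: monomial_fun_def)
  qed
  ultimately show ?thesis by simp
qed

lemma box_poly_sum:
  "(\<And>i. i \<in> I \<Longrightarrow> f i \<in> box_poly N T) \<Longrightarrow> (\<lambda>x. \<Sum>i\<in>I. f i x) \<in> box_poly N T"
  by (induction I rule: infinite_finite_induct) (auto intro: box_poly_const box_poly_add)

lemma box_poly_mult:
  assumes "f \<in> box_poly N T" "g \<in> box_poly N T'"
  shows "(\<lambda>x. f x * g x) \<in> box_poly N (T + T')"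
proof -
  have 1: "(\<lambda>x. monomial_fun N a x * g x) \<in> box_poly N (T + T')"
    if a: "a \<in> {..<N} \<rightarrow>\<^sub>E {..T}" for a
    using assms(2)[unfolded box_poly_def]
  proof (induction rule: fs.span_induct_alt)
    case base then show ?case using box_poly_const[of 0] by simp
  next
    case (step c h g)
    then obtain b where b: "b \<in> {..<N} \<rightarrow>\<^sub>E {..T'}" "h = monomial_fun N b" by blast
    have "monomial_fun N (\<lambda>i. a i + b i) \<in> box_poly N (T + T')"
      using a b(1) by (intro monomial_in_box_poly) (auto intro!: add_mono)
    from box_poly_add[OF box_poly_scale[OF this, of c] step(2)] show ?case
      by (simp add: b(2) fscale_def monomial_fun_def power_add prod.distrib algebra_simps)
  qed
  show ?thesis using assms(1)[unfolded box_poly_def]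
  proof (induction rule: fs.span_induct_alt)
    case base then show ?case using box_poly_const[of 0] by simp
  next
    case (step c h f)
    then obtain a where a: "a \<in> {..<N} \<rightarrow>\<^sub>E {..T}" "h = monomial_fun N a" by blast
    from box_poly_add[OF box_poly_scale[OF 1[OF a(1)], of c] step(2)] show ?case
      by (simp add: a(2) fscale_def algebra_simps)
  qed
qed

lemma box_poly_power:
  assumes "f \<in> box_poly N T" shows "(\<lambda>x. f x ^ m) \<in> box_poly N (m * T)"
  by (induction m) (auto intro: box_poly_const box_poly_mult[OF assms])

lemma box_poly_prod:
  assumes "finite I" "\<And>i. i \<in> I \<Longrightarrow> f i \<in> box_poly N (T i)"
  shows "(\<lambda>x. \<Prod>i\<in>I. f i x) \<in> box_poly N (\<Sum>i\<in>I. T i)"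
  using assms by (induction I) (auto intro: box_poly_const box_poly_mult)

lemma card_box: "card (monomial_fun N ` ({..<N} \<rightarrow>\<^sub>E {..T})) \<le> (T + 1) ^ N"
proof -
  have "card (monomial_fun N ` ({..<N} \<rightarrow>\<^sub>E {..T})) \<le> card ({..<N} \<rightarrow>\<^sub>E {..T})"
    by (intro card_image_le finite_PiE) auto
  also have "\<dots> = (T + 1) ^ N" by (simp add: card_PiE)
  finally show ?thesis .
qed

section \<open>Degree along lines\<close>

text \<open>A notion of degree that does not refer to coefficients. It passes to sums, products,
  determinants and linear substitutions, and it is all that the search for a nonzero value
  requires.\<close>
definition line_poly :: "nat \<Rightarrow> ((nat \<Rightarrow> complex) \<Rightarrow> complex) \<Rightarrow> bool" where
  "line_poly E f \<longleftrightarrow> (\<forall>z v. \<exists>p. degree p \<le> E \<and> (\<forall>t. f (\<lambda>k. z k + t * v k) = poly p t))"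

lemma line_poly_const: "line_poly E (\<lambda>_. c)"
  unfolding line_poly_def by (intro allI exI[of _ "[:c:]"]) auto

lemma line_poly_var: "line_poly 1 (\<lambda>x. x i)"
  unfolding line_poly_def
proof (intro allI)
  fix z v :: "nat \<Rightarrow> complex"
  show "\<exists>p. degree p \<le> 1 \<and> (\<forall>t. z i + t * v i = poly p t)"
    by (intro exI[of _ "[:z i, v i:]"]) auto
qed

lemma line_poly_mono: "line_poly E f \<Longrightarrow> E \<le> E' \<Longrightarrow> line_poly E' f"
  unfolding line_poly_def using le_trans by blast

lemma line_poly_add: assumes "line_poly E f" "line_poly E g" shows "line_poly E (\<lambda>x. f x + g x)"
  unfolding line_poly_def
proof (intro allI)
  fix z v
  obtain p q where "degree p \<le> E" "\<forall>t. f (\<lambda>k. z k + t * v k) = poly p t"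
    "degree q \<le> E" "\<forall>t. g (\<lambda>k. z k + t * v k) = poly q t"
    using assms unfolding line_poly_def by meson
  then show "\<exists>p. degree p \<le> E \<and> (\<forall>t. f (\<lambda>k. z k + t * v k) + g (\<lambda>k. z k + t * v k) = poly p t)"
    by (intro exI[of _ "p + q"]) (auto intro: degree_add_le)
qed

lemma line_poly_mult:
  assumes "line_poly E f" "line_poly E' g" shows "line_poly (E + E') (\<lambda>x. f x * g x)"
  unfolding line_poly_def
proof (intro allI)
  fix z v
  obtain p q where "degree p \<le> E" "\<forall>t. f (\<lambda>k. z k + t * v k) = poly p t"
    "degree q \<le> E'" "\<forall>t. g (\<lambda>k. z k + t * v k) = poly q t"
    using assms unfolding line_poly_def by meson
  then show "\<exists>p. degree p \<le> E + E' \<and> (\<forall>t. f (\<lambda>k. z k + t * v k) * g (\<lambda>k. z k + t * v k) = poly p t)"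
    by (intro exI[of _ "p * q"]) (auto intro: order_trans[OF degree_mult_le])
qed

lemma line_poly_sum:
  "(\<And>i. i \<in> I \<Longrightarrow> line_poly E (f i)) \<Longrightarrow> line_poly E (\<lambda>x. \<Sum>i\<in>I. f i x)"
  by (induction I rule: infinite_finite_induct) (auto intro: line_poly_const line_poly_add)

lemma line_poly_prod:
  "finite I \<Longrightarrow> (\<And>i. i \<in> I \<Longrightarrow> line_poly (E i) (f i)) \<Longrightarrow> line_poly (\<Sum>i\<in>I. E i) (\<lambda>x. \<Prod>i\<in>I. f i x)"
  by (induction I rule: finite_induct) (auto intro: line_poly_const line_poly_mult)

lemma line_poly_power: "line_poly E f \<Longrightarrow> line_poly (m * E) (\<lambda>x. f x ^ m)"
  by (induction m) (auto intro: line_poly_const line_poly_mult)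

lemma line_poly_poly:
  assumes "line_poly E f" shows "line_poly (degree p * E) (\<lambda>x. poly p (f x))"
  unfolding poly_altdef
proof (rule line_poly_sum)
  fix i assume "i \<in> {..degree p}"
  then have "i * E \<le> degree p * E" by simp
  then show "line_poly (degree p * E) (\<lambda>x. coeff p i * f x ^ i)"
    using line_poly_mono[OF line_poly_mult[OF line_poly_const[of 0 "coeff p i"] line_poly_power[OF assms, of i]]]
    by simp
qed

lemma line_poly_compose_linear:
  assumes "line_poly E f"
    and "\<And>u v t k. L (\<lambda>i. u i + t * v i) k = L u k + t * (L v k :: complex)"
  shows "line_poly E (\<lambda>u. f (L u))"
  unfolding line_poly_def
proof (intro allI)
  fix z v
  obtain p where "degree p \<le> E" "\<forall>t. f (\<lambda>k. L z k + t * L v k) = poly p t"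
    using assms(1) unfolding line_poly_def by meson
  moreover have L: "L (\<lambda>i. z i + t * v i) = (\<lambda>k. L z k + t * L v k)" for t
    by (rule ext) (rule assms(2))
  ultimately show "\<exists>p. degree p \<le> E \<and> (\<forall>t. f (L (\<lambda>k. z k + t * v k)) = poly p t)"
    using L by (intro exI[of _ p]) simp
qed

lemma line_poly_det:
  assumes "\<And>i j. i < N \<Longrightarrow> j < N \<Longrightarrow> line_poly E (M i j)"
  shows "line_poly (N * E) (\<lambda>x. det (mat N N (\<lambda>(i,j). M i j x)))"
proof -
  have eq: "det (mat N N (\<lambda>(i,j). M i j x)) =
      (\<Sum>p\<in>{p. p permutes {0..<N}}. signof p * (\<Prod>i\<in>{0..<N}. M i (p i) x))" for x
    by (subst det_def'[of _ N]) (auto intro!: sum.cong prod.cong simp: permutes_in_image)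
  have "line_poly (0 + (\<Sum>i\<in>{0..<N}. E)) (\<lambda>x. signof p * (\<Prod>i\<in>{0..<N}. M i (p i) x))"
    if "p permutes {0..<N}" for p
    by (rule line_poly_mult[OF line_poly_const line_poly_prod])
       (use that permutes_in_image[OF that] in \<open>auto intro: assms\<close>)
  then show ?thesis unfolding eq using line_poly_sum[of "{p. p permutes {0..<N}}"] by simp
qed

lemma schwartz_zippel_step:
  assumes f: "line_poly E f" and nz: "f u \<noteq> 0"
  shows "\<exists>a\<le>E. f (u(k := of_nat a)) \<noteq> 0"
proof -
  obtain p where p: "degree p \<le> E" "\<And>t. f (\<lambda>i. (u(k:=0)) i + t * (if i = k then 1 else 0)) = poly p t"
    using f unfolding line_poly_def by meson
  have p': "f (u(k := t)) = poly p t" for t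
  proof -
    have "(\<lambda>i. (u(k:=0)) i + t * (if i = k then 1 else 0)) = u(k := t)" by auto
    then show ?thesis using p(2)[of t] by simp
  qed
  have "poly p (u k) \<noteq> 0" using p'[of "u k"] nz by simp
  then have p0: "p \<noteq> 0" by auto
  show ?thesis
  proof (rule ccontr)
    assume "\<not> ?thesis"
    then have "of_nat ` {..E} \<subseteq> {t. poly p t = 0}" using p' by auto
    then have "card (of_nat ` {..E} :: complex set) \<le> card {t. poly p t = 0}"
      by (intro card_mono poly_roots_finite p0)
    also have "\<dots> \<le> E" using card_poly_roots_bound[OF p0] p(1) by linarith
    finally show False by (simp add: card_image inj_on_def)
  qed
qed

text \<open>Replacing the coordinates one at a time keeps the value nonzero, since a nonzero polynomial
  of degree at most \<open>E\<close> in one variable has a nonroot among \<open>0, \<dots>, E\<close>.\<close>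
lemma schwartz_zippel:
  assumes "line_poly E f" "f u \<noteq> 0"
  shows "\<exists>a. (\<forall>k<N. a k \<le> E) \<and> f (\<lambda>k. if k < N then of_nat (a k) else u k) \<noteq> 0"
proof (induction N)
  case 0 then show ?case using assms(2) by simp
next
  case (Suc N)
  then obtain a where a: "\<forall>k<N. a k \<le> E" "f (\<lambda>k. if k < N then of_nat (a k) else u k) \<noteq> 0" by blast
  from schwartz_zippel_step[OF assms(1) a(2), of N] obtain b where
    b: "b \<le> E" "f ((\<lambda>k. if k < N then of_nat (a k) else u k)(N := of_nat b)) \<noteq> 0" by blast
  have "(\<lambda>k. if k < N then of_nat (a k) else u k)(N := of_nat b) =
    (\<lambda>k. if k < Suc N then of_nat ((a(N := b)) k) else u k)" by (auto simp: fun_eq_iff less_Suc_eq)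
  then show ?case using a(1) b by (intro exI[of _ "a(N := b)"]) (auto simp: less_Suc_eq)
qed

section \<open>Nondegenerate zeros of polynomial systems\<close>

lemma poly_fun_coeffs_zero:
  fixes q :: "'a::{idom,ring_char_0} poly"
  assumes "\<And>t. poly q t = 0" shows "q = 0"
  using assms poly_all_0_iff_0 by blast

lemma monomial_fun_Suc: "monomial_fun (Suc N) a x = monomial_fun N a x * x N ^ a N"
  by (simp add: monomial_fun_def)

lemma monomial_fun_cong: "(\<And>i. i < N \<Longrightarrow> a i = b i \<and> x i = y i) \<Longrightarrow> monomial_fun N a x = monomial_fun N b y"
  by (auto simp: monomial_fun_def intro!: prod.cong)

text \<open>By induction on the number of variables: a relation is a polynomial in the last
  variable, whose coefficients are relations in the others.\<close>
lemma monomials_independent: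
  assumes "\<And>w. (\<Sum>a\<in>({..<N} \<rightarrow>\<^sub>E {..S}). c a * monomial_fun N a w) = 0"
    and "a \<in> {..<N} \<rightarrow>\<^sub>E {..S}"
  shows "c a = 0"
  using assms
proof (induction N arbitrary: c a)
  case 0
  then show ?case by (simp add: monomial_fun_def)
next
  case (Suc N)
  let ?B = "{..<N} \<rightarrow>\<^sub>E {..S}"
  have split: "(\<Sum>a\<in>({..<Suc N} \<rightarrow>\<^sub>E {..S}). g a) = (\<Sum>e\<le>S. \<Sum>b\<in>?B. g (b(N := e)))" for g :: "_ \<Rightarrow> complex"
  proof -
    have "{..<Suc N} \<rightarrow>\<^sub>E {..S} = (\<lambda>(e, b). b(N := e)) ` ({..S} \<times> ?B)"
      by (simp add: lessThan_Suc PiE_insert_eq)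
    moreover have "inj_on (\<lambda>(e, b). b(N := e)) ({..S} \<times> ?B)"
      by (rule inj_combinator[of N "{..<N}" "\<lambda>_. {..S}", simplified])
    ultimately show ?thesis
      by (simp add: sum.reindex sum.cartesian_product case_prod_unfold)
  qed
  \<comment> \<open>the coefficient of the last variable to the power \<open>e\<close>\<close>
  have zero: "(\<Sum>b\<in>?B. c (b(N := e)) * monomial_fun N b w) = 0" if e: "e \<le> S" for e w
  proof -
    define q where "q = (\<Sum>e\<le>S. monom (\<Sum>b\<in>?B. c (b(N := e)) * monomial_fun N b w) e)"
    have "poly q t = 0" for t
    proof -
      have "0 = (\<Sum>a\<in>({..<Suc N} \<rightarrow>\<^sub>E {..S}). c a * monomial_fun (Suc N) a (w(N := t)))"
        using Suc.prems(1) by simp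
      also have "\<dots> = (\<Sum>e\<le>S. \<Sum>b\<in>?B. c (b(N := e)) * (monomial_fun N b w * t ^ e))"
        unfolding split monomial_fun_Suc
        by (intro sum.cong refl arg_cong2[of _ _ _ _ "(*)"] monomial_fun_cong) auto
      also have "\<dots> = poly q t"
        by (simp add: q_def poly_sum poly_monom sum_distrib_right mult.assoc)
      finally show ?thesis by simp
    qed
    then have "q = 0" by (rule poly_fun_coeffs_zero)
    then have "coeff q e = 0" by simp
    then show ?thesis using e by (simp add: q_def coeff_sum)
  qed
  define b where "b = restrict a {..<N}"
  have aS: "a i \<le> S" if "i < Suc N" for i
    using PiE_mem[OF Suc.prems(2), of i] that by simp
  have b: "b \<in> ?B" "a N \<le> S" using aS by (auto simp: b_def)
  have "b(N := a N) = a"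
  proof (rule ext)
    fix i show "(b(N := a N)) i = a i"
      using PiE_arb[OF Suc.prems(2), of i] by (cases "i < N"; cases "i = N") (simp_all add: b_def)
  qed
  moreover have "c (b(N := a N)) = 0"
    by (rule Suc.IH[of "\<lambda>b. c (b(N := a N))", OF zero[OF b(2)] b(1)])
  ultimately show ?case by simp
qed

text \<open>That the differential of \<open>G\<close> at \<open>z\<close> is onto is expressed by
  directional derivatives: these are what the restriction of a polynomial relation to the lines
  through \<open>z\<close> sees.\<close>
definition nondegenerate_zero ::
  "nat \<Rightarrow> (nat \<Rightarrow> (nat \<Rightarrow> complex) \<Rightarrow> complex) \<Rightarrow> (nat \<Rightarrow> complex) \<Rightarrow> bool" where
  "nondegenerate_zero N G z \<longleftrightarrow> (\<forall>i<N. G i z = 0) \<and>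
     (\<forall>w. \<exists>v. \<forall>i<N. ((\<lambda>t. G i (\<lambda>k. z k + t * v k)) has_field_derivative w i) (at 0))"

text \<open>On the left is the number of monomials of degree at most \<open>d (N + 1) S\<close> in
  each variable, on the right the number of products \<open>G\<^sup>a l\<^sup>b\<close> with
  exponents at most \<open>S\<close>, which are combinations of them.\<close>
lemma bezout_counting:
  fixes N d S :: nat
  assumes "1 \<le> N" "1 \<le> d" "S = (d * (N + 1)) ^ N"
  shows "(d * (N + 1) * S + 1) ^ N < (S + 1) ^ (N + 1)"
proof -
  let ?D = "d * (N + 1)"
  have "2 \<le> ?D" using assms(1,2) mult_le_mono[of 1 d 2 "N + 1"] by simp
  then have "?D * S + 1 < ?D * (S + 1)" by simp
  then have "(?D * S + 1) ^ N < (?D * (S + 1)) ^ N"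
    using assms(1) by (intro power_strict_mono) auto
  also have "\<dots> = S * (S + 1) ^ N" by (simp only: power_mult_distrib assms(3))
  also have "\<dots> \<le> (S + 1) ^ (N + 1)" by simp
  finally show ?thesis .
qed

lemma relation_exists:
  assumes N: "1 \<le> N" and d: "1 \<le> d"
    and G: "\<And>i. i < N \<Longrightarrow> G i \<in> box_poly N d" and l: "l \<in> box_poly N d"
    and S: "S = (d * (N + 1)) ^ N"
  shows "\<exists>c. (\<exists>a\<in>{..<N} \<rightarrow>\<^sub>E {..S}. \<exists>b\<le>S. c a b \<noteq> 0) \<and>
     (\<forall>x. (\<Sum>a\<in>{..<N} \<rightarrow>\<^sub>E {..S}. \<Sum>b\<le>S. c a b * (monomial_fun N a (\<lambda>i. G i x) * l x ^ b)) = 0)"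
proof -
  let ?D = "d * (N + 1)"
  let ?A = "{..<N} \<rightarrow>\<^sub>E {..S}"
  let ?I = "?A \<times> {..S}"
  define f where "f = (\<lambda>(a, b) x. monomial_fun N a (\<lambda>i. G i x) * l x ^ b)"
  have finA: "finite ?A" by (intro finite_PiE) auto
  have f: "f p \<in> fs.span (monomial_fun N ` ({..<N} \<rightarrow>\<^sub>E {..?D * S}))" if "p \<in> ?I" for p
  proof -
    obtain a b where p: "p = (a, b)" "a \<in> ?A" "b \<le> S" using \<open>p \<in> ?I\<close> by auto
    have "(\<lambda>x. \<Prod>i\<in>{..<N}. G i x ^ a i) \<in> box_poly N (\<Sum>i\<in>{..<N}. a i * d)"
      by (intro box_poly_prod box_poly_power G) auto
    moreover have "(\<Sum>i<N. a i * d) \<le> N * (S * d)"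
      using p(2) sum_bounded_above[of "{..<N}" "\<lambda>i. a i * d" "S * d"] by (auto simp: PiE_iff)
    ultimately have "(\<lambda>x. \<Prod>i\<in>{..<N}. G i x ^ a i) \<in> box_poly N (N * (S * d))"
      using box_poly_mono by blast
    moreover have "(\<lambda>x. l x ^ b) \<in> box_poly N (S * d)"
      using box_poly_power[OF l, of b] box_poly_mono[of "b * d" "S * d"] p(3) by auto
    ultimately have "(\<lambda>x. (\<Prod>i\<in>{..<N}. G i x ^ a i) * l x ^ b) \<in> box_poly N (N * (S * d) + S * d)"
      by (rule box_poly_mult)
    then show ?thesis
      by (simp add: p f_def monomial_fun_def box_poly_def algebra_simps)
  qed
  have "card (monomial_fun N ` ({..<N} \<rightarrow>\<^sub>E {..?D * S})) < card ?I"
    using card_box[of N "?D * S"] bezout_counting[OF N d S] by (simp add: card_PiE card_cartesian_product mult.commute)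
  moreover have "finite ?I" "finite (monomial_fun N ` ({..<N} \<rightarrow>\<^sub>E {..?D * S}))"
    using finA by (auto intro: finite_PiE)
  ultimately obtain c where
    c: "\<exists>p\<in>?I. c p \<noteq> 0" "(\<Sum>p\<in>?I. fscale (c p) (f p)) = 0"
    using fs.family_dependent[of ?I "monomial_fun N ` ({..<N} \<rightarrow>\<^sub>E {..?D * S})" f] f by blast
  have app: "(\<Sum>p\<in>J. g p) x = (\<Sum>p\<in>J. g p x)" for g :: "_ \<Rightarrow> (nat \<Rightarrow> complex) \<Rightarrow> complex" and J x
    by (induction J rule: infinite_finite_induct) auto
  have "(\<Sum>a\<in>?A. \<Sum>b\<le>S. c (a, b) * (monomial_fun N a (\<lambda>i. G i x) * l x ^ b)) = 0" for x
    using fun_cong[OF c(2), of x]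
    by (simp add: app fscale_def f_def sum.cartesian_product case_prod_unfold)
  then show ?thesis using c(1) by (intro exI[of _ "\<lambda>a b. c (a, b)"]) auto
qed

text \<open>A weak form of Bezout's theorem. There are more products \<open>G\<^sup>a
  l\<^sup>b\<close> than monomials to express them, so they satisfy a relation \<open>\<Sum>\<^sub>a
  Q\<^sub>a(l) G\<^sup>a = 0\<close>. Let \<open>k\<close> be the least size of an exponent
  \<open>a\<close> that occurs. On the line through a zero \<open>z\<close> of \<open>G\<close> in
  direction \<open>v\<close> the coefficient of \<open>t\<^sup>k\<close> gives
  \<open>\<Sum>\<^sub>|\<^sub>a\<^sub>|\<^sub>=\<^sub>k Q\<^sub>a(l z) w\<^sup>a = 0\<close>, where
  \<open>w\<close> is the derivative of \<open>G\<close> in direction \<open>v\<close>. If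
  \<open>z\<close> is nondegenerate, then \<open>w\<close> is arbitrary, so \<open>l z\<close> is a
  root of each of these \<open>Q\<^sub>a\<close>. One of them is a nonzero polynomial of degree at
  most \<open>S\<close> that does not depend on \<open>z\<close>.\<close>
theorem nondegenerate_zeros_bound:
  assumes N: "1 \<le> N" and d: "1 \<le> d"
    and G: "\<And>i. i < N \<Longrightarrow> G i \<in> box_poly N d" and l: "l \<in> box_poly N d"
    and Gl: "\<And>i. i < N \<Longrightarrow> line_poly E (G i)" and ll: "line_poly E l"
  shows "\<exists>R. finite R \<and> card R \<le> (d * (N + 1)) ^ N \<and>
    (\<forall>z. nondegenerate_zero N G z \<longrightarrow> l z \<in> R)"
proof -
  define S where "S = (d * (N + 1)) ^ N"
  let ?A = "{..<N} \<rightarrow>\<^sub>E {..S}"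
  have finA: "finite ?A" by (intro finite_PiE) auto
  obtain c a0 b0 where c0: "a0 \<in> ?A" "b0 \<le> S" "c a0 b0 \<noteq> 0" and
    rel: "\<And>x. (\<Sum>a\<in>?A. \<Sum>b\<le>S. c a b * (monomial_fun N a (\<lambda>i. G i x) * l x ^ b)) = 0"
    using relation_exists[of N d G l S, OF N d G l S_def] by blast
  define Q where "Q a = (\<Sum>b\<le>S. monom (c a b) b)" for a
  have Qpoly: "poly (Q a) y = (\<Sum>b\<le>S. c a b * y ^ b)" for a y
    by (simp add: Q_def poly_sum poly_monom)
  have rel': "(\<Sum>a\<in>?A. poly (Q a) (l x) * monomial_fun N a (\<lambda>i. G i x)) = 0" for x
  proof -
    have "(\<Sum>b\<le>S. c a b * (monomial_fun N a (\<lambda>i. G i x) * l x ^ b)) =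
        poly (Q a) (l x) * monomial_fun N a (\<lambda>i. G i x)" for a
      unfolding Qpoly sum_distrib_right by (intro sum.cong) (simp_all add: mult_ac)
    then show ?thesis using rel[of x] by simp
  qed
  have "coeff (Q a0) b0 \<noteq> 0" using c0 by (simp add: Q_def coeff_sum)
  then have Qa0: "Q a0 \<noteq> 0" by auto
  define sz where "sz a = (\<Sum>i<N. a i)" for a :: "nat \<Rightarrow> nat"
  define k where "k = (LEAST m. \<exists>a\<in>?A. Q a \<noteq> 0 \<and> sz a = m)"
  have exk: "\<exists>a\<in>?A. Q a \<noteq> 0 \<and> sz a = k"
    unfolding k_def by (rule LeastI_ex) (use c0(1) Qa0 in blast)
  then obtain a1 where a1: "a1 \<in> ?A" "Q a1 \<noteq> 0" "sz a1 = k" by blast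
  have low: "k \<le> sz a" if "a \<in> ?A" "Q a \<noteq> 0" for a
    unfolding k_def by (rule Least_le) (use that in blast)
  define R where "R = {y. poly (Q a1) y = 0}"
  have degQ: "degree (Q a1) \<le> S"
    unfolding Q_def by (intro degree_sum_le) (auto intro: order_trans[OF degree_monom_le])
  have "finite R" unfolding R_def using a1(2) by (rule poly_roots_finite)
  moreover have "card R \<le> S" unfolding R_def using card_poly_roots_bound[OF a1(2)] degQ by linarith
  moreover have "l z \<in> R" if z: "nondegenerate_zero N G z" for z
  proof -
    \<comment> \<open>the part of least degree of the relation on the line through \<open>z\<close>\<close>
    have key: "(\<Sum>a\<in>?A. (if sz a = k then poly (Q a) (l z) else 0) * monomial_fun N a w) = 0" for w
    proof -
      obtain v where v: "\<And>i. i < N \<Longrightarrow>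
          ((\<lambda>t. G i (\<lambda>k. z k + t * v k)) has_field_derivative w i) (at 0)"
        using z unfolding nondegenerate_zero_def by blast
      have "\<exists>g. \<forall>i<N. \<forall>t. G i (\<lambda>k. z k + t * v k) = t * poly (g i) t \<and> poly (g i) 0 = w i"
      proof -
        have "\<exists>g. \<forall>t. G i (\<lambda>k. z k + t * v k) = t * poly g t \<and> poly g 0 = w i" if i: "i < N" for i
        proof -
          obtain p where p: "\<And>t. G i (\<lambda>k. z k + t * v k) = poly p t"
            using Gl[OF i] unfolding line_poly_def by meson
          have "poly p 0 = 0" using p[of 0] z i by (simp add: nondegenerate_zero_def)
          then obtain g where g: "p = pCons 0 g" by (metis pCons_cases poly_pCons mult_zero_left add_0_right)
          have "(poly p has_field_derivative w i) (at 0)" using v[OF i] p by simp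
          moreover have "(poly p has_field_derivative poly (pderiv p) 0) (at 0)" by (rule poly_DERIV)
          ultimately have "w i = poly (pderiv p) 0" by (rule DERIV_unique)
          then have "w i = poly g 0" by (simp add: g pderiv_pCons)
          then show ?thesis using p g by (intro exI[of _ g]) simp
        qed
        then show ?thesis by metis
      qed
      then obtain g where g: "\<And>i t. i < N \<Longrightarrow> G i (\<lambda>k. z k + t * v k) = t * poly (g i) t"
        "\<And>i. i < N \<Longrightarrow> poly (g i) 0 = w i" by blast
      obtain lp where lp: "\<And>t. l (\<lambda>k. z k + t * v k) = poly lp t"
        using ll unfolding line_poly_def by meson
      \<comment> \<open>the relation on this line, divided by \<open>t\<^sup>k\<close>\<close>
      define P where "P = (\<Sum>a\<in>?A. if Q a = 0 then 0 else
         pcompose (Q a) lp * (\<Prod>i<N. g i ^ a i) * monom 1 (sz a - k))"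
      have mono: "monomial_fun N a (\<lambda>i. G i (\<lambda>k. z k + t * v k)) = t ^ sz a * poly (\<Prod>i<N. g i ^ a i) t" for a t
      proof -
        have "monomial_fun N a (\<lambda>i. G i (\<lambda>k. z k + t * v k)) = (\<Prod>i<N. t ^ a i * poly (g i) t ^ a i)"
          unfolding monomial_fun_def by (intro prod.cong) (simp_all add: g(1) power_mult_distrib)
        then show ?thesis
          by (simp add: sz_def poly_prod poly_power prod.distrib power_sum)
      qed
      have "t ^ k * poly P t = 0" for t
      proof -
        have "0 = (\<Sum>a\<in>?A. poly (Q a) (poly lp t) * (t ^ sz a * poly (\<Prod>i<N. g i ^ a i) t))"
          using rel'[of "\<lambda>k. z k + t * v k"] by (simp add: mono lp)
        also have "\<dots> = (\<Sum>a\<in>?A. t ^ k * poly (if Q a = 0 then 0 else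
           pcompose (Q a) lp * (\<Prod>i<N. g i ^ a i) * monom 1 (sz a - k)) t)"
        proof (intro sum.cong refl)
          fix a assume "a \<in> ?A"
          then have "Q a \<noteq> 0 \<Longrightarrow> t ^ sz a = t ^ k * t ^ (sz a - k)"
            using low by (simp flip: power_add)
          then show "poly (Q a) (poly lp t) * (t ^ sz a * poly (\<Prod>i<N. g i ^ a i) t) =
            t ^ k * poly (if Q a = 0 then 0 else
             pcompose (Q a) lp * (\<Prod>i<N. g i ^ a i) * monom 1 (sz a - k)) t"
            by (simp add: poly_pcompose poly_monom)
        qed
        also have "\<dots> = t ^ k * poly P t" by (simp add: P_def poly_sum sum_distrib_left)
        finally show ?thesis by simp
      qed
      then have "poly (monom 1 k * P) t = 0" for t by (simp add: poly_monom)
      then have "monom 1 k * P = 0" by (rule poly_fun_coeffs_zero)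
      then have "P = 0" by simp
      then have "0 = poly P 0" by simp
      also have "\<dots> = (\<Sum>a\<in>?A. (if sz a = k then poly (Q a) (l z) else 0) * monomial_fun N a w)"
        unfolding P_def poly_sum
      proof (intro sum.cong refl)
        fix a assume a: "a \<in> ?A"
        have "poly lp 0 = l z" using lp[of 0] by simp
        moreover have "poly (\<Prod>i<N. g i ^ a i) 0 = monomial_fun N a w"
          by (simp add: poly_prod poly_power monomial_fun_def g(2))
        moreover have "Q a \<noteq> 0 \<Longrightarrow> poly (monom (1::complex) (sz a - k)) 0 = (if sz a = k then 1 else 0)"
          using low[OF a] by (auto simp: poly_monom)
        ultimately show "poly (if Q a = 0 then 0 else
             pcompose (Q a) lp * (\<Prod>i<N. g i ^ a i) * monom 1 (sz a - k)) 0 =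
            (if sz a = k then poly (Q a) (l z) else 0) * monomial_fun N a w"
          by (auto simp: poly_pcompose)
      qed
      finally show ?thesis by simp
    qed
    have "(if sz a1 = k then poly (Q a1) (l z) else 0) = 0"
      by (rule monomials_independent[OF key a1(1)])
    then show ?thesis by (simp add: R_def a1(3))
  qed
  ultimately show ?thesis unfolding S_def by blast
qed

section \<open>Multivariate Hermite interpolation on the hypercube\<close>

text \<open>The cubic Hermite polynomials with nodes \<open>0\<close> and \<open>1\<close>:
  \<open>hermite_value\<close> prescribes a value at one node, \<open>hermite_slope\<close> a
  derivative, and the other three data vanish. Their coefficients are integers, which makes the sums
  formed with them over conjugate points integral.\<close>
definition hermite_value :: "bool \<Rightarrow> complex poly" where
  "hermite_value b = (if b then [:0, 0, 3, -2:] else [:1, 0, -3, 2:])"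

definition hermite_slope :: "bool \<Rightarrow> complex poly" where
  "hermite_slope b = (if b then [:0, 0, -1, 1:] else [:0, 1, -2, 1:])"

lemma hermite_at_bits:
  "poly (hermite_value b) (of_bool c) = of_bool (b = c)"
  "poly (pderiv (hermite_value b)) (of_bool c) = 0"
  "poly (hermite_slope b) (of_bool c) = 0"
  "poly (pderiv (hermite_slope b)) (of_bool c) = of_bool (b = c)"
  by (cases b; cases c; simp add: hermite_value_def hermite_slope_def pderiv_pCons)+

text \<open>The product over \<open>k\<close> of these factors, in separate variables, is a
  polynomial on \<open>\<complex>\<^sup>r\<close> whose gradient is the \<open>j\<close>-th unit
  vector at the vertex of the hypercube given by the binary digits of \<open>i\<close>, and zero at
  every other vertex.\<close>
definition hermite_factor :: "nat \<Rightarrow> nat \<Rightarrow> nat \<Rightarrow> complex poly" where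
  "hermite_factor i j k = (if k = j then hermite_slope (bit i k) else hermite_value (bit i k))"

lemma degree_hermite_factor: "degree (hermite_factor i j k) \<le> 3"
  by (simp add: hermite_factor_def hermite_value_def hermite_slope_def)

text \<open>The polynomial with index \<open>m = i * r + j\<close> summed over the \<open>n\<close>
  points. It is symmetric in the points, hence a trace when they are conjugate.\<close>
definition hermite_sum :: "nat \<Rightarrow> nat \<Rightarrow> nat \<Rightarrow> (nat \<Rightarrow> complex) \<Rightarrow> complex" where
  "hermite_sum n r m x =
     (\<Sum>i<n. \<Prod>k<r. poly (hermite_factor (m div r) (m mod r) k) (x (i * r + k)))"

definition hermite_jacobian :: "nat \<Rightarrow> nat \<Rightarrow> nat \<Rightarrow> (nat \<Rightarrow> complex) \<Rightarrow> complex" where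
  "hermite_jacobian r m m' x =
     poly (pderiv (hermite_factor (m div r) (m mod r) (m' mod r))) (x m') *
     (\<Prod>k\<in>{..<r} - {m' mod r}. poly (hermite_factor (m div r) (m mod r) k) (x (m' div r * r + k)))"

text \<open>On a vertex of the hypercube the form reads off the number whose binary digits are the
  coordinates, so it separates the vertices.\<close>
definition binary_form :: "nat \<Rightarrow> nat \<Rightarrow> (nat \<Rightarrow> complex) \<Rightarrow> complex" where
  "binary_form r i x = (\<Sum>k<r. 2 ^ k * x (i * r + k))"

definition hypercube_point :: "nat \<Rightarrow> nat \<Rightarrow> complex" where
  "hypercube_point r m = of_bool (bit (m div r) (m mod r))"

text \<open>A single polynomial that controls both the invertibility of the Jacobian matrix of the
  sums and the separation of the \<open>n\<close> points by the binary form, so that one search for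
  a nonzero value serves both.\<close>
definition genericity :: "nat \<Rightarrow> nat \<Rightarrow> (nat \<Rightarrow> complex) \<Rightarrow> complex" where
  "genericity n r x = det (mat (n * r) (n * r) (\<lambda>(m, m'). hermite_jacobian r m m' x)) *
     (\<Prod>i<n. \<Prod>i'<i. binary_form r i x - binary_form r i' x)"

lemma hermite_sum_derivative:
  "((\<lambda>t. hermite_sum n r m (\<lambda>k. z k + t * v k)) has_field_derivative
     (\<Sum>m'<n * r. hermite_jacobian r m m' z * v m')) (at 0)"
proof -
  let ?p = "hermite_factor (m div r) (m mod r)"
  have "((\<lambda>t. poly (?p k) (z (i * r + k) + t * v (i * r + k))) has_field_derivative
      poly (pderiv (?p k)) (z (i * r + k) + 0 * v (i * r + k)) * v (i * r + k)) (at 0)" for i k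
    by (rule DERIV_chain2[OF poly_DERIV]) (auto intro!: derivative_eq_intros)
  then have 1: "((\<lambda>t. \<Prod>k<r. poly (?p k) (z (i * r + k) + t * v (i * r + k))) has_field_derivative
      (\<Sum>k<r. (poly (pderiv (?p k)) (z (i * r + k) + 0 * v (i * r + k)) * v (i * r + k)) *
         (\<Prod>l\<in>{..<r} - {k}. poly (?p l) (z (i * r + l) + 0 * v (i * r + l))))) (at 0)" for i
    by (intro has_field_derivative_prod[where f' = "\<lambda>k. poly (pderiv (?p k)) (z (i * r + k) + 0 * v (i * r + k)) * v (i * r + k)"])
  have 2: "(\<Sum>k<r. (poly (pderiv (?p k)) (z (i * r + k) + 0 * v (i * r + k)) * v (i * r + k)) *
         (\<Prod>l\<in>{..<r} - {k}. poly (?p l) (z (i * r + l) + 0 * v (i * r + l)))) =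
      (\<Sum>k<r. hermite_jacobian r m (i * r + k) z * v (i * r + k))" for i
    by (intro sum.cong refl) (simp add: hermite_jacobian_def mult_ac)
  show ?thesis unfolding hermite_sum_def sum_split_index
    by (intro DERIV_sum 1[unfolded 2])
qed

lemma line_poly_hermite_factor:
  "line_poly 3 (\<lambda>x. poly (hermite_factor i j k) (x m))"
  by (rule line_poly_mono[OF line_poly_poly[OF line_poly_var]]) (simp add: degree_hermite_factor)

lemma line_poly_hermite_jacobian:
  assumes "1 \<le> r" shows "line_poly (3 * r) (hermite_jacobian r m m')"
proof -
  have "line_poly (3 + (\<Sum>k\<in>{..<r} - {m' mod r}. 3)) (hermite_jacobian r m m')"
    unfolding hermite_jacobian_def
  proof (intro line_poly_mult line_poly_prod)
    show "line_poly 3 (\<lambda>x. poly (pderiv (hermite_factor (m div r) (m mod r) (m' mod r))) (x m'))"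
      using degree_hermite_factor[of "m div r" "m mod r" "m' mod r"]
      by (intro line_poly_mono[OF line_poly_poly[OF line_poly_var]]) (simp add: degree_pderiv)
  qed (auto intro: line_poly_hermite_factor)
  moreover have "3 + (\<Sum>k\<in>{..<r} - {m' mod r}. 3) = 3 * r"
    using assms by (simp add: card_Diff_singleton)
  ultimately show ?thesis by metis
qed

lemma line_poly_hermite_sum: "line_poly (r * 3) (hermite_sum n r m)"
proof -
  have "line_poly (\<Sum>k<r. 3) (\<lambda>x. \<Prod>k<r. poly (hermite_factor (m div r) (m mod r) k) (x (i * r + k)))" for i
    by (intro line_poly_prod line_poly_hermite_factor) auto
  then show ?thesis unfolding hermite_sum_def by (intro line_poly_sum) simp
qed

lemma box_poly_hermite_sum: "hermite_sum n r m \<in> box_poly (n * r) (r * 3)"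
proof -
  have var: "(\<lambda>x. poly p (x l)) \<in> box_poly (n * r) 3" if "degree p \<le> 3" "l < n * r" for p l
    unfolding poly_altdef
  proof (intro box_poly_sum)
    fix e assume "e \<in> {..degree p}"
    then have "box_poly (n * r) (e * 1) \<subseteq> box_poly (n * r) 3" using that(1) by (intro box_poly_mono) auto
    then show "(\<lambda>x. coeff p e * x l ^ e) \<in> box_poly (n * r) 3"
      using box_poly_scale[of _ "n * r" 3 "coeff p e"] box_poly_power[OF box_poly_var[OF that(2), of 1], of e]
      by auto
  qed
  have "(\<lambda>x. \<Prod>k\<in>{..<r}. poly (hermite_factor (m div r) (m mod r) k) (x (i * r + k)))
      \<in> box_poly (n * r) (\<Sum>k\<in>{..<r}. 3)" if "i < n" for i
    by (intro box_poly_prod var degree_hermite_factor index_less that) auto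
  then show ?thesis unfolding hermite_sum_def[abs_def] by (intro box_poly_sum) simp
qed

lemma line_poly_binary_form: "line_poly 1 (binary_form r i)"
  unfolding binary_form_def[abs_def]
  using line_poly_mult[OF line_poly_const[of 0] line_poly_var] by (intro line_poly_sum) simp

lemma box_poly_binary_form:
  assumes "i < n" "1 \<le> d" shows "binary_form r i \<in> box_poly (n * r) d"
  unfolding binary_form_def[abs_def]
  by (intro box_poly_sum box_poly_scale box_poly_var assms index_less) auto

lemma line_poly_genericity:
  assumes "1 \<le> r" shows "line_poly (n * r * (3 * r) + n * n) (genericity n r)"
  unfolding genericity_def[abs_def]
proof (rule line_poly_mult)
  show "line_poly (n * r * (3 * r)) (\<lambda>x. det (mat (n * r) (n * r) (\<lambda>(m, m'). hermite_jacobian r m m' x)))"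
    by (intro line_poly_det line_poly_hermite_jacobian assms)
  have diff: "line_poly 1 (\<lambda>x. binary_form r i x - binary_form r i' x)" for i i'
    using line_poly_add[OF line_poly_binary_form[of r i], of "\<lambda>x. - 1 * binary_form r i' x"]
      line_poly_mult[OF line_poly_const[of 0 "-1"] line_poly_binary_form[of r i']] by simp
  have "line_poly (\<Sum>i<n. \<Sum>i'<i. 1) (\<lambda>x. \<Prod>i<n. \<Prod>i'<i. binary_form r i x - binary_form r i' x)"
    by (intro line_poly_prod diff) auto
  moreover have "(\<Sum>i<n. \<Sum>i'<i. 1) \<le> n * n"
    using sum_bounded_above[of "{..<n}" "\<lambda>i. \<Sum>i'<i. (1::nat)" n] by simp
  ultimately show "line_poly (n * n) (\<lambda>x. \<Prod>i<n. \<Prod>i'<i. binary_form r i x - binary_form r i' x)"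
    by (rule line_poly_mono)
qed

lemma bits_determine:
  fixes i i' r :: nat assumes "i < 2 ^ r" "i' < 2 ^ r" "\<And>k. k < r \<Longrightarrow> bit i k = bit i' k"
  shows "i = i'"
proof -
  have "take_bit r i = take_bit r i'" by (rule bit_eqI) (auto simp: bit_take_bit_iff assms(3))
  then show ?thesis using assms(1,2) by (simp add: take_bit_nat_eq_self)
qed

lemma hermite_jacobian_hypercube:
  assumes "n \<le> 2 ^ r" "m < n * r" "m' < n * r"
  shows "hermite_jacobian r m m' (hypercube_point r) = of_bool (m = m')"
proof -
  have r: "r > 0" using assms(2) by (cases r) auto
  define i j i' j' where ij: "i = m div r" "j = m mod r" "i' = m' div r" "j' = m' mod r"
  have lt: "i < 2 ^ r" "i' < 2 ^ r" "j < r" "j' < r"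
    using assms r by (auto simp: ij less_mult_imp_div_less intro: less_le_trans[OF less_mult_imp_div_less])
  have mm: "m = m' \<longleftrightarrow> i = i' \<and> j = j'" unfolding ij by (metis div_mult_mod_eq)
  have hp: "hypercube_point r (i' * r + k) = of_bool (bit i' k)" if "k < r" for k
    using that by (simp add: hypercube_point_def)
  have hm: "hypercube_point r m' = of_bool (bit i' j')" by (simp add: hypercube_point_def ij)
  have J: "hermite_jacobian r m m' (hypercube_point r) =
     poly (pderiv (hermite_factor i j j')) (of_bool (bit i' j')) *
     (\<Prod>k\<in>{..<r} - {j'}. poly (hermite_factor i j k) (of_bool (bit i' k)))"
    unfolding hermite_jacobian_def ij(1)[symmetric] ij(2)[symmetric] ij(3)[symmetric] ij(4)[symmetric] hm
    by (intro arg_cong2[of _ _ _ _ "(*)"] prod.cong refl) (auto simp: hp)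
  show ?thesis
  proof (cases "j = j'")
    case False
    then show ?thesis unfolding J mm by (simp add: hermite_factor_def hermite_at_bits)
  next
    case True
    have "(\<Prod>k\<in>{..<r} - {j'}. poly (hermite_factor i j k) (of_bool (bit i' k))) =
      (\<Prod>k\<in>{..<r} - {j'}. of_bool (bit i k = bit i' k))"
      using True by (intro prod.cong) (auto simp: hermite_factor_def hermite_at_bits)
    moreover have "poly (pderiv (hermite_factor i j j')) (of_bool (bit i' j')) = of_bool (bit i j' = bit i' j')"
      using True by (simp add: hermite_factor_def hermite_at_bits)
    ultimately have "hermite_jacobian r m m' (hypercube_point r) = (\<Prod>k\<in>{..<r}. of_bool (bit i k = bit i' k))"
      unfolding J using lt(4) by (subst prod.remove[of "{..<r}" j']) auto
    also have "\<dots> = of_bool (i = i')"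
    proof (cases "i = i'")
      case False
      then obtain k where "k < r" "bit i k \<noteq> bit i' k" using bits_determine[OF lt(1,2)] by blast
      then show ?thesis using False by (auto intro!: prod_zero)
    qed simp
    finally show ?thesis using True mm by simp
  qed
qed

lemma binary_form_hypercube:
  assumes "i < 2 ^ r" shows "binary_form r i (hypercube_point r) = of_nat i"
proof -
  have "binary_form r i (hypercube_point r) = (\<Sum>k<r. 2 ^ k * of_bool (bit i k))"
    unfolding binary_form_def by (intro sum.cong) (auto simp: hypercube_point_def)
  also have "\<dots> = of_nat (\<Sum>k = 0..<r. push_bit k (of_bool (bit i k)))"
    by (simp add: lessThan_atLeast0 push_bit_eq_mult mult.commute)
  also have "\<dots> = of_nat i" using assms by (subst take_bit_sum[symmetric]) (simp add: take_bit_nat_eq_self)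
  finally show ?thesis .
qed

text \<open>The vertices of the hypercube with the binary digits of \<open>0, \<dots>, n - 1\<close>
  as coordinates are generic: the Jacobian matrix is the identity there.\<close>
lemma genericity_hypercube:
  assumes "n \<le> 2 ^ r" shows "genericity n r (hypercube_point r) \<noteq> 0"
proof -
  have "mat (n * r) (n * r) (\<lambda>(m, m'). hermite_jacobian r m m' (hypercube_point r)) = 1\<^sub>m (n * r)"
    by (rule eq_matI) (auto simp: hermite_jacobian_hypercube[OF assms])
  moreover have "(\<Prod>i<n. \<Prod>i'<i. binary_form r i (hypercube_point r) - binary_form r i' (hypercube_point r)) \<noteq> 0"
    using assms by (auto simp: binary_form_hypercube)
  ultimately show ?thesis by (simp add: genericity_def)
qed

lemma generic_nondegenerate:
  assumes "genericity n r z \<noteq> 0" "\<And>m. m < n * r \<Longrightarrow> hermite_sum n r m z = y m"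
  shows "nondegenerate_zero (n * r) (\<lambda>m x. hermite_sum n r m x - y m) z"
  unfolding nondegenerate_zero_def
proof (intro conjI allI impI)
  fix w :: "nat \<Rightarrow> complex"
  let ?A = "mat (n * r) (n * r) (\<lambda>(m, m'). hermite_jacobian r m m' z)"
  have "det ?A \<noteq> 0" using assms(1) by (simp add: genericity_def)
  from det_nonzero_solve[OF _ this, of "n * r" w] obtain v where
    v: "\<forall>m<n * r. (\<Sum>m'<n * r. ?A $$ (m, m') * v m') = w m" by auto
  have "((\<lambda>t. hermite_sum n r m (\<lambda>k. z k + t * v k) - y m) has_field_derivative w m) (at 0)" if "m < n * r" for m
  proof -
    have "(\<Sum>m'<n * r. hermite_jacobian r m m' z * v m') = w m" using v that by simp
    then show ?thesis using hermite_sum_derivative[of n r m z v] by (auto intro!: derivative_eq_intros)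
  qed
  then show "\<exists>v. \<forall>m<n * r. ((\<lambda>t. hermite_sum n r m (\<lambda>k. z k + t * v k) - y m) has_field_derivative w m) (at 0)"
    by blast
qed (use assms(2) in simp)

lemma generic_distinct:
  assumes "genericity n r z \<noteq> 0" "i < n" "i' < n" "i \<noteq> i'"
  shows "binary_form r i z \<noteq> binary_form r i' z"
proof -
  have "binary_form r i z \<noteq> binary_form r i' z" if "i < n" "i' < i" for i i'
    using assms(1) that by (auto simp: genericity_def)
  then show ?thesis using assms(2-4) by (metis linorder_neqE_nat)
qed

text \<open>The bound does not depend on the prescribed values \<open>y\<close>, so it multiplies
  the number of possible \<open>y\<close>.\<close>
lemma hermite_system_bound:
  assumes "1 \<le> n" "1 \<le> r"
  shows "\<exists>R. finite R \<and> card R \<le> (3 * r * (n * r + 1)) ^ (n * r) \<and>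
    (\<forall>z. genericity n r z \<noteq> 0 \<and> (\<forall>m<n * r. hermite_sum n r m z = y m) \<longrightarrow> binary_form r 0 z \<in> R)"
proof -
  have b: "(\<lambda>x. hermite_sum n r m x - y m) \<in> box_poly (n * r) (r * 3)" for m
    using box_poly_add[OF box_poly_hermite_sum box_poly_const[of "- y m"]] by simp
  have l: "line_poly (r * 3) (\<lambda>x. hermite_sum n r m x - y m)" for m
    using line_poly_add[OF line_poly_hermite_sum line_poly_const[of _ "- y m"]] by simp
  have "\<exists>R. finite R \<and> card R \<le> (r * 3 * (n * r + 1)) ^ (n * r) \<and>
    (\<forall>z. nondegenerate_zero (n * r) (\<lambda>m x. hermite_sum n r m x - y m) z \<longrightarrow> binary_form r 0 z \<in> R)"
    using assms by (intro nondegenerate_zeros_bound[where E = "r * 3"] b l box_poly_binary_form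
        line_poly_mono[OF line_poly_binary_form]) auto
  then show ?thesis using generic_nondegenerate[of n r _ y] by (auto simp: mult.commute)
qed

section \<open>Geometry of numbers\<close>

definition quad_form :: "nat \<Rightarrow> (nat \<Rightarrow> nat \<Rightarrow> real) \<Rightarrow> (nat \<Rightarrow> real) \<Rightarrow> real" where
  "quad_form n G x = (\<Sum>i<n. \<Sum>k<n. G i k * x i * x k)"

lemma quad_form_Suc:
  assumes "\<And>i. i < n \<Longrightarrow> G n i = G i n"
  shows "quad_form (Suc n) G x = quad_form n G x + 2 * x n * (\<Sum>i<n. G i n * x i) + G n n * (x n)\<^sup>2"
  using assms
  by (simp add: quad_form_def sum.distrib power2_eq_square sum_distrib_left mult_ac)

text \<open>Completing the square in the last variable. If its coefficient \<open>G n n\<close>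
  vanishes, so does the last column, by semidefiniteness; with division by zero giving zero, the
  same formulas then apply.\<close>
lemma cholesky:
  assumes "\<And>i k. i < n \<Longrightarrow> k < n \<Longrightarrow> G i k = G k i" "\<And>x. 0 \<le> quad_form n G x"
  shows "\<exists>R. (\<forall>i k. i < k \<longrightarrow> R i k = (0::real)) \<and> (\<forall>i<n. 0 \<le> R i i) \<and>
     (\<forall>i<n. \<forall>k<n. G i k = (\<Sum>j<n. R j i * R j k))"
  using assms
proof (induction n arbitrary: G)
  case 0
  then show ?case by (intro exI[of _ "\<lambda>_ _. 0"]) auto
next
  case (Suc n)
  have sym: "G n i = G i n" if "i < n" for i using Suc.prems(1) that by simp
  note qS = quad_form_Suc[of n G, OF sym]
  have unit: "quad_form n G (\<lambda>i. if i = j then 1 else 0) = (if j < n then G j j else 0)" for j n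
    unfolding quad_form_def by (simp add: if_distrib[of "\<lambda>y. _ * y"] sum.delta cong: if_cong)
  have g0: "0 \<le> G n n"
    using Suc.prems(2)[of "\<lambda>i. if i = n then 1 else 0"] unit[of "Suc n" n] by simp
  \<comment> \<open>otherwise the form takes the value \<open>-1\<close> at a point supported on \<open>i\<close> and \<open>n\<close>\<close>
  have col0: "G i n = 0" if "G n n = 0" and i: "i < n" for i
  proof (rule ccontr)
    assume nz: "G i n \<noteq> 0"
    define t where "t = - (G i i + 1) / (2 * G i n)"
    define x where "x = (\<lambda>k. if k = i then 1 else if k = n then t else 0)"
    have "quad_form n G x = quad_form n G (\<lambda>k. if k = i then 1 else 0)"
      unfolding quad_form_def x_def by (intro sum.cong refl) auto
    moreover have "(\<Sum>k<n. G k n * x k) = (\<Sum>k<n. if k = i then G k n else 0)"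
      unfolding x_def by (intro sum.cong refl) auto
    ultimately have "quad_form (Suc n) G x = G i i + 2 * t * G i n"
      using i unit[of n i] \<open>G n n = 0\<close> by (simp add: qS x_def)
    also have "\<dots> = -1" using nz by (simp add: t_def field_simps)
    finally show False using Suc.prems(2)[of x] by simp
  qed
  define G' where "G' i k = G i k - G i n * G k n / G n n" for i k
  have split: "quad_form n G x = quad_form n G' x + (\<Sum>i<n. G i n * x i)\<^sup>2 / G n n" for x
  proof -
    have "(\<Sum>i<n. G i n * x i)\<^sup>2 / G n n = (\<Sum>i<n. \<Sum>k<n. (G i n * G k n / G n n) * x i * x k)"
      by (simp add: power2_eq_square sum_product sum_divide_distrib mult_ac)
    then show ?thesis
      by (simp add: quad_form_def G'_def left_diff_distrib sum_subtractf)
  qed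
  have q: "0 \<le> quad_form n G' x" for x
  proof -
    define s where "s = (\<Sum>i<n. G i n * x i)"
    define y where "y = x(n := - s / G n n)"
    have "quad_form n G y = quad_form n G x" "(\<Sum>i<n. G i n * y i) = s"
      unfolding quad_form_def s_def y_def by (auto intro!: sum.cong)
    then have "quad_form (Suc n) G y = quad_form n G' x + s\<^sup>2 / G n n - 2 * s\<^sup>2 / G n n + G n n * (s / G n n)\<^sup>2"
      by (simp add: qS split s_def[symmetric] y_def power2_eq_square)
    also have "G n n * (s / G n n)\<^sup>2 = s\<^sup>2 / G n n" by (simp add: power2_eq_square)
    finally have "quad_form (Suc n) G y = quad_form n G' x" by simp
    then show ?thesis using Suc.prems(2)[of y] by simp
  qed
  have "\<And>i k. i < n \<Longrightarrow> k < n \<Longrightarrow> G' i k = G' k i"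
    using Suc.prems(1) by (simp add: G'_def mult.commute)
  from Suc.IH[OF this q] obtain R where R: "\<forall>i k. i < k \<longrightarrow> R i k = (0::real)" "\<forall>i<n. 0 \<le> R i i"
    "\<forall>i<n. \<forall>k<n. G' i k = (\<Sum>j<n. R j i * R j k)" by auto
  define R' where "R' = R(n := \<lambda>k. if k \<le> n then G k n / sqrt (G n n) else 0)"
  have "G i k = (\<Sum>j<Suc n. R' j i * R' j k)" if ik: "i < Suc n" "k < Suc n" for i k
  proof -
    have *: "(\<Sum>j<Suc n. R' j i * R' j k) = (\<Sum>j<n. R j i * R j k) + G i n * G k n / G n n"
      using ik g0 unfolding R'_def sum.lessThan_Suc by simp
    have last: "(\<Sum>j<n. R j i * R j k) = 0" if "i = n \<or> k = n"
      using R(1) that by (intro sum.neutral) auto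
    consider "i < n" "k < n" | "i = n" | "k = n" using ik by linarith
    then show ?thesis
    proof cases
      case 1
      then have "G' i k = (\<Sum>j<n. R j i * R j k)" using R(3) by simp
      then show ?thesis unfolding * by (simp add: G'_def)
    next
      case 2
      then show ?thesis unfolding * using last ik sym[of k] col0[of k] by (cases "k = n") auto
    next
      case 3
      then show ?thesis unfolding * using last ik col0[of i] by (cases "i = n") auto
    qed
  qed
  moreover have "\<forall>i k. i < k \<longrightarrow> R' i k = 0" "\<forall>i<Suc n. 0 \<le> R' i i"
    using R(1,2) g0 by (simp_all add: R'_def less_Suc_eq)
  ultimately show ?case by blast
qed

text \<open>At real coefficients only the real part of the Gram matrix of the rows of
  \<open>a\<close> matters, and it is positive semidefinite.\<close>
lemma hermitian_form_triangular:
  fixes a :: "nat \<Rightarrow> nat \<Rightarrow> complex"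
  shows "\<exists>R. (\<forall>i k. i < k \<longrightarrow> R i k = (0::real)) \<and> (\<forall>i<d. 0 \<le> R i i) \<and>
     (\<forall>i<d. \<forall>k<d. Re (\<Sum>j<n. a i j * cnj (a k j)) = (\<Sum>j<d. R j i * R j k)) \<and>
     (\<forall>x. (\<Sum>j<n. (cmod (\<Sum>i<d. of_real (x i) * a i j))\<^sup>2) = (\<Sum>j<d. (\<Sum>k<d. R j k * x k)\<^sup>2))"
proof -
  define G where "G i k = Re (\<Sum>j<n. a i j * cnj (a k j))" for i k
  have qf: "quad_form d G x = (\<Sum>j<n. (cmod (\<Sum>i<d. of_real (x i) * a i j))\<^sup>2)" for x
  proof -
    have "complex_of_real (\<Sum>j<n. (cmod (\<Sum>i<d. of_real (x i) * a i j))\<^sup>2) =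
       (\<Sum>j<n. \<Sum>i<d. \<Sum>k<d. of_real (x i) * a i j * cnj (of_real (x k) * a k j))"
      by (simp only: of_real_sum complex_norm_square cnj_sum sum_product)
    also have "\<dots> = (\<Sum>i<d. \<Sum>k<d. \<Sum>j<n. of_real (x i) * a i j * cnj (of_real (x k) * a k j))"
      by (subst sum.swap) (intro sum.cong refl sum.swap)
    also have "\<dots> = (\<Sum>i<d. \<Sum>k<d. (\<Sum>j<n. a i j * cnj (a k j)) * of_real (x i) * of_real (x k))"
      by (simp add: sum_distrib_right sum_distrib_left mult_ac)
    finally have "complex_of_real (\<Sum>j<n. (cmod (\<Sum>i<d. of_real (x i) * a i j))\<^sup>2) =
      (\<Sum>i<d. \<Sum>k<d. (\<Sum>j<n. a i j * cnj (a k j)) * of_real (x i * x k))" by (simp add: mult.assoc)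
    from arg_cong[OF this, of Re]
    have "(\<Sum>j<n. (cmod (\<Sum>i<d. of_real (x i) * a i j))\<^sup>2) =
      Re (\<Sum>i<d. \<Sum>k<d. (\<Sum>j<n. a i j * cnj (a k j)) * of_real (x i * x k))"
      by (simp only: Re_complex_of_real)
    moreover have "Re (\<Sum>i<d. \<Sum>k<d. g i k * of_real (y i k)) = (\<Sum>i<d. \<Sum>k<d. Re (g i k) * y i k)"
      for g and y :: "nat \<Rightarrow> nat \<Rightarrow> real" by simp
    ultimately show ?thesis by (simp only: quad_form_def G_def mult.assoc)
  qed
  have "G i k = G k i" for i k
    unfolding G_def Re_sum by (intro sum.cong refl) (simp add: algebra_simps)
  moreover have "0 \<le> quad_form d G x" for x unfolding qf by (intro sum_nonneg) auto
  ultimately obtain R where R: "\<forall>i k. i < k \<longrightarrow> R i k = (0::real)" "\<forall>i<d. 0 \<le> R i i"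
      "\<forall>i<d. \<forall>k<d. G i k = (\<Sum>j<d. R j i * R j k)"
    using cholesky[of d G] by blast
  have "quad_form d G x = (\<Sum>j<d. (\<Sum>k<d. R j k * x k)\<^sup>2)" for x
  proof -
    have "quad_form d G x = (\<Sum>i<d. \<Sum>k<d. \<Sum>j<d. (R j i * x i) * (R j k * x k))"
      unfolding quad_form_def using R(3)
      by (intro sum.cong refl) (simp add: sum_distrib_right sum_distrib_left mult_ac)
    also have "\<dots> = (\<Sum>j<d. \<Sum>i<d. \<Sum>k<d. (R j i * x i) * (R j k * x k))"
      by (subst (2) sum.swap, subst sum.swap) simp
    finally show ?thesis by (simp add: power2_eq_square sum_product)
  qed
  then show ?thesis using R qf unfolding G_def by (intro exI[of _ R]) auto
qed

text \<open>The lattice spanned by the columns of a triangular matrix has a box as fundamental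
  domain: the coordinates are reduced one after the other.\<close>
lemma triangular_reduction:
  fixes R :: "nat \<Rightarrow> nat \<Rightarrow> real"
  assumes "\<And>i k. i < k \<Longrightarrow> R i k = 0" "\<And>i. i < n \<Longrightarrow> 0 < R i i" "m \<le> n"
  shows "\<exists>c :: nat \<Rightarrow> int. \<forall>i<m. 0 \<le> y i + (\<Sum>k<n. R i k * c k) \<and> y i + (\<Sum>k<n. R i k * c k) < R i i"
  using assms(3)
proof (induction m)
  case (Suc m)
  then obtain c :: "nat \<Rightarrow> int" where
    c: "\<And>i. i < m \<Longrightarrow> 0 \<le> y i + (\<Sum>k<n. R i k * c k) \<and> y i + (\<Sum>k<n. R i k * c k) < R i i" by auto
  define s where "s = y m + (\<Sum>k\<in>{..<n} - {m}. R m k * c k)"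
  define c' where "c' = c(m := - \<lfloor>s / R m m\<rfloor>)"
  have Rm: "0 < R m m" using assms(2) Suc.prems by simp
  have same: "(\<Sum>k<n. R i k * c' k) = (\<Sum>k<n. R i k * c k)" if "i < m" for i
    using that assms(1) by (intro sum.cong refl) (auto simp: c'_def)
  have "(\<Sum>k<n. R m k * c' k) = R m m * c' m + (\<Sum>k\<in>{..<n} - {m}. R m k * c' k)"
    using Suc.prems by (intro sum.remove) auto
  also have "(\<Sum>k\<in>{..<n} - {m}. R m k * c' k) = (\<Sum>k\<in>{..<n} - {m}. R m k * c k)"
    by (intro sum.cong) (auto simp: c'_def)
  finally have eq: "y m + (\<Sum>k<n. R m k * c' k) = s - R m m * \<lfloor>s / R m m\<rfloor>"
    by (simp add: s_def c'_def)
  have fl: "real_of_int \<lfloor>s / R m m\<rfloor> \<le> s / R m m" "s / R m m < real_of_int \<lfloor>s / R m m\<rfloor> + 1" by linarith+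
  then have "R m m * \<lfloor>s / R m m\<rfloor> \<le> R m m * (s / R m m)"
    "R m m * (s / R m m) < R m m * (real_of_int \<lfloor>s / R m m\<rfloor> + 1)"
    using mult_left_mono[OF fl(1), of "R m m"] mult_strict_left_mono[OF fl(2) Rm] Rm by linarith+
  then have "R m m * \<lfloor>s / R m m\<rfloor> \<le> s" "s < R m m * \<lfloor>s / R m m\<rfloor> + R m m"
    using Rm by (simp_all add: distrib_left)
  then have "0 \<le> y m + (\<Sum>k<n. R m k * c' k)" "y m + (\<Sum>k<n. R m k * c' k) < R m m"
    unfolding eq by auto
  then show ?case using c same by (intro exI[of _ c']) (auto simp: less_Suc_eq)
qed simp

lemma large_fibre:
  assumes "finite A" "f ` A \<subseteq> B" "finite B" "card B > 0"
  shows "\<exists>y\<in>B. real (card A) / real (card B) \<le> real (card {x\<in>A. f x = y})"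
proof (rule ccontr)
  assume "\<not> ?thesis"
  then have lt: "\<And>y. y \<in> B \<Longrightarrow> real (card {x\<in>A. f x = y}) < real (card A) / real (card B)" by force
  have "(\<Sum>y\<in>B. \<Sum>x\<in>{x\<in>A. f x = y}. 1) = (\<Sum>x\<in>A. (1::nat))"
    by (rule sum.group) (use assms in auto)
  then have "(\<Sum>y\<in>B. card {x\<in>A. f x = y}) = card A" by simp
  from this[symmetric] have "real (card A) = (\<Sum>y\<in>B. real (card {x\<in>A. f x = y}))" by simp
  also have "\<dots> < (\<Sum>y\<in>B. real (card A) / real (card B))"
    using assms(3,4) lt by (intro sum_strict_mono) auto
  also have "\<dots> = real (card A)" using assms(4) by simp
  finally show False by simp
qed

text \<open>A version of Blichfeldt's theorem by the pigeonhole principle. The points of a fine grid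
  in the box of side \<open>S\<close> are reduced modulo the lattice into the fundamental box, which
  is cut into cells of the width \<open>e\<close> of the grid. Two grid points in one cell differ by
  a lattice vector up to an error less than \<open>e\<close>; so the points of the fullest cell give
  different small lattice vectors.\<close>
lemma many_lattice_points:
  fixes R :: "nat \<Rightarrow> nat \<Rightarrow> real"
  assumes tri: "\<And>i k. i < k \<Longrightarrow> R i k = 0" and pos: "\<And>i. i < n \<Longrightarrow> 0 < R i i" and S: "0 < S"
  shows "\<exists>C :: (nat \<Rightarrow> int) set. finite C \<and> C \<subseteq> {..<n} \<rightarrow>\<^sub>E UNIV \<and>
     (S / 2) ^ n / (\<Prod>i<n. R i i) \<le> real (card C) \<and>
     (\<forall>c\<in>C. \<forall>i<n. \<bar>\<Sum>k<n. R i k * c k\<bar> \<le> S)"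
proof -
  \<comment> \<open>so fine that the cells fit into the fundamental box: \<open>e \<le> R i i\<close> for all \<open>i\<close>\<close>
  define M where "M = nat \<lceil>\<Sum>i<n. S / R i i\<rceil> + 1"
  define e where "e = S / M"
  have M: "0 < M" by (simp add: M_def)
  have e: "0 < e" using S M by (simp add: e_def)
  have eR: "e \<le> R i i" if "i < n" for i
  proof -
    have "S / R i i \<le> (\<Sum>i<n. S / R i i)"
      using that pos S by (intro member_le_sum) (auto intro: less_imp_le)
    also have "\<dots> \<le> M" unfolding M_def by linarith
    finally show ?thesis using pos[OF that] M by (simp add: e_def field_simps)
  qed
  let ?P = "{..<n} \<rightarrow>\<^sub>E {..<M}"
  have "\<exists>c :: nat \<Rightarrow> int. \<forall>i<n. 0 \<le> e * p i + (\<Sum>k<n. R i k * c k) \<and> e * p i + (\<Sum>k<n. R i k * c k) < R i i"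
    for p :: "nat \<Rightarrow> nat" by (rule triangular_reduction[OF tri pos order.refl])
  then obtain c :: "(nat \<Rightarrow> nat) \<Rightarrow> nat \<Rightarrow> int" where
    c: "\<And>p i. i < n \<Longrightarrow> 0 \<le> e * p i + (\<Sum>k<n. R i k * c p k) \<and> e * p i + (\<Sum>k<n. R i k * c p k) < R i i"
    by metis
  define z where "z p i = e * p i + (\<Sum>k<n. R i k * c p k)" for p i
  define cell where "cell p = (\<lambda>i\<in>{..<n}. \<lfloor>z p i / e\<rfloor>)" for p
  let ?B = "PiE {..<n} (\<lambda>i. {0..\<lfloor>R i i / e\<rfloor>})"
  have cellB: "cell ` ?P \<subseteq> ?B"
  proof (intro image_subsetI)
    fix p
    have "0 \<le> \<lfloor>z p i / e\<rfloor> \<and> \<lfloor>z p i / e\<rfloor> \<le> \<lfloor>R i i / e\<rfloor>" if "i < n" for i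
    proof -
      have "0 \<le> z p i" "z p i \<le> R i i" using c[OF that, of p] by (simp_all add: z_def)
      then show ?thesis using e by (auto intro!: floor_mono divide_right_mono)
    qed
    then show "cell p \<in> ?B" by (simp add: cell_def PiE_iff)
  qed
  have cardB: "real (card ?B) \<le> (2 / e) ^ n * (\<Prod>i<n. R i i)"
  proof -
    have "real (card ?B) = (\<Prod>i<n. real (nat (\<lfloor>R i i / e\<rfloor> + 1)))" by (simp add: card_PiE)
    also have "\<dots> \<le> (\<Prod>i<n. (2 / e) * R i i)"
    proof (intro prod_mono conjI)
      fix i assume "i \<in> {..<n}"
      then have i: "i < n" by simp
      have "0 \<le> R i i / e" "1 \<le> R i i / e" using e eR[OF i] by auto
      then have "real (nat (\<lfloor>R i i / e\<rfloor> + 1)) \<le> R i i / e + R i i / e" by linarith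
      then show "real (nat (\<lfloor>R i i / e\<rfloor> + 1)) \<le> (2 / e) * R i i" by simp
    qed simp
    also have "\<dots> = (2 / e) ^ n * (\<Prod>i<n. R i i)" unfolding prod.distrib by simp
    finally show ?thesis .
  qed
  have B0: "card ?B > 0"
  proof -
    have "0 \<le> \<lfloor>R i i / e\<rfloor>" if "i < n" for i using e pos[OF that] by simp
    then show ?thesis by (auto simp: card_PiE intro!: prod_pos)
  qed
  have "finite ?P" "finite ?B" by (intro finite_PiE; simp)+
  from large_fibre[OF this(1) cellB this(2) B0] obtain b where
    b: "real (card ?P) / real (card ?B) \<le> real (card {p\<in>?P. cell p = b})" by blast
  define F where "F = {p\<in>?P. cell p = b}"
  have pP: "0 < (\<Prod>i<n. R i i)" using pos by (intro prod_pos) auto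
  have "(S / 2) ^ n / (\<Prod>i<n. R i i) = real M ^ n / ((2 / e) ^ n * (\<Prod>i<n. R i i))"
    using M S by (simp add: e_def power_divide field_simps)
  also have "\<dots> = real (card ?P) / ((2 / e) ^ n * (\<Prod>i<n. R i i))" by (simp add: card_PiE)
  also have "\<dots> \<le> real (card ?P) / real (card ?B)"
    using cardB B0 by (intro frac_le) auto
  finally have cardF: "(S / 2) ^ n / (\<Prod>i<n. R i i) \<le> real (card F)" using b by (simp add: F_def)
  have finF: "finite F" using \<open>finite ?P\<close> by (simp add: F_def)
  have "F \<noteq> {}"
  proof
    assume "F = {}"
    then have "(S / 2) ^ n / (\<Prod>i<n. R i i) \<le> 0" using cardF by simp
    moreover have "0 < (S / 2) ^ n / (\<Prod>i<n. R i i)" using pP S by simp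
    ultimately show False by linarith
  qed
  then obtain p0 where p0: "p0 \<in> F" by blast
  have close: "\<bar>z p i - z p' i\<bar> < e" if "p \<in> F" "p' \<in> F" "i < n" for p p' i
  proof -
    have "cell p i = cell p' i" using that by (simp add: F_def)
    then have "\<lfloor>z p i / e\<rfloor> = \<lfloor>z p' i / e\<rfloor>" using that by (simp add: cell_def)
    then have "\<bar>z p i / e - z p' i / e\<bar> < 1" by linarith
    then show ?thesis using e by (simp add: diff_divide_distrib[symmetric] abs_less_iff field_simps)
  qed
  define h where "h p = (\<lambda>i\<in>{..<n}. c p i - c p0 i)" for p
  have inj: "inj_on h F"
  proof (rule inj_onI)
    fix p p' assume pp: "p \<in> F" "p' \<in> F" "h p = h p'"
    have "c p i = c p' i" if "i < n" for i using fun_cong[OF pp(3), of i] that by (simp add: h_def)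
    then have same: "(\<Sum>k<n. R i k * c p k) = (\<Sum>k<n. R i k * c p' k)" for i
      by (intro sum.cong) auto
    have "z p i - z p' i = e * (real (p i) - real (p' i))" if "i < n" for i
      unfolding z_def right_diff_distrib using same[of i] by linarith
    then have "\<bar>e * (real (p i) - real (p' i))\<bar> < e" if "i < n" for i
      using close[OF pp(1,2) that] that by simp
    then have "\<bar>real (p i) - real (p' i)\<bar> < 1" if "i < n" for i
      using that e by (simp add: abs_mult)
    then have "p i = p' i" if "i < n" for i using that by fastforce
    moreover have "p \<in> ?P" "p' \<in> ?P" using pp by (auto simp: F_def)
    ultimately show "p = p'" by (intro PiE_ext[of p "{..<n}"]) auto
  qed
  have bound: "\<bar>\<Sum>k<n. R i k * h p k\<bar> \<le> S" if "p \<in> F" "i < n" for p i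
  proof -
    have "(\<Sum>k<n. R i k * h p k) = (\<Sum>k<n. R i k * c p k) - (\<Sum>k<n. R i k * c p0 k)"
      unfolding sum_subtractf[symmetric] by (intro sum.cong refl) (simp add: h_def algebra_simps)
    also have "\<dots> = (z p i - z p0 i) + e * (real (p0 i) - real (p i))"
      by (simp add: z_def algebra_simps)
    finally have eq: "(\<Sum>k<n. R i k * h p k) = (z p i - z p0 i) + e * (real (p0 i) - real (p i))" .
    have "p i < M" "p0 i < M" using that p0 by (auto simp: F_def)
    then have "\<bar>real (p0 i) - real (p i)\<bar> \<le> real M - 1" by linarith
    then have "\<bar>e * (real (p0 i) - real (p i))\<bar> \<le> e * (real M - 1)" using e by (simp add: abs_mult)
    then have "\<bar>\<Sum>k<n. R i k * h p k\<bar> \<le> e + e * (real M - 1)"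
      using close[OF that(1) p0 that(2)] unfolding eq by linarith
    also have "\<dots> = S" using M by (simp add: e_def field_simps)
    finally show ?thesis .
  qed
  show ?thesis
  proof (intro exI[of _ "h ` F"] conjI ballI)
    show "h ` F \<subseteq> {..<n} \<rightarrow>\<^sub>E UNIV" by (simp add: h_def image_subset_iff PiE_iff)
    show "(S / 2) ^ n / (\<Prod>i<n. R i i) \<le> real (card (h ` F))" using cardF card_image[OF inj] by simp
  qed (use finF bound in auto)
qed

lemma det_gram:
  fixes a :: "nat \<Rightarrow> nat \<Rightarrow> complex"
  shows "det (mat n n (\<lambda>(i, k). \<Sum>j<n. a i j * cnj (a k j))) =
    complex_of_real ((cmod (det (mat n n (\<lambda>(i, j). a i j))))\<^sup>2)"
proof -
  let ?A = "mat n n (\<lambda>(i, j). a i j)"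
  define A' where "A' = mat n n (\<lambda>(j, k). cnj (a k j))"
  have carr: "?A \<in> carrier_mat n n" "A' \<in> carrier_mat n n" by (simp_all add: A'_def)
  have "mat n n (\<lambda>(i, k). \<Sum>j<n. a i j * cnj (a k j)) = ?A * A'"
    by (rule eq_matI) (auto simp: A'_def scalar_prod_def lessThan_atLeast0)
  moreover have "det A' = cnj (det ?A)"
  proof -
    have "A' = map_mat cnj (?A\<^sup>T)" by (rule eq_matI) (auto simp: A'_def)
    moreover have "comm_ring_hom cnj" by unfold_locales auto
    ultimately show ?thesis
      using comm_ring_hom.hom_det[of cnj "?A\<^sup>T"] det_transpose[OF carr(1)] by simp
  qed
  ultimately show ?thesis by (simp only: det_mult[OF carr] complex_norm_square)
qed

text \<open>The Gram matrix of the rows being real, it is \<open>R\<^sup>T R\<close> with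
  \<open>R\<close> real triangular, and the product of the diagonal of \<open>R\<close> is the
  absolute value of the determinant.\<close>
lemma lattice_points_of_matrix:
  fixes a :: "nat \<Rightarrow> nat \<Rightarrow> complex"
  assumes real: "\<And>i k. i < n \<Longrightarrow> k < n \<Longrightarrow> (\<Sum>j<n. a i j * cnj (a k j)) \<in> \<real>"
    and det0: "det (mat n n (\<lambda>(i, j). a i j)) \<noteq> 0" and S: "0 < S"
  shows "\<exists>C :: (nat \<Rightarrow> int) set. finite C \<and> C \<subseteq> {..<n} \<rightarrow>\<^sub>E UNIV \<and>
     (S / 2) ^ n / cmod (det (mat n n (\<lambda>(i, j). a i j))) \<le> real (card C) \<and>
     (\<forall>c\<in>C. \<forall>j<n. cmod (\<Sum>i<n. of_int (c i) * a i j) \<le> real n * S)"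
proof -
  let ?A = "mat n n (\<lambda>(i, j). a i j)"
  obtain R where R: "\<And>i k. i < k \<Longrightarrow> R i k = (0::real)" "\<And>i. i < n \<Longrightarrow> 0 \<le> R i i"
    "\<And>i k. i < n \<Longrightarrow> k < n \<Longrightarrow> Re (\<Sum>j<n. a i j * cnj (a k j)) = (\<Sum>j<n. R j i * R j k)"
    "\<And>x. (\<Sum>j<n. (cmod (\<Sum>i<n. of_real (x i) * a i j))\<^sup>2) = (\<Sum>j<n. (\<Sum>k<n. R j k * x k)\<^sup>2)"
    using hermitian_form_triangular[where d = n and n = n and a = a] by blast
  define RR where "RR = mat n n (\<lambda>(i, j). complex_of_real (R i j))"
  have carr: "RR \<in> carrier_mat n n" by (simp add: RR_def)
  have "mat n n (\<lambda>(i, k). \<Sum>j<n. a i j * cnj (a k j)) = RR\<^sup>T * RR"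
  proof (rule eq_matI)
    fix i k assume ik: "i < dim_row (RR\<^sup>T * RR)" "k < dim_col (RR\<^sup>T * RR)"
    then have ik: "i < n" "k < n" using carr by auto
    have "(\<Sum>j<n. a i j * cnj (a k j)) = of_real (Re (\<Sum>j<n. a i j * cnj (a k j)))"
      using real[OF ik] by (metis of_real_Re)
    also have "\<dots> = of_real (\<Sum>j<n. R j i * R j k)" using R(3)[OF ik] by simp
    also have "\<dots> = (RR\<^sup>T * RR) $$ (i, k)"
      using ik by (simp add: RR_def scalar_prod_def lessThan_atLeast0)
    finally show "mat n n (\<lambda>(i, k). \<Sum>j<n. a i j * cnj (a k j)) $$ (i, k) = (RR\<^sup>T * RR) $$ (i, k)"
      using ik by simp
  qed (auto simp: RR_def)
  then have "complex_of_real ((cmod (det ?A))\<^sup>2) = det RR * det RR"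
    using det_mult[of "RR\<^sup>T" n RR] det_transpose[OF carr] carr det_gram[of n a] by simp
  moreover have "det RR = of_real (\<Prod>i<n. R i i)"
  proof -
    have "det RR = prod_list (diag_mat RR)"
      by (rule det_lower_triangular[OF _ carr]) (simp add: RR_def R(1))
    also have "\<dots> = (\<Prod>i<n. RR $$ (i, i))"
      using carr by (simp add: prod_list_diag_prod lessThan_atLeast0)
    also have "\<dots> = of_real (\<Prod>i<n. R i i)" by (simp add: RR_def)
    finally show ?thesis .
  qed
  ultimately have "complex_of_real ((cmod (det ?A))\<^sup>2) = of_real ((\<Prod>i<n. R i i)\<^sup>2)"
    by (simp only: of_real_mult power2_eq_square)
  then have "(cmod (det ?A))\<^sup>2 = (\<Prod>i<n. R i i)\<^sup>2" by (simp only: of_real_eq_iff)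
  moreover have Rn: "0 \<le> (\<Prod>i<n. R i i)" using R(2) by (intro prod_nonneg) auto
  ultimately have prodR: "(\<Prod>i<n. R i i) = cmod (det ?A)" by (simp add: power2_eq_iff_nonneg)
  have "(\<Prod>i<n. R i i) \<noteq> 0" using prodR det0 by simp
  then have Rpos: "\<And>i. i < n \<Longrightarrow> 0 < R i i" using R(2) by (auto simp: less_le)
  from many_lattice_points[of R n S, OF R(1) Rpos S] obtain C :: "(nat \<Rightarrow> int) set" where
    C: "finite C" "C \<subseteq> {..<n} \<rightarrow>\<^sub>E UNIV" "(S / 2) ^ n / (\<Prod>i<n. R i i) \<le> real (card C)"
      "\<And>c i. c \<in> C \<Longrightarrow> i < n \<Longrightarrow> \<bar>\<Sum>k<n. R i k * c k\<bar> \<le> S" by blast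
  have "cmod (\<Sum>i<n. of_int (c i) * a i j) \<le> real n * S" if "c \<in> C" "j < n" for c j
  proof -
    have "(cmod (\<Sum>i<n. of_int (c i) * a i j))\<^sup>2 \<le> (\<Sum>j<n. (cmod (\<Sum>i<n. of_real (real_of_int (c i)) * a i j))\<^sup>2)"
      using that(2) by (subst of_real_of_int_eq) (intro member_le_sum, auto)
    also have "\<dots> = (\<Sum>j<n. (\<Sum>k<n. R j k * real_of_int (c k))\<^sup>2)" by (rule R(4))
    also have "\<dots> \<le> (\<Sum>j<n. S\<^sup>2)"
    proof (rule sum_mono)
      fix j assume "j \<in> {..<n}"
      then have "\<bar>\<Sum>k<n. R j k * c k\<bar> ^ 2 \<le> S ^ 2" using C(4)[OF that(1)] by (intro power_mono) auto
      then show "(\<Sum>k<n. R j k * c k)\<^sup>2 \<le> S\<^sup>2" by (simp only: power2_abs)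
    qed
    also have "\<dots> = real n * S\<^sup>2" by simp
    also have "\<dots> \<le> (real n * S)\<^sup>2"
    proof -
      have "real n \<le> (real n)\<^sup>2" using that(2) by (cases n) (auto simp: power2_eq_square)
      then show ?thesis unfolding power_mult_distrib by (rule mult_right_mono) simp
    qed
    finally show ?thesis using S by (auto intro: power2_le_imp_le[of _ "real n * S"])
  qed
  then show ?thesis using C prodR by (intro exI[of _ C]) auto
qed

text \<open>In the coordinates \<open>L\<close> the form is a sum of \<open>d\<close> squares.
  Points in the same cell of width \<open>1 / (d + 1)\<close> have a difference on which the form is
  less than \<open>1\<close>. The exponent is the number \<open>d\<close> of real parameters and not
  the number \<open>n\<close> of complex coordinates.\<close>
lemma packing_bound:
  fixes a :: "nat \<Rightarrow> nat \<Rightarrow> complex" and V :: "(nat \<Rightarrow> real) set"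
  assumes B: "0 \<le> B"
    and small: "\<And>x j. x \<in> V \<Longrightarrow> j < n \<Longrightarrow> cmod (\<Sum>i<d. of_real (x i) * a i j) \<le> B"
    and sep: "\<And>x y. x \<in> V \<Longrightarrow> y \<in> V \<Longrightarrow> x \<noteq> y \<Longrightarrow>
        1 \<le> (\<Sum>j<n. (cmod (\<Sum>i<d. of_real (x i - y i) * a i j))\<^sup>2)"
  shows "real (card V) \<le> (2 * real (d + 1) * (real n * B) + 2) ^ d"
proof -
  obtain R where R:
    "\<And>x. (\<Sum>j<n. (cmod (\<Sum>i<d. of_real (x i) * a i j))\<^sup>2) = (\<Sum>j<d. (\<Sum>k<d. R j k * x k)\<^sup>2)"
    using hermitian_form_triangular[where d = d and n = n and a = a] by blast
  define L where "L x j = (\<Sum>k<d. R j k * x k)" for x j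
  have Lb: "\<bar>L x j\<bar> \<le> real n * B" if "x \<in> V" "j < d" for x j
  proof -
    have "(L x j)\<^sup>2 \<le> (\<Sum>j<d. (L x j)\<^sup>2)" using that by (intro member_le_sum) auto
    also have "\<dots> = (\<Sum>j<n. (cmod (\<Sum>i<d. of_real (x i) * a i j))\<^sup>2)" by (simp only: L_def R)
    also have "\<dots> \<le> (\<Sum>j<n. B\<^sup>2)" using small[OF that(1)] by (intro sum_mono power_mono) auto
    also have "\<dots> = real n * B\<^sup>2" by simp
    also have "\<dots> \<le> (real n * B)\<^sup>2"
    proof -
      have "real n \<le> (real n)\<^sup>2" by (cases n) (auto simp: power2_eq_square)
      then show ?thesis unfolding power_mult_distrib by (rule mult_right_mono) simp
    qed
    finally have "(L x j)\<^sup>2 \<le> (real n * B)\<^sup>2" .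
    then show ?thesis using B by (metis abs_le_square_iff abs_of_nonneg mult_nonneg_nonneg of_nat_0_le_iff)
  qed
  define cell where "cell x = (\<lambda>j\<in>{..<d}. \<lfloor>real (d + 1) * L x j\<rfloor>)" for x
  let ?T = "real (d + 1) * (real n * B)"
  let ?B = "{..<d} \<rightarrow>\<^sub>E {\<lfloor>- ?T\<rfloor>..\<lfloor>?T\<rfloor>}"
  have sub: "cell ` V \<subseteq> ?B"
  proof (intro image_subsetI)
    fix x assume x: "x \<in> V"
    have "- ?T \<le> real (d + 1) * L x j \<and> real (d + 1) * L x j \<le> ?T" if "j < d" for j
    proof -
      have "- (real n * B) \<le> L x j" "L x j \<le> real n * B" using Lb[OF x that] by auto
      then have "real (d + 1) * - (real n * B) \<le> real (d + 1) * L x j" "real (d + 1) * L x j \<le> ?T"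
        by (intro mult_left_mono; simp)+
      then show ?thesis by simp
    qed
    then show "cell x \<in> ?B" by (auto simp: cell_def intro!: floor_mono)
  qed
  have inj: "inj_on cell V"
  proof (rule inj_onI, rule ccontr)
    fix x y assume xy: "x \<in> V" "y \<in> V" "cell x = cell y" "x \<noteq> y"
    have d: "\<bar>L x j - L y j\<bar> \<le> 1 / real (d + 1)" if "j < d" for j
    proof -
      have "\<lfloor>real (d + 1) * L x j\<rfloor> = \<lfloor>real (d + 1) * L y j\<rfloor>"
        using fun_cong[OF xy(3), of j] that by (simp add: cell_def)
      then have "\<bar>real (d + 1) * L x j - real (d + 1) * L y j\<bar> \<le> 1" by linarith
      then have "\<bar>real (d + 1) * (L x j - L y j)\<bar> \<le> 1" by (simp add: right_diff_distrib)
      then have "real (d + 1) * \<bar>L x j - L y j\<bar> \<le> 1" by (simp add: abs_mult)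
      then show ?thesis by (simp add: pos_le_divide_eq mult.commute)
    qed
    have "1 \<le> (\<Sum>j<n. (cmod (\<Sum>i<d. of_real (x i - y i) * a i j))\<^sup>2)" by (rule sep[OF xy(1,2,4)])
    also have "\<dots> = (\<Sum>j<d. (L x j - L y j)\<^sup>2)"
      by (subst R) (simp add: L_def right_diff_distrib sum_subtractf)
    also have "\<dots> \<le> (\<Sum>j<d. (1 / real (d + 1))\<^sup>2)"
    proof (rule sum_mono)
      fix j assume "j \<in> {..<d}"
      then have "\<bar>L x j - L y j\<bar> ^ 2 \<le> (1 / real (d + 1)) ^ 2" using d by (intro power_mono) auto
      then show "(L x j - L y j)\<^sup>2 \<le> (1 / real (d + 1))\<^sup>2" by (simp only: power2_abs)
    qed
    also have "\<dots> < 1"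
      using mult_nonneg_nonneg[of "real d" "real d"]
      by (simp add: power2_eq_square divide_simps) (simp add: algebra_simps add_pos_nonneg)
    finally show False by simp
  qed
  have "finite ?B" by (intro finite_PiE) auto
  then have "card V \<le> card ?B" using card_image[OF inj] card_mono[OF _ sub] by simp
  then have "real (card V) \<le> real (card ?B)" by simp
  also have "\<dots> = real (nat (\<lfloor>?T\<rfloor> - \<lfloor>- ?T\<rfloor> + 1)) ^ d" by (simp add: card_PiE)
  also have "\<dots> \<le> (2 * ?T + 2) ^ d"
  proof (intro power_mono)
    have "0 \<le> ?T" using B by simp
    then show "real (nat (\<lfloor>?T\<rfloor> - \<lfloor>- ?T\<rfloor> + 1)) \<le> 2 * ?T + 2" by linarith
  qed simp
  finally show ?thesis by (simp only: mult.assoc)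
qed

section \<open>Algebraic integers\<close>

definition int_span :: "'i set \<Rightarrow> ('i \<Rightarrow> complex) \<Rightarrow> complex set" where
  "int_span I v = range (\<lambda>c. \<Sum>k\<in>I. of_int (c k) * v k)"

lemma int_span_base: assumes "finite I" "k \<in> I" shows "v k \<in> int_span I v"
proof -
  have "(\<Sum>i\<in>I. of_int (if i = k then 1 else 0) * v i) = (\<Sum>i\<in>I. if i = k then v i else 0)"
    by (intro sum.cong) auto
  then show ?thesis using assms unfolding int_span_def
    by (intro range_eqI[of _ _ "\<lambda>i. if i = k then 1 else 0"]) simp
qed

lemma int_span_add: "x \<in> int_span I v \<Longrightarrow> y \<in> int_span I v \<Longrightarrow> x + y \<in> int_span I v"
  unfolding int_span_def
  by (auto simp flip: sum.distrib distrib_right of_int_add)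

lemma int_span_scale: "x \<in> int_span I v \<Longrightarrow> of_int a * x \<in> int_span I v"
  unfolding int_span_def
  by (auto simp: sum_distrib_left mult.assoc[symmetric] simp flip: of_int_mult)

lemma int_span_combination:
  "(\<And>j. j \<in> J \<Longrightarrow> f j \<in> int_span I v) \<Longrightarrow> (\<Sum>j\<in>J. of_int (c j) * f j) \<in> int_span I v"
proof (induction J rule: infinite_finite_induct)
  case empty show ?case unfolding int_span_def by (intro range_eqI[of _ _ "\<lambda>_. 0"]) simp
next
  case infinite then show ?case unfolding int_span_def by (intro range_eqI[of _ _ "\<lambda>_. 0"]) simp
qed (auto intro: int_span_add int_span_scale)

text \<open>The generators form an eigenvector, with eigenvalue \<open>x\<close>, of an integer
  matrix, and the characteristic polynomial of that matrix is monic with integer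
  coefficients.\<close>
lemma algebraic_int_of_stable_span:
  fixes x :: complex
  assumes I: "finite I" and nz: "i0 \<in> I" "v i0 \<noteq> 0"
    and stable: "\<And>i. i \<in> I \<Longrightarrow> x * v i \<in> int_span I v"
  shows "algebraic_int x"
proof -
  define m where "m = card I"
  obtain g where g: "bij_betw g {..<m} I"
    using ex_bij_betw_nat_finite[OF I] by (auto simp: m_def lessThan_atLeast0)
  have "\<exists>c. x * v i = (\<Sum>k\<in>I. of_int (c k) * v k)" if "i \<in> I" for i
    using stable[OF that] by (auto simp: int_span_def)
  then obtain M where M: "\<And>i. i \<in> I \<Longrightarrow> x * v i = (\<Sum>k\<in>I. of_int (M i k) * v k)" by metis
  have eig: "x * v (g i) = (\<Sum>k<m. of_int (M (g i) (g k)) * v (g k))" if "i < m" for i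
    using M[of "g i"] bij_betwE[OF g] that sum.reindex_bij_betw[OF g, of "\<lambda>k. of_int (M (g i) k) * v k"]
    by simp
  define A where "A = mat m m (\<lambda>(i, k). M (g i) (g k))"
  have A: "A \<in> carrier_mat m m" by (simp add: A_def)
  have AC: "(map_mat of_int A :: complex mat) \<in> carrier_mat m m" using A by simp
  define w where "w = vec m (\<lambda>i. v (g i))"
  have "eigenvalue (map_mat of_int A :: complex mat) x"
  proof -
    have "(map_mat of_int A :: complex mat) *\<^sub>v w = x \<cdot>\<^sub>v w"
      by (rule eq_vecI) (auto simp: A_def w_def eig scalar_prod_def lessThan_atLeast0)
    moreover obtain i where "i < m" "g i = i0" using g nz(1) by (auto simp: bij_betw_def)
    then have "w \<noteq> 0\<^sub>v m" using nz(2) by (metis index_vec index_zero_vec(1) w_def)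
    ultimately show ?thesis
      using AC unfolding eigenvalue_def eigenvector_def by (intro exI[of _ w]) (auto simp: w_def)
  qed
  then have "poly (char_poly (map_mat of_int A :: complex mat)) x = 0"
    using eigenvalue_root_char_poly[OF AC] by simp
  then have "poly (map_poly of_int (char_poly A)) x = 0"
    by (simp add: of_int_hom.char_poly_hom[OF A])
  moreover have "lead_coeff (char_poly A) = 1"
    using degree_monic_char_poly[OF A] by simp
  ultimately show ?thesis unfolding algebraic_int_altdef_ipoly by blast
qed

lemma algebraic_int_power_relation:
  assumes "algebraic_int (x::complex)"
  shows "\<exists>a>0. \<exists>c::nat \<Rightarrow> int. x ^ a = (\<Sum>i<a. of_int (c i) * x ^ i)"
proof -
  obtain p where p: "poly (map_poly of_int p) x = 0" "lead_coeff p = 1"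
    using assms unfolding algebraic_int_altdef_ipoly by blast
  have "degree p > 0"
  proof (rule ccontr)
    assume "\<not> degree p > 0"
    then have "p = [:1:]" using p(2) by (metis degree_eq_zeroE coeff_pCons_0 degree_0 lead_coeff_pCons(2) gr0I)
    then show False using p(1) by simp
  qed
  moreover have "x ^ degree p = (\<Sum>i<degree p. of_int (- coeff p i) * x ^ i)"
  proof -
    have "0 = (\<Sum>i\<le>degree p. of_int (coeff p i) * x ^ i)"
      using p(1) by (simp add: poly_altdef coeff_map_poly degree_map_poly)
    also have "\<dots> = (\<Sum>i<degree p. of_int (coeff p i) * x ^ i) + x ^ degree p"
      using p(2) by (simp add: lessThan_Suc_atMost[symmetric])
    finally show ?thesis by (simp add: sum_negf eq_neg_iff_add_eq_0 add.commute)
  qed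
  ultimately show ?thesis by (intro exI[of _ "degree p"]) (auto intro!: exI[of _ "\<lambda>i. - coeff p i"])
qed

text \<open>The span of the products of powers of \<open>x\<close> and \<open>y\<close> is stable
  under both.\<close>
lemma algebraic_int_add_mult:
  assumes "algebraic_int (x::complex)" "algebraic_int y"
  shows "algebraic_int (x + y)" "algebraic_int (x * y)"
proof -
  obtain a c where a: "a > 0" and c: "x ^ a = (\<Sum>i<a. of_int (c i) * x ^ i)"
    using algebraic_int_power_relation[OF assms(1)] by blast
  obtain b d where b: "b > 0" and d: "y ^ b = (\<Sum>i<b. of_int (d i) * y ^ i)"
    using algebraic_int_power_relation[OF assms(2)] by blast
  define I where "I = {..<a} \<times> {..<b}"
  define v where "v = (\<lambda>(i, j). x ^ i * y ^ j)"
  have fin: "finite I" by (simp add: I_def)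
  note base = int_span_base[OF fin, of _ v]
  have stable_x: "x * v p \<in> int_span I v" if "p \<in> I" for p
  proof -
    obtain i j where p: "p = (i, j)" "i < a" "j < b" using \<open>p \<in> I\<close> unfolding I_def by blast
    show ?thesis
    proof (cases "Suc i < a")
      case True
      then show ?thesis using base[of "(Suc i, j)"] p by (simp add: v_def I_def mult_ac)
    next
      case False
      then have "Suc i = a" using p by simp
      then have "x * v p = x ^ a * y ^ j" using p by (auto simp: v_def)
      also have "\<dots> = (\<Sum>i<a. of_int (c i) * v (i, j))" by (simp add: c v_def sum_distrib_right mult.assoc)
      finally show ?thesis using base p by (auto intro!: int_span_combination simp: I_def)
    qed
  qed
  have stable_y: "y * v p \<in> int_span I v" if "p \<in> I" for p
  proof -
    obtain i j where p: "p = (i, j)" "i < a" "j < b" using \<open>p \<in> I\<close> unfolding I_def by blast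
    show ?thesis
    proof (cases "Suc j < b")
      case True
      then show ?thesis using base[of "(i, Suc j)"] p by (simp add: v_def I_def mult_ac)
    next
      case False
      then have "Suc j = b" using p by simp
      then have "y * v p = y ^ b * x ^ i" using p by (auto simp: v_def)
      also have "\<dots> = (\<Sum>j<b. of_int (d j) * v (i, j))" by (simp add: d v_def sum_distrib_left mult_ac)
      finally show ?thesis using base p by (auto intro!: int_span_combination simp: I_def)
    qed
  qed
  have nz: "(0, 0) \<in> I" "v (0, 0) \<noteq> 0" using a b by (auto simp: v_def I_def)
  show "algebraic_int (x + y)"
    by (rule algebraic_int_of_stable_span[where v = v, OF fin nz]) (simp add: distrib_right int_span_add stable_x stable_y)
  have "x * z \<in> int_span I v" if z: "z \<in> int_span I v" for z
  proof -
    obtain e where "z = (\<Sum>k\<in>I. of_int (e k) * v k)" using z by (auto simp: int_span_def)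
    then have "x * z = (\<Sum>k\<in>I. of_int (e k) * (x * v k))" by (simp add: sum_distrib_left mult_ac)
    then show ?thesis using stable_x by (simp add: int_span_combination)
  qed
  then show "algebraic_int (x * y)"
    by (intro algebraic_int_of_stable_span[where v = v, OF fin nz]) (simp add: mult.assoc stable_y)
qed

lemma algebraic_int_sum:
  "(\<And>i. i \<in> I \<Longrightarrow> algebraic_int (f i :: complex)) \<Longrightarrow> algebraic_int (\<Sum>i\<in>I. f i)"
  by (induction I rule: infinite_finite_induct) (auto intro: algebraic_int_add_mult)

lemma algebraic_int_prod:
  "(\<And>i. i \<in> I \<Longrightarrow> algebraic_int (f i :: complex)) \<Longrightarrow> algebraic_int (\<Prod>i\<in>I. f i)"
  by (induction I rule: infinite_finite_induct) (auto intro: algebraic_int_add_mult int_imp_algebraic_int)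

lemma algebraic_int_of_int: "algebraic_int (of_int k :: complex)"
  by (rule int_imp_algebraic_int) simp

text \<open>Multiplying by the leading coefficient \<open>c\<close> of an integral equation: if
  \<open>\<Sum> a\<^sub>i x\<^sup>i = 0\<close> with \<open>a\<^sub>d = c\<close>, then
  \<open>\<Sum> a\<^sub>i c\<^sup>d\<^sup>-\<^sup>1\<^sup>-\<^sup>i (c x)\<^sup>i = 0\<close> is
  monic in \<open>c x\<close>.\<close>
lemma algebraic_multiple_integral:
  assumes "algebraic (x::complex)"
  shows "\<exists>c::int. c \<noteq> 0 \<and> algebraic_int (of_int c * x)"
proof -
  obtain p where p: "p \<noteq> 0" "poly (map_poly of_int p) x = 0" using assms by (erule algebraicE')
  define d c where "d = degree p" "c = lead_coeff p"
  have c0: "c \<noteq> 0" using p(1) by (simp add: d_c_def)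
  have sum0: "(\<Sum>i\<le>d. of_int (coeff p i) * x ^ i) = 0"
    using p(2) by (simp add: poly_altdef coeff_map_poly degree_map_poly d_c_def)
  have d: "0 < d"
  proof (rule ccontr)
    assume "\<not> 0 < d"
    then have "d = 0" by simp
    then show False using sum0 c0 by (simp add: d_c_def)
  qed
  define q :: "complex poly" where "q = monom 1 d + (\<Sum>i<d. monom (of_int (coeff p i * c ^ (d - 1 - i))) i)"
  have degs: "degree (\<Sum>i<d. monom (of_int (coeff p i * c ^ (d - 1 - i))) i :: complex poly) < d"
    using d by (intro degree_sum_less) (auto intro: le_less_trans[OF degree_monom_le])
  then have dq: "degree q = d" unfolding q_def
    by (subst degree_add_eq_left) (auto simp: degree_monom_eq)
  have "coeff q d = 1" using degs by (simp add: q_def coeff_eq_0)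
  then have "lead_coeff q = 1" using dq by simp
  moreover have "\<forall>i. coeff q i \<in> \<int>"
    unfolding q_def by (auto simp: coeff_sum coeff_monom intro!: Ints_sum)
  moreover have "poly q (of_int c * x) = 0"
  proof -
    have "poly q (of_int c * x) = (of_int c * x) ^ d + (\<Sum>i<d. of_int (coeff p i * c ^ (d - 1 - i)) * (of_int c * x) ^ i)"
      by (simp add: q_def poly_sum poly_monom)
    also have "(\<Sum>i<d. of_int (coeff p i * c ^ (d - 1 - i)) * (of_int c * x) ^ i) =
       (\<Sum>i<d. of_int c ^ (d - 1) * (of_int (coeff p i) * x ^ i))"
    proof (intro sum.cong refl)
      fix i assume "i \<in> {..<d}"
      then have "(of_int c :: complex) ^ (d - 1) = of_int c ^ (d - 1 - i) * of_int c ^ i"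
        by (simp flip: power_add)
      then show "of_int (coeff p i * c ^ (d - 1 - i)) * (of_int c * x) ^ i = of_int c ^ (d - 1) * (of_int (coeff p i) * x ^ i)"
        by (simp add: power_mult_distrib mult_ac)
    qed
    also have "(of_int c * x) ^ d = of_int c ^ (d - 1) * (of_int (coeff p d) * x ^ d)"
      using d by (cases d) (auto simp: d_c_def power_mult_distrib mult_ac)
    also have "of_int c ^ (d - 1) * (of_int (coeff p d) * x ^ d) + (\<Sum>i<d. of_int c ^ (d - 1) * (of_int (coeff p i) * x ^ i)) =
      of_int c ^ (d - 1) * (\<Sum>i\<le>d. of_int (coeff p i) * x ^ i)"
      by (simp add: lessThan_Suc_atMost[symmetric] distrib_left sum_distrib_left)
    finally show ?thesis using sum0 by simp
  qed
  ultimately have "algebraic_int (of_int c * x)" by (intro algebraic_int.intros)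
  then show ?thesis using c0 by blast
qed

section \<open>Number fields as concrete subfields of the complex numbers\<close>

text \<open>The field operations are those of the type \<open>complex\<close>, and the dimension
  over \<open>\<rat>\<close> is expressed by the existence of a basis with \<open>n\<close>
  members.\<close>
locale complex_number_field =
  fixes K :: "complex set" and n :: nat
  assumes one_closed: "1 \<in> K"
    and add_closed: "x \<in> K \<Longrightarrow> y \<in> K \<Longrightarrow> x + y \<in> K"
    and mult_closed: "x \<in> K \<Longrightarrow> y \<in> K \<Longrightarrow> x * y \<in> K"
    and uminus_closed: "x \<in> K \<Longrightarrow> - x \<in> K"
    and inverse_closed: "x \<in> K \<Longrightarrow> x \<noteq> 0 \<Longrightarrow> inverse x \<in> K"
    and ex_basis: "\<exists>b. (\<forall>i<n. b i \<in> K) \<and> (\<forall>x\<in>K. \<exists>q. x = (\<Sum>i<n. of_rat (q i) * b i)) \<and>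
       (\<forall>q. (\<Sum>i<n. of_rat (q i) * b i) = 0 \<longrightarrow> (\<forall>i<n. q i = 0))"

lemma complex_field_simps:
  "carrier complex_field = UNIV" "x \<otimes>\<^bsub>complex_field\<^esub> y = x * y" "\<one>\<^bsub>complex_field\<^esub> = 1"
  "x \<oplus>\<^bsub>complex_field\<^esub> y = x + y" "\<zero>\<^bsub>complex_field\<^esub> = 0"
  by (simp_all add: ring_of_type_algebra_def)

lemma complex_field_uminus: "\<ominus>\<^bsub>complex_field\<^esub> x = - (x::complex)"
proof -
  interpret cring complex_field by (rule cring_from_type_algebra)
  show ?thesis by (rule minus_equality) (simp_all add: complex_field_simps)
qed

lemma complex_field_inv: "x \<noteq> 0 \<Longrightarrow> inv\<^bsub>complex_field\<^esub> x = inverse (x::complex)"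
proof -
  assume x: "x \<noteq> 0"
  interpret cring complex_field by (rule cring_from_type_algebra)
  show ?thesis by (rule comm_inv_char) (use x in \<open>simp_all add: complex_field_simps\<close>)
qed

lemma rationals_subfield: "subfield \<rat> complex_field"
proof -
  interpret F: Ring.field complex_field by (rule field_from_type_algebra)
  have "subring \<rat> complex_field"
    by (intro F.subringI) (auto simp: complex_field_simps complex_field_uminus)
  then show ?thesis
    by (intro F.subfieldI') (auto simp: complex_field_simps complex_field_inv)
qed

lemma combine_complex:
  assumes "length Ks = length Us"
  shows "ring.combine complex_field Ks Us = (\<Sum>i<length Us. Ks ! i * Us ! i)"
proof -
  interpret cring complex_field by (rule cring_from_type_algebra)
  show ?thesis using assms
    by (induction Ks Us rule: list_induct2) (simp_all add: complex_field_simps sum.lessThan_Suc_shift del: sum.lessThan_Suc)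
qed

lemma number_field_concrete:
  assumes "number_field K"
  shows "complex_number_field K (nf_degree K)"
proof -
  interpret F: Ring.field complex_field by (rule field_from_type_algebra)
  have sf: "subfield K complex_field" and fin: "F.finite_dimension \<rat> K"
    using assms by (auto simp: number_field_def)
  note sr = subringE[OF subfieldE(1)[OF sf], unfolded complex_field_simps complex_field_uminus]
  have dim: "F.dimension (nf_degree K) \<rat> K"
    using F.finite_dimensionE[OF rationals_subfield fin] by (simp add: nf_degree_def over_def)
  obtain Us where Us: "set Us \<subseteq> carrier complex_field" "F.independent \<rat> Us" "length Us = nf_degree K" "F.Span \<rat> Us = K"
    using F.exists_base[OF rationals_subfield dim] by blast
  note comb = F.Span_eq_combine_set_length_version[OF rationals_subfield Us(1), unfolded Us(4)]
  show ?thesis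
  proof
    show "inverse x \<in> K" if "x \<in> K" "x \<noteq> 0" for x
      using F.subfield_m_inv(1)[OF sf, of x] that by (simp add: complex_field_simps complex_field_inv)
    show "\<exists>b. (\<forall>i<nf_degree K. b i \<in> K) \<and> (\<forall>x\<in>K. \<exists>q. x = (\<Sum>i<nf_degree K. of_rat (q i) * b i)) \<and>
       (\<forall>q. (\<Sum>i<nf_degree K. of_rat (q i) * b i) = 0 \<longrightarrow> (\<forall>i<nf_degree K. q i = 0))"
    proof (intro exI[of _ "\<lambda>i. Us ! i"] conjI allI impI ballI)
      fix i assume "i < nf_degree K"
      then have "Us ! i \<in> set Us" using Us(3) by simp
      then have "Us ! i \<in> F.Span \<rat> Us" by (rule subsetD[OF F.Span_base_incl[OF rationals_subfield Us(1)]])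
      then show "Us ! i \<in> K" by (simp only: Us(4))
    next
      fix x assume "x \<in> K"
      then obtain Ks where Ks: "x = F.combine Ks Us" "length Ks = length Us" "set Ks \<subseteq> \<rat>"
        unfolding comb by blast
      have "\<exists>q. Ks ! i = of_rat q" if "i < length Us" for i
      proof -
        have "Ks ! i \<in> set Ks" using that Ks(2) by simp
        then show ?thesis using Ks(3) by (auto elim: Rats_cases)
      qed
      then have "\<exists>q. \<forall>i<length Us. Ks ! i = of_rat (q i)" by (intro exI[of _ "\<lambda>i. SOME q. Ks ! i = of_rat q"]) (auto intro: someI_ex)
      then obtain q where "\<And>i. i < length Us \<Longrightarrow> Ks ! i = of_rat (q i)" by blast
      then show "\<exists>q. x = (\<Sum>i<nf_degree K. of_rat (q i) * Us ! i)"
        using Ks(1) combine_complex[OF Ks(2)] Us(3) by (intro exI[of _ q]) simp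
    next
      fix q i assume q: "(\<Sum>i<nf_degree K. of_rat (q i) * Us ! i) = 0" and i: "i < nf_degree K"
      define Ks where "Ks = map (\<lambda>i. of_rat (q i) :: complex) [0..<nf_degree K]"
      have len: "length Ks = length Us" by (simp add: Ks_def Us(3))
      have "F.combine Ks Us = 0" unfolding combine_complex[OF len] using q by (simp add: Ks_def Us(3))
      moreover have "set Ks \<subseteq> \<rat>" by (auto simp: Ks_def)
      ultimately have "set (take (length Us) Ks) \<subseteq> {0}"
        using F.independent_imp_trivial_combine[OF rationals_subfield Us(2), of Ks]
        by (simp only: complex_field_simps)
      then have "Ks ! i = 0" using len Us(3) i by (metis nth_mem order_refl singletonD subsetD take_all)
      then show "q i = 0" using i by (simp add: Ks_def)
    qed
  qed (fact sr(3) sr(7) sr(6) sr(5))+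
qed

section \<open>Rational polynomials at complex numbers\<close>

definition rpoly :: "rat poly \<Rightarrow> complex \<Rightarrow> complex" where
  "rpoly p x = poly (map_poly of_rat p) x"

lemma map_poly_of_rat_0 [simp]: "map_poly of_rat p = (0::complex poly) \<longleftrightarrow> p = 0"
  by (auto simp: poly_eq_iff coeff_map_poly)

lemma map_poly_of_rat_add: "map_poly of_rat (p + q) = (map_poly of_rat p + map_poly of_rat q :: complex poly)"
  by (simp add: poly_eq_iff coeff_map_poly of_rat_add)

lemma map_poly_of_rat_mult: "map_poly of_rat (p * q) = (map_poly of_rat p * map_poly of_rat q :: complex poly)"
  by (simp add: poly_eq_iff coeff_map_poly coeff_mult of_rat_sum of_rat_mult)

lemma map_poly_of_rat_pderiv: "map_poly of_rat (pderiv p) = (pderiv (map_poly of_rat p) :: complex poly)"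
  by (simp add: poly_eq_iff coeff_map_poly coeff_pderiv of_rat_mult of_rat_add)

lemma degree_map_poly_of_rat [simp]: "degree (map_poly of_rat p :: complex poly) = degree p"
  by (rule degree_map_poly) simp

lemma map_poly_of_rat_pCons: "map_poly of_rat (pCons a p) = pCons (of_rat a) (map_poly of_rat p :: complex poly)"
  by (simp add: poly_eq_iff coeff_map_poly coeff_pCons split: nat.split)

lemma rpoly_simps [simp]:
  "rpoly 0 x = 0" "rpoly 1 x = 1" "rpoly (p + q) x = rpoly p x + rpoly q x" "rpoly (p * q) x = rpoly p x * rpoly q x"
  "rpoly (pCons a p) x = of_rat a + x * rpoly p x"
  by (simp_all add: rpoly_def map_poly_of_rat_add map_poly_of_rat_mult map_poly_of_rat_pCons)

lemma rpoly_uminus [simp]: "rpoly (- p) x = - rpoly p x"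
proof -
  have "rpoly (- p) x + rpoly p x = rpoly (- p + p) x" by (simp only: rpoly_simps)
  then show ?thesis by (simp add: eq_neg_iff_add_eq_0)
qed

lemma rpoly_diff [simp]: "rpoly (p - q) x = rpoly p x - rpoly q x"
  using rpoly_simps(3)[of p "- q" x] by simp

lemma rpoly_sum: "rpoly (\<Sum>i\<in>I. f i) x = (\<Sum>i\<in>I. rpoly (f i) x)"
  by (induction I rule: infinite_finite_induct) auto

lemma rpoly_monom [simp]: "rpoly (monom a k) x = of_rat a * x ^ k"
  by (simp add: rpoly_def map_poly_monom poly_monom)

lemma rpoly_pcompose: "rpoly (pcompose p q) x = rpoly p (rpoly q x)"
  by (induction p) (simp_all add: pcompose_pCons)

lemma rpoly_altdef: "rpoly p x = (\<Sum>i\<le>degree p. of_rat (coeff p i) * x ^ i)"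
  by (simp add: rpoly_def poly_altdef coeff_map_poly)

definition is_min_poly :: "rat poly \<Rightarrow> complex \<Rightarrow> bool" where
  "is_min_poly f x \<longleftrightarrow> f \<noteq> 0 \<and> rpoly f x = 0 \<and> (\<forall>g. g \<noteq> 0 \<longrightarrow> rpoly g x = 0 \<longrightarrow> degree f \<le> degree g)"

lemma min_poly_exists:
  assumes "p \<noteq> 0" "rpoly p x = 0"
  shows "\<exists>f. is_min_poly f x"
proof -
  have "\<exists>f. (f \<noteq> 0 \<and> rpoly f x = 0) \<and> (\<forall>g. g \<noteq> 0 \<and> rpoly g x = 0 \<longrightarrow> degree f \<le> degree g)"
    by (rule ex_has_least_nat[of _ p]) (use assms in auto)
  then show ?thesis unfolding is_min_poly_def by blast
qed

lemma rpoly_mod: "rpoly f x = 0 \<Longrightarrow> rpoly (g mod f) x = rpoly g x"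
proof -
  assume f: "rpoly f x = 0"
  have "rpoly g x = rpoly f x * rpoly (g div f) x + rpoly (g mod f) x"
    unfolding rpoly_simps(3,4)[symmetric] by simp
  then show ?thesis using f by simp
qed

lemma min_poly_dvd:
  assumes f: "is_min_poly f x" and g: "rpoly g x = 0"
  shows "f dvd g"
proof -
  have "rpoly (g mod f) x = 0" using f g by (simp add: is_min_poly_def rpoly_mod)
  moreover have "g mod f = 0 \<or> degree (g mod f) < degree f"
    using f by (intro degree_mod_less) (simp add: is_min_poly_def)
  ultimately show ?thesis using f unfolding is_min_poly_def by (metis mod_eq_0_iff_dvd not_less)
qed

lemma min_poly_degree_pos: "is_min_poly f x \<Longrightarrow> 0 < degree f"
  unfolding is_min_poly_def by (metis degree_eq_zeroE gr0I of_rat_eq_0_iff pCons_0_0 rpoly_simps(1,5) mult_zero_right add_0_right)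

text \<open>The derivative has smaller degree, so it does not vanish at \<open>x\<close>, and
  neither does the common divisor. Then its cofactor in \<open>f\<close> vanishes at
  \<open>x\<close>, and by minimality the common divisor is constant.\<close>
lemma min_poly_coprime_pderiv:
  assumes f: "is_min_poly f x"
  shows "Rings.coprime f (pderiv f)"
proof -
  define d where "d = gcd f (pderiv f)"
  obtain k where k: "f = d * k" unfolding d_def by (metis dvd_def gcd_dvd1)
  have f0: "f \<noteq> 0" "rpoly f x = 0" using f by (auto simp: is_min_poly_def)
  have deg: "0 < degree f" using min_poly_degree_pos[OF f] .
  have nz: "d \<noteq> 0" "k \<noteq> 0" using k f0 by auto
  have dk: "degree f = degree d + degree k" using k nz by (simp add: degree_mult_eq)
  have "rpoly d x \<noteq> 0"
  proof
    assume "rpoly d x = 0"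
    then have "rpoly (pderiv f) x = 0" unfolding d_def by (metis dvdE gcd_dvd2 mult_zero_left rpoly_simps(4))
    moreover have "pderiv f \<noteq> 0" using deg by (simp add: pderiv_eq_0_iff)
    ultimately have "degree f \<le> degree (pderiv f)" using f by (auto simp: is_min_poly_def)
    then show False using deg by (simp add: degree_pderiv)
  qed
  then have "rpoly k x = 0" using f0(2) k by simp
  then have "degree f \<le> degree k" using f nz by (auto simp: is_min_poly_def)
  then have "degree d = 0" using dk by simp
  then show ?thesis using nz unfolding d_def
    by (simp add: is_unit_iff_degree flip: is_unit_gcd)
qed

lemma min_poly_simple_roots:
  assumes f: "is_min_poly f x" and r: "rpoly f r = 0"
  shows "rpoly (pderiv f) r \<noteq> 0"
proof
  assume r': "rpoly (pderiv f) r = 0"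
  have "fst (bezout_coefficients f (pderiv f)) * f + snd (bezout_coefficients f (pderiv f)) * pderiv f = 1"
    using min_poly_coprime_pderiv[OF f] by (simp add: bezout_coefficients_fst_snd)
  then have "rpoly (fst (bezout_coefficients f (pderiv f)) * f + snd (bezout_coefficients f (pderiv f)) * pderiv f) r = 1"
    by simp
  then show False using r r' by simp
qed

lemma min_poly_roots_card:
  assumes f: "is_min_poly f x"
  shows "finite {r. rpoly f r = 0}" "card {r. rpoly f r = 0} = degree f"
proof -
  let ?F = "map_poly of_rat f :: complex poly"
  have F0: "?F \<noteq> 0" using f by (simp add: is_min_poly_def)
  have S: "{r. rpoly f r = 0} = {z. poly ?F z = 0}" by (simp add: rpoly_def)
  show "finite {r. rpoly f r = 0}" unfolding S by (rule poly_roots_finite[OF F0])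
  have "rsquarefree ?F"
    using min_poly_simple_roots[OF f] by (auto simp: rsquarefree_roots rpoly_def map_poly_of_rat_pderiv)
  from complex_poly_decompose_rsquarefree[OF this]
  have "degree ?F = degree (smult (lead_coeff ?F) (\<Prod>z | poly ?F z = 0. [:- z, 1:]))" by simp
  also have "\<dots> = (\<Sum>z | poly ?F z = 0. degree [:- z, 1:])"
    using F0 by (simp add: degree_prod_eq_sum_degree del: degree_map_poly_of_rat)
  also have "\<dots> = card {z. poly ?F z = 0}" by simp
  finally show "card {r. rpoly f r = 0} = degree f" by (simp add: S)
qed

section \<open>Polynomials over a subfield of the complex numbers\<close>

text \<open>For algebraic \<open>x\<close> the polynomial expressions in \<open>x\<close> already
  form the field generated by \<open>x\<close>.\<close>
definition rat_adjoin :: "complex \<Rightarrow> complex set" where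
  "rat_adjoin x = range (\<lambda>p. rpoly p x)"

lemma rat_adjoin_closed:
  "of_rat q \<in> rat_adjoin x" "x \<in> rat_adjoin x"
  "y \<in> rat_adjoin x \<Longrightarrow> z \<in> rat_adjoin x \<Longrightarrow> y + z \<in> rat_adjoin x"
  "y \<in> rat_adjoin x \<Longrightarrow> z \<in> rat_adjoin x \<Longrightarrow> y - z \<in> rat_adjoin x"
  "y \<in> rat_adjoin x \<Longrightarrow> z \<in> rat_adjoin x \<Longrightarrow> y * z \<in> rat_adjoin x"
proof -
  show "of_rat q \<in> rat_adjoin x" unfolding rat_adjoin_def by (rule range_eqI[of _ _ "[:q:]"]) simp
  show "x \<in> rat_adjoin x" unfolding rat_adjoin_def by (rule range_eqI[of _ _ "[:0, 1:]"]) simp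
  show "y + z \<in> rat_adjoin x" if "y \<in> rat_adjoin x" "z \<in> rat_adjoin x"
    using that unfolding rat_adjoin_def by (auto simp flip: rpoly_simps)
  show "y - z \<in> rat_adjoin x" if "y \<in> rat_adjoin x" "z \<in> rat_adjoin x"
    using that unfolding rat_adjoin_def by (auto simp flip: rpoly_diff)
  show "y * z \<in> rat_adjoin x" if "y \<in> rat_adjoin x" "z \<in> rat_adjoin x"
    using that unfolding rat_adjoin_def by (auto simp flip: rpoly_simps)
qed

lemma rat_adjoin_mono: "y \<in> rat_adjoin x \<Longrightarrow> rat_adjoin y \<subseteq> rat_adjoin x"
  unfolding rat_adjoin_def by (auto simp flip: rpoly_pcompose)

text \<open>An equation of least degree for \<open>y\<close> has a nonzero constant term; solve it
  for that term.\<close>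
lemma rat_adjoin_inverse:
  assumes y: "y \<in> rat_adjoin x" "y \<noteq> 0" and alg: "p \<noteq> 0" "rpoly p y = 0"
  shows "inverse y \<in> rat_adjoin x"
proof -
  obtain f where f: "is_min_poly f y" using min_poly_exists[OF alg] by blast
  obtain a g where g: "f = pCons a g" by (rule pCons_cases)
  have a: "a \<noteq> 0"
  proof
    assume "a = 0"
    then have "rpoly g y = 0" "g \<noteq> 0" "degree f = Suc (degree g)"
      using f g y(2) by (auto simp: is_min_poly_def)
    then show False using f by (auto simp: is_min_poly_def)
  qed
  have "of_rat a + y * rpoly g y = 0" using f g by (simp add: is_min_poly_def)
  then have "y * (of_rat (- 1 / a) * rpoly g y) = 1"
    using a by (simp add: of_rat_divide of_rat_minus field_simps) (simp add: add_eq_0_iff)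
  then have "inverse y = of_rat (- 1 / a) * rpoly g y" by (rule inverse_unique)
  moreover have "rpoly g y \<in> rat_adjoin x" using rat_adjoin_mono[OF y(1)] by (auto simp: rat_adjoin_def)
  ultimately show ?thesis using rat_adjoin_closed by metis
qed

text \<open>Division with remainder by the monic \<open>p\<close> stays within the polynomials over
  \<open>F\<close>; the remainder vanishes at \<open>b\<close> and so must be zero.\<close>
lemma least_degree_dvd:
  fixes F :: "complex set" and p u :: "complex poly"
  assumes closed: "\<And>y z. y \<in> F \<Longrightarrow> z \<in> F \<Longrightarrow> y - z \<in> F" "\<And>y z. y \<in> F \<Longrightarrow> z \<in> F \<Longrightarrow> y * z \<in> F"
    and z: "0 \<in> F"
    and p: "\<And>i. coeff p i \<in> F" "lead_coeff p = 1" "poly p b = 0"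
    and least: "\<And>u. (\<And>i. coeff u i \<in> F) \<Longrightarrow> u \<noteq> 0 \<Longrightarrow> poly u b = 0 \<Longrightarrow> degree p \<le> degree u"
    and u: "\<And>i. coeff u i \<in> F" "poly u b = 0"
  shows "p dvd u"
  using u
proof (induction "degree u" arbitrary: u rule: less_induct)
  case less
  show ?case
  proof (cases "u = 0")
    case False
    define m where "m = degree u - degree p"
    define w where "w = monom (lead_coeff u) m * p"
    have le: "degree p \<le> degree u" using least[OF less.prems(1) False less.prems(2)] .
    have p0: "p \<noteq> 0" using p(2) by auto
    have "degree w = degree (monom (lead_coeff u) m) + degree p"
      unfolding w_def using False p0 by (intro degree_mult_eq) auto
    also have "degree (monom (lead_coeff u) m) = m" using False by (intro degree_monom_eq) simp
    finally have dw: "degree w = degree u" using le by (simp add: m_def)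
    have lw: "lead_coeff w = lead_coeff u" unfolding w_def lead_coeff_mult lead_coeff_monom using p(2) by simp
    have wF: "coeff (u - w) i \<in> F" for i
      using less.prems(1) p(1) z closed by (auto simp: w_def coeff_monom_mult)
    have wb: "poly (u - w) b = 0" using less.prems(2) p(3) by (simp add: w_def)
    have "p dvd u - w"
    proof (cases "u - w = 0")
      case nz: False
      have "degree (u - w) < degree u"
      proof (rule ccontr)
        assume "\<not> degree (u - w) < degree u"
        moreover have "degree (u - w) \<le> degree u" using dw by (intro degree_diff_le) auto
        ultimately have "degree (u - w) = degree u" by simp
        then have "lead_coeff (u - w) = coeff u (degree u) - coeff w (degree u)"
          by (simp only: coeff_diff)
        also have "\<dots> = 0" using lw by (simp only: dw diff_self)
        finally show False using nz by (simp only: leading_coeff_0_iff)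
      qed
      then show ?thesis using less.hyps wF wb by blast
    qed simp
    moreover have "p dvd w" by (simp add: w_def)
    ultimately have "p dvd (u - w) + w" by (rule dvd_add)
    then show ?thesis by simp
  qed simp
qed

section \<open>Rational bases and the primitive element\<close>

context complex_number_field
begin

lemma zero_closed: "0 \<in> K"
  using add_closed[OF one_closed uminus_closed[OF one_closed]] by simp

lemma of_nat_closed: "of_nat k \<in> K"
  by (induction k) (auto intro: zero_closed add_closed one_closed)

lemma of_int_closed: "of_int k \<in> K"
  by (cases k) (auto intro: of_nat_closed uminus_closed simp del: of_nat_Suc)

lemma of_rat_closed: "of_rat q \<in> K"
proof -
  obtain a b where q: "q = Rat.Fract a b" "b > 0" by (cases q) auto
  have "of_rat q = (of_int a :: complex) * inverse (of_int b)"
    using q by (simp add: of_rat_rat divide_inverse)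
  then show ?thesis using q(2) by (auto intro: mult_closed of_int_closed inverse_closed)
qed

lemma sum_closed: "(\<And>i. i \<in> I \<Longrightarrow> f i \<in> K) \<Longrightarrow> (\<Sum>i\<in>I. f i) \<in> K"
  by (induction I rule: infinite_finite_induct) (auto intro: zero_closed add_closed)

lemma prod_closed: "(\<And>i. i \<in> I \<Longrightarrow> f i \<in> K) \<Longrightarrow> (\<Prod>i\<in>I. f i) \<in> K"
  by (induction I rule: infinite_finite_induct) (auto intro: one_closed mult_closed)

lemma power_closed: "x \<in> K \<Longrightarrow> x ^ k \<in> K"
  by (induction k) (auto intro: one_closed mult_closed)

lemma rpoly_closed: "x \<in> K \<Longrightarrow> rpoly p x \<in> K"
  by (induction p) (auto intro: zero_closed add_closed mult_closed of_rat_closed)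

lemma rat_adjoin_subset: "x \<in> K \<Longrightarrow> rat_adjoin x \<subseteq> K"
  by (auto simp: rat_adjoin_def rpoly_closed)

definition rat_independent :: "nat \<Rightarrow> (nat \<Rightarrow> complex) \<Rightarrow> bool" where
  "rat_independent m b \<longleftrightarrow> (\<forall>q. (\<Sum>i<m. of_rat (q i) * b i) = 0 \<longrightarrow> (\<forall>i<m. q i = 0))"

lemma spanned_dependent:
  assumes span: "\<And>j. j < m \<Longrightarrow> \<exists>q. b j = (\<Sum>i<d. of_rat (q i) * (a i::complex))" and "d < m"
  shows "\<not> rat_independent m b"
proof -
  obtain Q where Q: "\<And>j. j < m \<Longrightarrow> b j = (\<Sum>i<d. of_rat (Q j i) * a i)" using span by metis
  obtain c where c: "\<exists>j<m. c j \<noteq> (0::rat)" "\<And>i. i < d \<Longrightarrow> (\<Sum>j<m. Q j i * c j) = 0"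
    using underdetermined_system[OF \<open>d < m\<close>, of "\<lambda>i j. Q j i"] by blast
  have "(\<Sum>j<m. of_rat (c j) * b j) = (\<Sum>j<m. \<Sum>i<d. of_rat (Q j i * c j) * a i)"
    using Q by (intro sum.cong refl) (simp add: sum_distrib_left of_rat_mult mult_ac)
  also have "\<dots> = (\<Sum>i<d. of_rat (\<Sum>j<m. Q j i * c j) * a i)"
    by (subst sum.swap) (simp add: sum_distrib_right of_rat_sum)
  also have "\<dots> = 0" using c(2) by simp
  finally show ?thesis using c(1) unfolding rat_independent_def by blast
qed

lemma independent_le_degree:
  assumes "rat_independent m b" "\<And>i. i < m \<Longrightarrow> b i \<in> K"
  shows "m \<le> n"
proof (rule ccontr)
  assume "\<not> m \<le> n"
  then have "n < m" by simp
  obtain a where a: "\<And>x. x \<in> K \<Longrightarrow> \<exists>q. x = (\<Sum>i<n. of_rat (q i) * a i)" using ex_basis by blast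
  have "\<not> rat_independent m b" by (rule spanned_dependent[OF a[OF assms(2)] \<open>n < m\<close>])
  then show False using assms(1) by simp
qed

lemma degree_le_spanning:
  assumes "\<And>x. x \<in> K \<Longrightarrow> \<exists>q. x = (\<Sum>i<d. of_rat (q i) * (a i::complex))"
  shows "n \<le> d"
proof -
  obtain b where b: "\<And>i. i < n \<Longrightarrow> b i \<in> K" "rat_independent n b"
    using ex_basis unfolding rat_independent_def by blast
  show ?thesis
  proof (rule ccontr)
    assume "\<not> n \<le> d"
    then have "d < n" by simp
    have "\<not> rat_independent n b" by (rule spanned_dependent[OF assms[OF b(1)] \<open>d < n\<close>])
    then show False using b(2) by simp
  qed
qed

lemma independent_extend:
  assumes ind: "rat_independent k e" and no: "\<nexists>q. x = (\<Sum>i<k. of_rat (q i) * e i)"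
  shows "rat_independent (Suc k) (e(k := x))"
  unfolding rat_independent_def
proof (intro allI impI)
  fix q i assume q: "(\<Sum>i<Suc k. of_rat (q i) * (e(k := x)) i) = 0" and i: "i < Suc k"
  have s: "(\<Sum>i<k. of_rat (q i) * e i) + of_rat (q k) * x = 0" using q by simp
  have qk: "q k = 0"
  proof (rule ccontr)
    assume qk: "q k \<noteq> 0"
    have "of_rat (q k) * x = (\<Sum>i<k. - of_rat (q i) * e i)"
      using s by (simp add: sum_negf eq_neg_iff_add_eq_0 add.commute)
    then have "x = (\<Sum>i<k. - of_rat (q i) * e i) / of_rat (q k)" using qk by (simp add: field_simps)
    also have "\<dots> = (\<Sum>i<k. of_rat (- q i / q k) * e i)"
      by (simp add: sum_divide_distrib of_rat_divide of_rat_minus)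
    finally have "\<exists>q. x = (\<Sum>i<k. of_rat (q i) * e i)" by (rule exI[of _ "\<lambda>i. - q i / q k"])
    then show False using no by blast
  qed
  then have "\<forall>i<k. q i = 0" using s ind unfolding rat_independent_def by simp
  then show "q i = 0" using qk i by (auto simp: less_Suc_eq)
qed

lemma independent_spans:
  assumes ind: "rat_independent n b" and b: "\<And>i. i < n \<Longrightarrow> b i \<in> K" and x: "x \<in> K"
  shows "\<exists>q. x = (\<Sum>i<n. of_rat (q i) * b i)"
proof (rule ccontr)
  assume "\<nexists>q. x = (\<Sum>i<n. of_rat (q i) * b i)"
  from independent_extend[OF ind this] have "Suc n \<le> n"
    by (rule independent_le_degree) (use b x in \<open>auto simp: less_Suc_eq\<close>)
  then show False by simp
qed

lemma degree_pos: "0 < n"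
proof (rule ccontr)
  assume "\<not> 0 < n"
  then have "(1::complex) = 0" using ex_basis one_closed by force
  then show False by simp
qed

lemma powers_relation:
  assumes "x \<in> K" shows "\<exists>p. p \<noteq> 0 \<and> rpoly p x = 0"
proof -
  have "\<not> rat_independent (Suc n) (\<lambda>i. x ^ i)"
    using independent_le_degree[of "Suc n" "\<lambda>i. x ^ i"] power_closed[OF assms] by auto
  then obtain q j where q: "(\<Sum>i<Suc n. of_rat (q i) * x ^ i) = 0" "j < Suc n" "q j \<noteq> 0"
    unfolding rat_independent_def by blast
  define p where "p = (\<Sum>i<Suc n. monom (q i) i)"
  have "coeff p j = q j" using q(2) unfolding p_def by (subst coeff_sum) (simp add: coeff_monom sum.delta del: sum.lessThan_Suc)
  then have "p \<noteq> 0" using q(3) by auto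
  moreover have "rpoly p x = 0" using q(1) unfolding p_def by (subst rpoly_sum) (simp del: sum.lessThan_Suc)
  ultimately show ?thesis by blast
qed

lemma algebraic_in_field: assumes "x \<in> K" shows "algebraic x"
proof -
  obtain p where p: "p \<noteq> 0" "rpoly p x = 0" using powers_relation[OF assms] by blast
  show ?thesis
    unfolding algebraic_altdef using p by (intro exI[of _ "map_poly of_rat p"]) (auto simp: coeff_map_poly rpoly_def)
qed

lemma rat_adjoin_inverse_closed:
  assumes "x \<in> K" "y \<in> rat_adjoin x" "y \<noteq> 0" shows "inverse y \<in> rat_adjoin x"
  using powers_relation[of y] rat_adjoin_subset[OF assms(1)] rat_adjoin_inverse[OF assms(2,3)] assms(2) by blast

text \<open>The classical choice \<open>g = a + c b\<close>, with \<open>c\<close> avoiding finitely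
  many values. Then \<open>b\<close> is the only common root of its own minimal polynomial and of a
  polynomial over \<open>\<rat>(g)\<close>, and a simple one; so the polynomial of least degree over
  \<open>\<rat>(g)\<close> that vanishes at \<open>b\<close> is linear.\<close>
lemma two_generators:
  assumes a: "a \<in> K" and b: "b \<in> K"
  shows "\<exists>g\<in>K. a \<in> rat_adjoin g \<and> b \<in> rat_adjoin g"
proof -
  obtain fa where fa: "fa \<noteq> 0" "rpoly fa a = 0" using powers_relation[OF a] by blast
  obtain fb where fb: "is_min_poly fb b" using powers_relation[OF b] min_poly_exists by blast
  define Ra Rb where "Ra = {r. rpoly fa r = 0}" "Rb = {r. rpoly fb r = 0}"
  have "finite Ra" unfolding Ra_Rb_def rpoly_def using fa(1) by (intro poly_roots_finite) simp
  moreover have "finite Rb" unfolding Ra_Rb_def by (rule min_poly_roots_card(1)[OF fb])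
  ultimately have "finite ((\<lambda>(r, s). (r - a) / (b - s)) ` (Ra \<times> Rb))" by simp
  then have "\<exists>c::nat. of_nat c \<notin> (\<lambda>(r, s). (r - a) / (b - s)) ` (Ra \<times> Rb)"
  proof -
    assume "finite ((\<lambda>(r, s). (r - a) / (b - s)) ` (Ra \<times> Rb))" (is "finite ?S")
    moreover have "infinite (range (of_nat :: nat \<Rightarrow> complex))" by (rule range_inj_infinite) (simp add: inj_def)
    ultimately have "\<not> range of_nat \<subseteq> ?S" using finite_subset by blast
    then show ?thesis by blast
  qed
  then obtain c :: nat where c: "\<And>r s. r \<in> Ra \<Longrightarrow> s \<in> Rb \<Longrightarrow> of_nat c \<noteq> (r - a) / (b - s)" by force
  define g where "g = a + of_nat c * b"
  have gK: "g \<in> K" unfolding g_def by (intro add_closed mult_closed of_nat_closed a b)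
  let ?F = "rat_adjoin g"
  have nat_F: "of_nat k \<in> ?F" for k using rat_adjoin_closed(1)[of "of_nat k" g] by simp
  have zero_F: "0 \<in> ?F" using nat_F[of 0] by simp
  have sum_F: "(\<Sum>i\<in>I. h i) \<in> ?F" if "\<And>i. i \<in> I \<Longrightarrow> h i \<in> ?F" for I :: "nat set" and h
    using that by (induction I rule: infinite_finite_induct) (auto intro: zero_F rat_adjoin_closed(3))
  define P where "P p \<longleftrightarrow> (\<forall>i. coeff p i \<in> ?F)" for p
  have P_mult: "P (p * q)" if "P p" "P q" for p q
    using that unfolding P_def coeff_mult by (auto intro!: sum_F rat_adjoin_closed(5))
  have P_add: "P (p + q)" if "P p" "P q" for p q
    using that unfolding P_def by (auto intro: rat_adjoin_closed(3))
  have P_pCons: "P (pCons x p)" if "x \<in> ?F" "P p" for x p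
    using that unfolding P_def by (auto simp: coeff_pCons split: nat.split)
  have P_0: "P 0" unfolding P_def using zero_F by simp
  have P_rat: "P (map_poly of_rat p)" for p
    unfolding P_def by (auto simp: coeff_map_poly intro: rat_adjoin_closed(1))
  have P_pcompose: "P (pcompose p q)" if "P p" "P q" for p q
    using that(1)
  proof (induction p)
    case (pCons x p)
    have "coeff (pCons x p) 0 \<in> ?F" "\<And>i. coeff (pCons x p) (Suc i) \<in> ?F" using pCons.prems unfolding P_def by blast+
    then have "x \<in> ?F" "P p" unfolding P_def by auto
    then show ?case using pCons.IH P_add P_mult P_pCons P_0 that(2) by (simp add: pcompose_pCons)
  qed (simp add: P_0)
  \<comment> \<open>the polynomials \<open>fb\<close> and \<open>fa (g - c X)\<close> over \<open>\<rat>(g)\<close> have only the root \<open>b\<close> in common\<close>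
  define h where "h = pcompose (map_poly of_rat fa) [:g, - of_nat c:]"
  have lin: "P [:g, - of_nat c:]"
    using rat_adjoin_closed(4)[OF zero_F nat_F[of c]] by (intro P_pCons P_0 rat_adjoin_closed(2)) simp
  have Ph: "P h" unfolding h_def by (intro P_pcompose P_rat lin)
  have hb: "poly h b = 0" using fa(2) by (simp add: h_def poly_pcompose g_def rpoly_def)
  have fbb: "poly (map_poly of_rat fb) b = 0" "map_poly of_rat fb \<noteq> (0::complex poly)"
    using fb by (auto simp: is_min_poly_def rpoly_def)
  obtain p0 where p0: "P p0" "p0 \<noteq> 0" "poly p0 b = 0"
    "\<And>u. P u \<Longrightarrow> u \<noteq> 0 \<Longrightarrow> poly u b = 0 \<Longrightarrow> degree p0 \<le> degree u"
  proof -
    have "\<exists>p. (P p \<and> p \<noteq> 0 \<and> poly p b = 0) \<and> (\<forall>u. P u \<and> u \<noteq> 0 \<and> poly u b = 0 \<longrightarrow> degree p \<le> degree u)"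
      by (rule ex_has_least_nat[of _ "map_poly of_rat fb"]) (use fbb P_rat in auto)
    then show ?thesis using that by blast
  qed
  define p where "p = smult (inverse (lead_coeff p0)) p0"
  have lc: "lead_coeff p0 \<in> ?F" "lead_coeff p0 \<noteq> 0" using p0(1,2) by (auto simp: P_def)
  have pF: "coeff p i \<in> ?F" for i
    using p0(1) rat_adjoin_inverse_closed[OF gK lc] unfolding p_def P_def by (auto intro: rat_adjoin_closed(5))
  have pl: "lead_coeff p = 1" using lc(2) by (simp add: p_def)
  have pb: "poly p b = 0" using p0(3) by (simp add: p_def)
  have pleast: "degree p \<le> degree u" if "\<And>i. coeff u i \<in> ?F" "u \<noteq> 0" "poly u b = 0" for u
    using p0(4)[of u] that lc(2) unfolding p_def P_def by simp
  have dvd: "p dvd u" if "P u" "poly u b = 0" for u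
    by (rule least_degree_dvd[of ?F p b u]) (use that pF pl pb pleast zero_F rat_adjoin_closed in \<open>auto simp: P_def\<close>)
  have ph: "p dvd h" using dvd Ph hb by blast
  have pfb: "p dvd map_poly of_rat fb" using dvd P_rat fbb(1) by blast
  have only: "s = b" if "poly p s = 0" for s
  proof (rule ccontr)
    assume "s \<noteq> b"
    have s: "s \<in> Rb" using that pfb by (auto simp: Ra_Rb_def rpoly_def elim: dvdE)
    have "poly h s = 0" using that ph by (auto elim: dvdE)
    then have "g - of_nat c * s \<in> Ra" by (simp add: Ra_Rb_def rpoly_def h_def poly_pcompose mult.commute)
    from c[OF this s] show False using \<open>s \<noteq> b\<close> by (simp add: g_def field_simps)
  qed
  obtain s where s: "p = [:- b, 1:] * s" using pb by (metis poly_eq_0_iff_dvd dvdE)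
  \<comment> \<open>a second root would again be \<open>b\<close>, and \<open>b\<close> would be a double root of its minimal polynomial\<close>
  have "poly s r \<noteq> 0" for r
  proof
    assume r: "poly s r = 0"
    then have "poly p r = 0" using s by simp
    then have "r = b" by (rule only)
    then obtain s' where "s = [:- b, 1:] * s'" using r by (metis poly_eq_0_iff_dvd dvdE)
    moreover obtain w where "map_poly of_rat fb = p * w" using pfb by (elim dvdE)
    ultimately have fact: "map_poly of_rat fb = [:- b, 1:] * ([:- b, 1:] * (s' * w))" using s by (simp only: mult.assoc)
    have "poly (pderiv ([:- b, 1:] * ([:- b, 1:] * (s' * w)))) b = 0"
      by (simp add: pderiv_mult pderiv_pCons del: mult_pCons_left mult_pCons_right)
    then have "rpoly (pderiv fb) b = 0" by (simp add: rpoly_def map_poly_of_rat_pderiv fact del: mult_pCons_left mult_pCons_right)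
    then show False using min_poly_simple_roots[OF fb, of b] fb by (auto simp: is_min_poly_def)
  qed
  then have "degree s = 0" using fundamental_theorem_of_algebra[of s] by (auto simp: constant_degree)
  then obtain e where e: "s = [:e:]" by (metis degree_eq_zeroE)
  have "e = 1" using pl s e by (cases "e = 0") auto
  then have "coeff p 0 = - b" using s e by simp
  then have "- b \<in> ?F" using pF by metis
  then have bF: "b \<in> ?F" using rat_adjoin_closed(4)[OF zero_F, of "- b"] by simp
  moreover have "a \<in> ?F"
    using rat_adjoin_closed(4)[OF rat_adjoin_closed(2) rat_adjoin_closed(5)[OF nat_F[of c] bF]] by (simp add: g_def)
  ultimately show ?thesis using gK by blast
qed

theorem primitive_element: "\<exists>t\<in>K. K = rat_adjoin t"
proof -
  obtain b where b: "\<And>i. i < n \<Longrightarrow> b i \<in> K" and span: "\<And>x. x \<in> K \<Longrightarrow> \<exists>q. x = (\<Sum>i<n. of_rat (q i) * b i)"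
    using ex_basis by blast
  have "\<exists>t\<in>K. \<forall>i<m. b i \<in> rat_adjoin t" if "m \<le> n" for m
    using that
  proof (induction m)
    case 0 then show ?case using one_closed by auto
  next
    case (Suc m)
    then obtain t where t: "t \<in> K" "\<forall>i<m. b i \<in> rat_adjoin t" by auto
    obtain t' where t': "t' \<in> K" "t \<in> rat_adjoin t'" "b m \<in> rat_adjoin t'"
      using two_generators[OF t(1) b[of m]] Suc.prems by auto
    then show ?case using t(2) rat_adjoin_mono[OF t'(2)] by (auto simp: less_Suc_eq)
  qed
  from this[of n] obtain t where t: "t \<in> K" "\<And>i. i < n \<Longrightarrow> b i \<in> rat_adjoin t" by auto
  have "x \<in> rat_adjoin t" if x: "x \<in> K" for x
  proof -
    obtain q where q: "x = (\<Sum>i<n. of_rat (q i) * b i)" using span[OF x] by blast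
    have "(\<Sum>i<m. of_rat (q i) * b i) \<in> rat_adjoin t" if "m \<le> n" for m
      using that
      by (induction m) (use rat_adjoin_closed(1)[of 0 t] t(2) in \<open>auto intro!: rat_adjoin_closed(3,5) rat_adjoin_closed(1)\<close>)
    then show ?thesis using q by simp
  qed
  then show ?thesis using t(1) rat_adjoin_subset[OF t(1)] by blast
qed

lemma primitive_min_poly:
  "\<exists>t f. t \<in> K \<and> K = rat_adjoin t \<and> is_min_poly f t \<and> degree f = n"
proof -
  obtain t where t: "t \<in> K" "K = rat_adjoin t" using primitive_element by blast
  obtain f where f: "is_min_poly f t" using powers_relation[OF t(1)] min_poly_exists by blast
  let ?d = "degree f"
  have "rat_independent ?d (\<lambda>i. t ^ i)"
    unfolding rat_independent_def
  proof (intro allI impI)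
    fix q i assume q: "(\<Sum>i<?d. of_rat (q i) * t ^ i) = 0" and i: "i < ?d"
    define p where "p = (\<Sum>i<?d. monom (q i) i)"
    have "degree p < ?d" unfolding p_def using min_poly_degree_pos[OF f]
      by (intro degree_sum_less) (auto intro: le_less_trans[OF degree_monom_le])
    moreover have "rpoly p t = 0" using q by (simp add: p_def rpoly_sum)
    ultimately have "p = 0" using f by (auto simp: is_min_poly_def)
    then have "coeff p i = 0" by simp
    then show "q i = 0" using i by (simp add: p_def coeff_sum)
  qed
  then have "?d \<le> n" by (rule independent_le_degree) (rule power_closed[OF t(1)])
  moreover have "n \<le> ?d"
  proof (rule degree_le_spanning)
    fix x assume "x \<in> K"
    then obtain p where p: "x = rpoly p t" using t(2) by (auto simp: rat_adjoin_def)
    then have "x = rpoly (p mod f) t" using f by (simp add: is_min_poly_def rpoly_mod)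
    also have "\<dots> = (\<Sum>i\<le>degree (p mod f). of_rat (coeff (p mod f) i) * t ^ i)" by (rule rpoly_altdef)
    also have "\<dots> = (\<Sum>i<?d. of_rat (coeff (p mod f) i) * t ^ i)"
    proof (rule sum.mono_neutral_left)
      show "{..degree (p mod f)} \<subseteq> {..<?d}"
        using degree_mod_less'[of f p] f min_poly_degree_pos[OF f] by (cases "p mod f = 0") (auto simp: is_min_poly_def)
    qed (auto simp: coeff_eq_0 not_le)
    finally show "\<exists>q. x = (\<Sum>i<?d. of_rat (q i) * t ^ i)" by blast
  qed
  ultimately show ?thesis using t f by auto
qed

end

section \<open>Embeddings\<close>

lemma embeddings_iff:
  "s \<in> embeddings K \<longleftrightarrow> (\<forall>x\<in>K. \<forall>y\<in>K. s (x * y) = s x * s y) \<and>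
     (\<forall>x\<in>K. \<forall>y\<in>K. s (x + y) = s x + s y) \<and> s 1 = 1 \<and> s \<in> extensional K"
  by (auto simp: embeddings_def Ring.ring_hom_def complex_field_simps)

context complex_number_field
begin

lemma embedding_hom:
  assumes s: "s \<in> embeddings K"
  shows "x \<in> K \<Longrightarrow> y \<in> K \<Longrightarrow> s (x + y) = s x + s y"
    and "x \<in> K \<Longrightarrow> y \<in> K \<Longrightarrow> s (x * y) = s x * s y"
    and "s 1 = 1" and "s 0 = 0"
    and "x \<in> K \<Longrightarrow> s (- x) = - s x"
    and "s (of_rat q) = of_rat q"
proof -
  show add: "s (x + y) = s x + s y" if "x \<in> K" "y \<in> K" for x y using s that by (simp add: embeddings_iff)
  show mult: "s (x * y) = s x * s y" if "x \<in> K" "y \<in> K" for x y using s that by (simp add: embeddings_iff)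
  show one: "s 1 = 1" using s by (simp add: embeddings_iff)
  show zero: "s 0 = 0" using add[OF zero_closed zero_closed] by simp
  show minus: "s (- x) = - s x" if "x \<in> K" for x
    using add[OF that uminus_closed[OF that]] zero by (simp add: eq_neg_iff_add_eq_0 add.commute)
  have nat: "s (of_nat k) = of_nat k" for k
    by (induction k) (simp_all add: zero one add one_closed of_nat_closed)
  have int: "s (of_int k) = of_int k" for k
  proof (cases k)
    case (nonneg m) then show ?thesis using nat[of m] by simp
  next
    case (neg m) then show ?thesis using minus[OF of_nat_closed[of "Suc m"]] nat[of "Suc m"] by simp
  qed
  obtain a b where q: "q = Rat.Fract a b" "b > 0" by (cases q) auto
  have "of_rat q * of_int b = (of_int a :: complex)" using q by (simp add: of_rat_rat)
  then have "s (of_rat q) * of_int b = of_int a"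
    using mult[OF of_rat_closed of_int_closed, of q b] int by simp
  then show "s (of_rat q) = of_rat q" using q by (simp add: of_rat_rat field_simps)
qed

lemma embedding_sum:
  "s \<in> embeddings K \<Longrightarrow> (\<And>i. i \<in> I \<Longrightarrow> f i \<in> K) \<Longrightarrow> s (\<Sum>i\<in>I. f i) = (\<Sum>i\<in>I. s (f i))"
  by (induction I rule: infinite_finite_induct) (simp_all add: embedding_hom sum_closed)

lemma embedding_prod:
  "s \<in> embeddings K \<Longrightarrow> (\<And>i. i \<in> I \<Longrightarrow> f i \<in> K) \<Longrightarrow> s (\<Prod>i\<in>I. f i) = (\<Prod>i\<in>I. s (f i))"
  by (induction I rule: infinite_finite_induct) (simp_all add: embedding_hom prod_closed)

lemma embedding_power:
  "s \<in> embeddings K \<Longrightarrow> x \<in> K \<Longrightarrow> s (x ^ k) = s x ^ k"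
  by (induction k) (simp_all add: embedding_hom power_closed)

lemma embedding_rat_combination:
  assumes "s \<in> embeddings K" "\<And>i. i \<in> I \<Longrightarrow> b i \<in> K"
  shows "s (\<Sum>i\<in>I. of_rat (q i) * b i) = (\<Sum>i\<in>I. of_rat (q i) * s (b i))"
  using assms by (simp add: embedding_sum embedding_hom mult_closed of_rat_closed)

lemma embedding_rpoly: "s \<in> embeddings K \<Longrightarrow> x \<in> K \<Longrightarrow> s (rpoly p x) = rpoly p (s x)"
  by (induction p) (simp_all add: embedding_hom of_rat_closed mult_closed rpoly_closed)

lemma embedding_nonzero:
  assumes s: "s \<in> embeddings K" and x: "x \<in> K" "x \<noteq> 0" shows "s x \<noteq> 0"
proof
  assume "s x = 0"
  then have "s (x * inverse x) = 0" using embedding_hom(2)[OF s x(1) inverse_closed[OF x]] by simp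
  then show False using x(2) embedding_hom(3)[OF s] by simp
qed

lemma embedding_inj: assumes s: "s \<in> embeddings K" shows "inj_on s K"
proof (rule inj_onI)
  fix x y assume xy: "x \<in> K" "y \<in> K" "s x = s y"
  have "s (x + - y) = 0" using xy by (simp only: embedding_hom[OF s] uminus_closed) simp
  then show "x = y" using embedding_nonzero[OF s, of "x + - y"] add_closed[OF xy(1) uminus_closed[OF xy(2)]] by auto
qed

lemma embedding_algebraic_int:
  assumes s: "s \<in> embeddings K" and x: "x \<in> K" "algebraic_int x" shows "algebraic_int (s x)"
proof -
  obtain p where p: "poly (map_poly of_int p) x = 0" "lead_coeff p = 1"
    using x(2) unfolding algebraic_int_altdef_ipoly by blast
  have e: "poly (map_poly of_int p) z = rpoly (map_poly of_int p) z" for z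
    by (simp add: rpoly_def map_poly_map_poly o_def)
  have "rpoly (map_poly of_int p) (s x) = s (rpoly (map_poly of_int p) x)"
    by (simp add: embedding_rpoly[OF s x(1)])
  also have "\<dots> = 0" using p(1) embedding_hom(4)[OF s] by (simp add: e)
  finally have "poly (map_poly of_int p) (s x) = 0" by (simp add: e)
  then show ?thesis unfolding algebraic_int_altdef_ipoly using p(2) by blast
qed

text \<open>An embedding is determined by the image of a primitive element, which may be any root of
  the minimal polynomial.\<close>
lemma embeddings_roots:
  assumes t: "t \<in> K" "K = rat_adjoin t" "is_min_poly f t"
  shows "bij_betw (\<lambda>s. s t) (embeddings K) {r. rpoly f r = 0}"
  unfolding bij_betw_def
proof
  show "inj_on (\<lambda>s. s t) (embeddings K)"
  proof (rule inj_onI, rule ext)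
    fix s s' x assume s: "s \<in> embeddings K" "s' \<in> embeddings K" "s t = s' t"
    show "s x = s' x"
    proof (cases "x \<in> K")
      case True
      then obtain p where "x = rpoly p t" using t(2) by (auto simp: rat_adjoin_def)
      then show ?thesis using s(3) embedding_rpoly[OF s(1) t(1)] embedding_rpoly[OF s(2) t(1)] by simp
    next
      case False
      then show ?thesis using s by (simp add: embeddings_iff extensional_def)
    qed
  qed
  show "(\<lambda>s. s t) ` embeddings K = {r. rpoly f r = 0}"
  proof (intro equalityI subsetI)
    fix r assume "r \<in> (\<lambda>s. s t) ` embeddings K"
    then obtain s where s: "s \<in> embeddings K" "r = s t" by blast
    have "rpoly f (s t) = s (rpoly f t)" using embedding_rpoly[OF s(1) t(1)] by simp
    also have "\<dots> = 0" using t(3) embedding_hom(4)[OF s(1)] by (simp add: is_min_poly_def)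
    finally show "r \<in> {r. rpoly f r = 0}" using s(2) by simp
  next
    fix r assume "r \<in> {r. rpoly f r = 0}"
    then have r: "rpoly f r = 0" by simp
    define P where "P x = (SOME p. x = rpoly p t)" for x
    define s where "s = (\<lambda>x\<in>K. rpoly (P x) r)"
    have sp: "s (rpoly p t) = rpoly p r" for p
    proof -
      have "rpoly p t = rpoly (P (rpoly p t)) t" unfolding P_def by (rule someI[of _ p]) simp
      then have "rpoly (p - P (rpoly p t)) t = 0" by simp
      then have "f dvd p - P (rpoly p t)" by (rule min_poly_dvd[OF t(3)])
      then obtain w where "p - P (rpoly p t) = f * w" by (rule dvdE)
      then have "rpoly (p - P (rpoly p t)) r = 0" using r by simp
      then show ?thesis by (simp add: s_def rpoly_closed[OF t(1)])
    qed
    have ex: "\<exists>p. x = rpoly p t" if "x \<in> K" for x using that t(2) by (auto simp: rat_adjoin_def)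
    have "s (x * y) = s x * s y \<and> s (x + y) = s x + s y" if "x \<in> K" "y \<in> K" for x y
    proof -
      obtain p q where "x = rpoly p t" "y = rpoly q t" using ex \<open>x \<in> K\<close> \<open>y \<in> K\<close> by blast
      then show ?thesis using sp[of "p * q"] sp[of "p + q"] by (simp add: sp)
    qed
    moreover have "s 1 = 1" using sp[of 1] by simp
    moreover have "s \<in> extensional K" by (simp add: s_def)
    ultimately have "s \<in> embeddings K" by (simp add: embeddings_iff)
    moreover have "s t = r" using sp[of "[:0, 1:]"] by simp
    ultimately show "r \<in> (\<lambda>s. s t) ` embeddings K" by blast
  qed
qed

lemma card_embeddings: "finite (embeddings K)" "card (embeddings K) = n"
proof -
  obtain t f where t: "t \<in> K" "K = rat_adjoin t" "is_min_poly f t" "degree f = n"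
    using primitive_min_poly by blast
  have b: "bij_betw (\<lambda>s. s t) (embeddings K) {r. rpoly f r = 0}" by (rule embeddings_roots[OF t(1-3)])
  show "finite (embeddings K)" using bij_betw_finite[OF b] min_poly_roots_card(1)[OF t(3)] by simp
  show "card (embeddings K) = n" using bij_betw_same_card[OF b] min_poly_roots_card(2)[OF t(3)] t(4) by simp
qed

end

text \<open>The embeddings come in a fixed but arbitrary order.\<close>
locale embedded_number_field = complex_number_field +
  fixes emb :: "nat \<Rightarrow> complex \<Rightarrow> complex"
  assumes emb_bij: "bij_betw emb {..<n} (embeddings K)"
begin

lemma emb_in: "j < n \<Longrightarrow> emb j \<in> embeddings K"
  using emb_bij by (auto simp: bij_betw_def)

definition emb_mat :: "(nat \<Rightarrow> complex) \<Rightarrow> complex mat" where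
  "emb_mat b = mat n n (\<lambda>(i, j). emb j (b i))"

lemma emb_mat_carrier [simp]: "emb_mat b \<in> carrier_mat n n"
  by (simp add: emb_mat_def)

lemma emb_mat_combination:
  assumes "\<And>k. k < n \<Longrightarrow> b k \<in> K" "\<And>i. i < n \<Longrightarrow> c i = (\<Sum>k<n. of_rat (M i k) * b k)"
  shows "emb_mat c = mat n n (\<lambda>(i, k). of_rat (M i k)) * emb_mat b"
proof (rule eq_matI)
  fix i j assume "i < dim_row (mat n n (\<lambda>(i, k). of_rat (M i k)) * emb_mat b)"
    "j < dim_col (mat n n (\<lambda>(i, k). of_rat (M i k)) * emb_mat b)"
  then have ij: "i < n" "j < n" by (simp_all add: emb_mat_def)
  have "emb j (c i) = (\<Sum>k<n. of_rat (M i k) * emb j (b k))"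
    unfolding assms(2)[OF ij(1)] by (rule embedding_rat_combination[OF emb_in[OF ij(2)]]) (simp add: assms(1))
  then show "emb_mat c $$ (i, j) = (mat n n (\<lambda>(i, k). of_rat (M i k)) * emb_mat b) $$ (i, j)"
    using ij by (simp add: emb_mat_def scalar_prod_def lessThan_atLeast0)
qed (simp_all add: emb_mat_def)

lemma mat_left_kernel:
  fixes A :: "complex mat"
  assumes A: "A \<in> carrier_mat n n" and q: "\<And>j. j < n \<Longrightarrow> (\<Sum>i<n. q i * A $$ (i, j)) = 0" and i: "i < n" "q i \<noteq> 0"
  shows "det A = 0"
proof -
  have "A\<^sup>T *\<^sub>v vec n q = 0\<^sub>v n"
    using A q by (intro eq_vecI) (auto simp: scalar_prod_def lessThan_atLeast0 mult.commute)
  moreover have "vec n q \<noteq> 0\<^sub>v n" using i by (metis index_vec index_zero_vec(1))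
  ultimately have "det A\<^sup>T = 0" using det_0_iff_vec_prod_zero[of "A\<^sup>T" n] A by (metis transpose_carrier_mat vec_carrier)
  then show ?thesis using det_transpose[OF A] by simp
qed

lemma mat_left_kernel_exists:
  fixes A :: "complex mat"
  assumes A: "A \<in> carrier_mat n n" "det A = 0"
  shows "\<exists>q. (\<exists>i<n. q i \<noteq> 0) \<and> (\<forall>j<n. (\<Sum>i<n. q i * A $$ (i, j)) = 0)"
proof -
  have "det A\<^sup>T = 0" using det_transpose[OF A(1)] A(2) by simp
  then obtain v where v: "v \<in> carrier_vec n" "v \<noteq> 0\<^sub>v n" "A\<^sup>T *\<^sub>v v = 0\<^sub>v n"
    using det_0_iff_vec_prod_zero[of "A\<^sup>T" n] A by auto
  have "\<exists>i<n. v $ i \<noteq> 0" using v(1,2) by (metis carrier_vecD eq_vecI index_zero_vec)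
  moreover have "(\<Sum>i<n. v $ i * A $$ (i, j)) = 0" if "j < n" for j
  proof -
    have "(A\<^sup>T *\<^sub>v v) $ j = 0" using v(3) that by simp
    then show ?thesis using that A(1) v(1) by (simp add: scalar_prod_def lessThan_atLeast0 mult.commute)
  qed
  ultimately show ?thesis by (intro exI[of _ "\<lambda>i. v $ i"]) auto
qed

text \<open>A left kernel vector consists of the coefficients of a polynomial of degree less than
  \<open>n\<close> with the \<open>n\<close> conjugates of \<open>x\<close> as roots.\<close>
lemma det_powers:
  assumes "inj_on (\<lambda>j. emb j x) {..<n}" "x \<in> K"
  shows "det (emb_mat (\<lambda>i. x ^ i)) \<noteq> 0"
proof
  assume "det (emb_mat (\<lambda>i. x ^ i)) = 0"
  then obtain q where q: "\<exists>i<n. q i \<noteq> 0" "\<And>j. j < n \<Longrightarrow> (\<Sum>i<n. q i * emb_mat (\<lambda>i. x ^ i) $$ (i, j)) = 0"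
    using mat_left_kernel_exists[OF emb_mat_carrier] by blast
  define p where "p = (\<Sum>i<n. monom (q i) i)"
  obtain i where i: "i < n" "q i \<noteq> 0" using q(1) by blast
  have "coeff p i = q i" using i(1) by (simp add: p_def coeff_sum)
  then have p0: "p \<noteq> 0" using i(2) by auto
  have "poly p (emb j x) = 0" if "j < n" for j
    using q(2)[OF that] that by (simp add: p_def poly_sum poly_monom emb_mat_def embedding_power[OF emb_in assms(2)])
  then have "(\<lambda>j. emb j x) ` {..<n} \<subseteq> {z. poly p z = 0}" by auto
  then have "card ((\<lambda>j. emb j x) ` {..<n}) \<le> card {z. poly p z = 0}"
    by (intro card_mono poly_roots_finite p0)
  then have "n \<le> degree p" using card_poly_roots_bound[OF p0] card_image[OF assms(1)] by simp
  moreover have "degree p < n" unfolding p_def using i(1)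
    by (intro degree_sum_less) (auto intro: le_less_trans[OF degree_monom_le])
  ultimately show False by simp
qed

text \<open>For independent \<open>b\<close>, the powers of a primitive element are combinations of
  \<open>b\<close>, and their determinant is nonzero. Conversely a rational relation is a left
  kernel vector.\<close>
lemma det_independent:
  assumes b: "\<And>i. i < n \<Longrightarrow> b i \<in> K"
  shows "det (emb_mat b) \<noteq> 0 \<longleftrightarrow> rat_independent n b"
proof
  assume ind: "rat_independent n b"
  obtain t f where t: "t \<in> K" "K = rat_adjoin t" "is_min_poly f t" "degree f = n"
    using primitive_min_poly by blast
  have "inj_on (\<lambda>s. s t) (embeddings K)" using embeddings_roots[OF t(1-3)] by (simp add: bij_betw_def)
  then have "inj_on (\<lambda>j. emb j t) {..<n}"
    using emb_bij comp_inj_on[of emb "{..<n}" "\<lambda>s. s t"] by (auto simp: bij_betw_def o_def)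
  from det_powers[OF this t(1)] have nz: "det (emb_mat (\<lambda>i. t ^ i)) \<noteq> 0" .
  have "\<exists>q. t ^ i = (\<Sum>k<n. of_rat (q k) * b k)" for i
    by (rule independent_spans[OF ind b power_closed[OF t(1)]])
  then obtain M where M: "\<And>i. t ^ i = (\<Sum>k<n. of_rat (M i k) * b k)" by metis
  have "emb_mat (\<lambda>i. t ^ i) = mat n n (\<lambda>(i, k). of_rat (M i k)) * emb_mat b"
    by (rule emb_mat_combination[OF b M])
  then have "det (emb_mat (\<lambda>i. t ^ i)) = det (mat n n (\<lambda>(i, k). of_rat (M i k))) * det (emb_mat b)"
    by (simp add: det_mult[of _ n])
  then show "det (emb_mat b) \<noteq> 0" using nz by auto
next
  assume nz: "det (emb_mat b) \<noteq> 0"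
  show "rat_independent n b"
    unfolding rat_independent_def
  proof (intro allI impI, rule ccontr)
    fix q i assume q: "(\<Sum>i<n. of_rat (q i) * b i) = 0" and i: "i < n" "q i \<noteq> 0"
    have "(\<Sum>i<n. of_rat (q i) * emb_mat b $$ (i, j)) = 0" if j: "j < n" for j
    proof -
      have "(\<Sum>i<n. of_rat (q i) * emb j (b i)) = emb j (\<Sum>i<n. of_rat (q i) * b i)"
        using embedding_rat_combination[OF emb_in[OF j], of "{..<n}" b q] b by simp
      then show ?thesis using q j embedding_hom(4)[OF emb_in[OF j]] by (simp add: emb_mat_def)
    qed
    then have "det (emb_mat b) = 0" by (rule mat_left_kernel[OF emb_mat_carrier]) (use i in auto)
    then show False using nz by simp
  qed
qed

lemma ex_independent: "\<exists>b. (\<forall>i<n. b i \<in> K) \<and> rat_independent n b"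
  using ex_basis unfolding rat_independent_def by blast

text \<open>The conjugates of \<open>x\<close> are the eigenvalues of the rational matrix by which
  \<open>x\<close> acts on a basis, because the matrix of the embeddings diagonalises it.\<close>
lemma trace_norm_rational:
  assumes x: "x \<in> K"
  shows "(\<Sum>j<n. emb j x) \<in> \<rat>" "(\<Prod>j<n. emb j x) \<in> \<rat>"
proof -
  obtain b where b: "\<And>i. i < n \<Longrightarrow> b i \<in> K" "rat_independent n b" using ex_independent by blast
  have "\<exists>q. x * b i = (\<Sum>k<n. of_rat (q k) * b k)" if "i < n" for i
    by (rule independent_spans[OF b(2,1) mult_closed[OF x b(1)[OF that]]])
  then obtain M where M: "\<And>i. i < n \<Longrightarrow> x * b i = (\<Sum>k<n. of_rat (M i k) * b k)" by metis
  define MM where "MM = mat n n (\<lambda>(i, k). of_rat (M i k) :: complex)"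
  define D where "D = mat n n (\<lambda>(i, j). if i = j then emb j x else 0)"
  let ?A = "emb_mat b"
  have carr: "MM \<in> carrier_mat n n" "D \<in> carrier_mat n n" by (simp_all add: MM_def D_def)
  have "?A * D = emb_mat (\<lambda>i. x * b i)"
  proof (rule eq_matI)
    fix i j assume "i < dim_row (emb_mat (\<lambda>i. x * b i))" "j < dim_col (emb_mat (\<lambda>i. x * b i))"
    then have ij: "i < n" "j < n" by (simp_all add: emb_mat_def)
    have "(?A * D) $$ (i, j) = (\<Sum>k<n. emb k (b i) * (if k = j then emb j x else 0))"
      using ij by (simp add: emb_mat_def D_def scalar_prod_def lessThan_atLeast0)
    also have "\<dots> = (\<Sum>k<n. if k = j then emb k (b i) * emb j x else 0)" by (intro sum.cong) auto
    also have "\<dots> = emb j (b i) * emb j x" using ij by simp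
    finally show "(?A * D) $$ (i, j) = emb_mat (\<lambda>i. x * b i) $$ (i, j)"
      using ij by (simp add: emb_mat_def embedding_hom(2)[OF emb_in x b(1)])
  qed (simp_all add: emb_mat_def D_def)
  then have AD: "?A * D = MM * ?A" using emb_mat_combination[OF b(1) M] by (simp add: MM_def)
  have nz: "det ?A \<noteq> 0" using det_independent[OF b(1)] b(2) by simp
  have "det D = det MM"
    using arg_cong[OF AD, of det] det_mult[OF emb_mat_carrier carr(2)] det_mult[OF carr(1) emb_mat_carrier] nz
    by simp
  moreover have "det D = (\<Prod>j<n. emb j x)"
  proof -
    have "det D = prod_list (diag_mat D)" by (rule det_upper_triangular[OF _ carr(2)]) (auto simp: D_def upper_triangular_def)
    also have "\<dots> = (\<Prod>j<n. emb j x)"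
      using carr(2) by (simp add: prod_list_diag_prod lessThan_atLeast0 D_def)
    finally show ?thesis .
  qed
  moreover have "det MM \<in> \<rat>"
  proof -
    have "MM = map_mat of_rat (mat n n (\<lambda>(i, k). M i k))" by (rule eq_matI) (auto simp: MM_def)
    then show ?thesis by (simp add: of_rat_hom.hom_det)
  qed
  ultimately show "(\<Prod>j<n. emb j x) \<in> \<rat>" by simp
  define B where "B = (1 / det ?A) \<cdot>\<^sub>m adj_mat ?A"
  have adj: "adj_mat ?A \<in> carrier_mat n n" "?A * adj_mat ?A = det ?A \<cdot>\<^sub>m 1\<^sub>m n" "adj_mat ?A * ?A = det ?A \<cdot>\<^sub>m 1\<^sub>m n"
    using adj_mat[OF emb_mat_carrier] by auto
  have B: "B \<in> carrier_mat n n" using adj(1) by (simp add: B_def)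
  have one: "(1 / det ?A) \<cdot>\<^sub>m (det ?A \<cdot>\<^sub>m 1\<^sub>m n) = 1\<^sub>m n" by (rule eq_matI) (use nz in auto)
  have AB: "?A * B = 1\<^sub>m n"
    unfolding B_def by (simp only: mult_smult_distrib[OF emb_mat_carrier adj(1)] adj(2) one)
  have BA: "B * ?A = 1\<^sub>m n"
    unfolding B_def by (simp only: mult_smult_assoc_mat[OF adj(1) emb_mat_carrier] adj(3) one)
  have "D = (B * ?A) * D" using BA carr(2) by simp
  also have "\<dots> = B * (MM * ?A)" using B carr(2) AD by (simp add: assoc_mult_mat[OF B emb_mat_carrier carr(2)])
  finally have DB: "D = B * (MM * ?A)" .
  have ent: "emb j x = (\<Sum>i<n. \<Sum>k<n. B $$ (j, i) * (MM $$ (i, k) * ?A $$ (k, j)))" if j: "j < n" for j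
  proof -
    have "emb j x = D $$ (j, j)" using j by (simp add: D_def)
    also have "\<dots> = (B * (MM * ?A)) $$ (j, j)" using DB by simp
    also have "\<dots> = (\<Sum>i<n. B $$ (j, i) * (MM * ?A) $$ (i, j))"
      using j B carr(1) by (simp add: scalar_prod_def lessThan_atLeast0 emb_mat_def)
    also have "\<dots> = (\<Sum>i<n. \<Sum>k<n. B $$ (j, i) * (MM $$ (i, k) * ?A $$ (k, j)))"
      using j carr(1) by (intro sum.cong refl) (simp add: scalar_prod_def lessThan_atLeast0 sum_distrib_left emb_mat_def)
    finally show ?thesis .
  qed
  have AB': "(\<Sum>j<n. ?A $$ (k, j) * B $$ (j, i)) = (if k = i then 1 else 0)" if "k < n" "i < n" for k i
  proof -
    have "(?A * B) $$ (k, i) = (if k = i then 1 else 0)" using that by (simp add: AB)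
    then show ?thesis using that B by (simp add: scalar_prod_def lessThan_atLeast0 emb_mat_def)
  qed
  have "(\<Sum>j<n. emb j x) = (\<Sum>j<n. \<Sum>i<n. \<Sum>k<n. MM $$ (i, k) * (?A $$ (k, j) * B $$ (j, i)))"
    by (intro sum.cong refl) (simp add: ent mult_ac)
  also have "\<dots> = (\<Sum>i<n. \<Sum>k<n. \<Sum>j<n. MM $$ (i, k) * (?A $$ (k, j) * B $$ (j, i)))"
    by (subst sum.swap) (intro sum.cong refl sum.swap)
  also have "\<dots> = (\<Sum>i<n. \<Sum>k<n. MM $$ (i, k) * (if k = i then 1 else 0))"
    by (intro sum.cong refl) (simp add: AB' flip: sum_distrib_left)
  also have "\<dots> = (\<Sum>i<n. \<Sum>k<n. if k = i then MM $$ (i, k) else 0)"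
    by (intro sum.cong refl) simp
  also have "\<dots> = (\<Sum>i<n. of_rat (M i i))" by (simp add: MM_def)
  also have "\<dots> \<in> \<rat>" by (intro Rats_sum) auto
  finally show "(\<Sum>j<n. emb j x) \<in> \<rat>" .
qed

lemma trace_norm_integer:
  assumes x: "x \<in> K" "algebraic_int x"
  shows "(\<Sum>j<n. emb j x) \<in> \<int>" "(\<Prod>j<n. emb j x) \<in> \<int>"
proof -
  have int: "algebraic_int (emb j x)" if "j \<in> {..<n}" for j
    using embedding_algebraic_int[OF emb_in x] that by simp
  show "(\<Sum>j<n. emb j x) \<in> \<int>"
    by (rule rational_algebraic_int_is_int[OF algebraic_int_sum[OF int] trace_norm_rational(1)[OF x(1)]])
  show "(\<Prod>j<n. emb j x) \<in> \<int>"
    by (rule rational_algebraic_int_is_int[OF algebraic_int_prod[OF int] trace_norm_rational(2)[OF x(1)]])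
qed

end

section \<open>Integral bases and the discriminant\<close>

lemma common_denominator:
  fixes q :: "nat \<Rightarrow> rat"
  shows "\<exists>d::int. d \<noteq> 0 \<and> (\<forall>i<n. of_int d * q i \<in> \<int>)"
proof (induction n)
  case 0 then show ?case by (intro exI[of _ 1]) auto
next
  case (Suc n)
  then obtain d :: int where d: "d \<noteq> 0" "\<forall>i<n. of_int d * q i \<in> \<int>" by blast
  obtain a b where ab: "q n = Rat.Fract a b" "b > 0" by (cases "q n") auto
  have qb: "of_int b * q n \<in> \<int>" using ab by (simp add: Fract_of_int_quotient)
  have "of_int (d * b) * q i \<in> \<int>" if "i < Suc n" for i
  proof (cases "i = n")
    case True
    have "of_int (d * b) * q n = of_int d * (of_int b * q n)" by simp
    then show ?thesis using True qb by (metis Ints_mult Ints_of_int)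
  next
    case False
    then have "of_int d * q i \<in> \<int>" using d(2) that by simp
    moreover have "of_int (d * b) * q i = of_int b * (of_int d * q i)" by simp
    ultimately show ?thesis by (metis Ints_mult Ints_of_int)
  qed
  then show ?case using d(1) ab(2) by (intro exI[of _ "d * b"]) auto
qed

lemma of_real_of_rat: "complex_of_real (real_of_rat q) = of_rat q"
  by (cases q) (simp add: of_rat_rat)

lemma det_integer:
  assumes "\<And>i j. i < n \<Longrightarrow> j < n \<Longrightarrow> a i j \<in> \<int>"
  shows "det (mat n n (\<lambda>(i, j). a i j :: complex)) \<in> \<int>"
proof -
  have "\<exists>z. i < n \<longrightarrow> j < n \<longrightarrow> a i j = of_int z" for i j
    using assms[of i j] by (cases "i < n \<and> j < n") (auto elim: Ints_cases)
  then obtain z where "\<And>i j. i < n \<Longrightarrow> j < n \<Longrightarrow> a i j = of_int (z i j)" by metis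
  then have "mat n n (\<lambda>(i, j). a i j) = map_mat of_int (mat n n (\<lambda>(i, j). z i j))"
    by (intro eq_matI) auto
  then show ?thesis by (simp add: of_int_hom.hom_det)
qed

context embedded_number_field
begin

text \<open>Complex conjugation after an embedding is an embedding.\<close>
lemma conjugation_permutes:
  "\<exists>\<pi>. bij_betw \<pi> {..<n} {..<n} \<and> (\<forall>j<n. \<forall>x\<in>K. cnj (emb j x) = emb (\<pi> j) x)"
proof -
  have "\<exists>k<n. \<forall>x\<in>K. cnj (emb j x) = emb k x" if j: "j < n" for j
  proof -
    have "(\<lambda>x\<in>K. cnj (emb j x)) \<in> embeddings K"
      using embedding_hom[OF emb_in[OF j]]
      by (auto simp: embeddings_iff add_closed mult_closed one_closed)
    then have "(\<lambda>x\<in>K. cnj (emb j x)) \<in> emb ` {..<n}" using emb_bij by (simp add: bij_betw_def)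
    then obtain k where k: "k < n" "(\<lambda>x\<in>K. cnj (emb j x)) = emb k" by auto
    have "cnj (emb j x) = emb k x" if "x \<in> K" for x using fun_cong[OF k(2), of x] that by simp
    then show ?thesis using k(1) by blast
  qed
  then obtain \<pi> where \<pi>: "\<And>j. j < n \<Longrightarrow> \<pi> j < n" "\<And>j x. j < n \<Longrightarrow> x \<in> K \<Longrightarrow> cnj (emb j x) = emb (\<pi> j) x"
    by metis
  have inj: "inj_on \<pi> {..<n}"
  proof (rule inj_onI)
    fix j k assume jk: "j \<in> {..<n}" "k \<in> {..<n}" "\<pi> j = \<pi> k"
    have "emb j x = emb k x" for x
    proof (cases "x \<in> K")
      case True
      then have "cnj (emb j x) = cnj (emb k x)" using \<pi>(2)[of j x] \<pi>(2)[of k x] jk by simp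
      then show ?thesis by simp
    next
      case False
      then show ?thesis using emb_in[of j] emb_in[of k] jk by (simp add: embeddings_iff extensional_def)
    qed
    then have "emb j = emb k" by blast
    then show "j = k" using emb_bij jk by (auto simp: bij_betw_def inj_on_def)
  qed
  have "\<pi> ` {..<n} \<subseteq> {..<n}" using \<pi>(1) by auto
  then have "\<pi> ` {..<n} = {..<n}" using inj by (intro endo_inj_surj) auto
  then show ?thesis using \<pi>(2) inj by (intro exI[of _ \<pi>]) (auto simp: bij_betw_def)
qed

text \<open>Conjugation permutes the terms of the sum. In this way the embeddings, although complex,
  map \<open>K\<close> into a real Euclidean space of dimension \<open>n\<close>.\<close>
lemma gram_real:
  assumes "x \<in> K" "y \<in> K"
  shows "(\<Sum>j<n. emb j x * cnj (emb j y)) \<in> \<real>"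
proof -
  obtain \<pi> where \<pi>: "bij_betw \<pi> {..<n} {..<n}" "\<And>j x. j < n \<Longrightarrow> x \<in> K \<Longrightarrow> cnj (emb j x) = emb (\<pi> j) x"
    using conjugation_permutes by blast
  have "cnj (emb (\<pi> j) y) = emb j y" if "j < n" for j
    using \<pi>(2)[OF that assms(2)] by (metis complex_cnj_cnj)
  then have "cnj (\<Sum>j<n. emb j x * cnj (emb j y)) = (\<Sum>j<n. emb (\<pi> j) x * cnj (emb (\<pi> j) y))"
    using \<pi>(2) assms by (simp add: cnj_sum)
  also have "\<dots> = (\<Sum>j<n. emb j x * cnj (emb j y))"
    by (rule sum.reindex_bij_betw[OF \<pi>(1)])
  finally show ?thesis by (simp add: Reals_cnj_iff)
qed

definition integral_family :: "(nat \<Rightarrow> complex) \<Rightarrow> bool" where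
  "integral_family b \<longleftrightarrow> (\<forall>i<n. b i \<in> K \<and> algebraic_int (b i))"

text \<open>The square of the determinant is the determinant of the matrix of the traces of \<open>b
  i * b k\<close>, which are integers.\<close>
lemma discriminant_natural:
  assumes b: "integral_family b" "det (emb_mat b) \<noteq> 0"
  shows "\<exists>m::nat. 0 < m \<and> (cmod (det (emb_mat b)))\<^sup>2 = real m"
proof -
  have bK: "\<And>i. i < n \<Longrightarrow> b i \<in> K" using b by (simp add: integral_family_def)
  have "emb_mat b * (emb_mat b)\<^sup>T = mat n n (\<lambda>(i, k). \<Sum>j<n. emb j (b i * b k))"
    by (rule eq_matI) (auto simp: emb_mat_def scalar_prod_def lessThan_atLeast0 embedding_hom(2)[OF emb_in] bK
        intro!: sum.cong)
  moreover have "det (emb_mat b * (emb_mat b)\<^sup>T) = (det (emb_mat b))\<^sup>2"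
    by (simp add: det_mult[of _ n] det_transpose[of _ n] power2_eq_square)
  moreover have "det (mat n n (\<lambda>(i, k). \<Sum>j<n. emb j (b i * b k))) \<in> \<int>"
    using b by (intro det_integer trace_norm_integer) (auto simp: integral_family_def intro: mult_closed algebraic_int_add_mult)
  ultimately have "(det (emb_mat b))\<^sup>2 \<in> \<int>" by simp
  then obtain z where z: "(det (emb_mat b))\<^sup>2 = of_int z" by (elim Ints_cases)
  have "(cmod (det (emb_mat b)))\<^sup>2 = real_of_int \<bar>z\<bar>"
    using arg_cong[OF z, of cmod] by (simp add: norm_power)
  moreover have "z \<noteq> 0" using z b(2) by auto
  ultimately show ?thesis by (intro exI[of _ "nat \<bar>z\<bar>"]) auto
qed

text \<open>The norm of \<open>x\<close> is a nonzero integer, so not all conjugates are less than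
  \<open>1\<close> in absolute value.\<close>
lemma integral_separation:
  assumes x: "x \<in> K" "algebraic_int x" "x \<noteq> 0"
  shows "1 \<le> (\<Sum>j<n. (cmod (emb j x))\<^sup>2)"
proof (rule ccontr)
  assume lt: "\<not> 1 \<le> (\<Sum>j<n. (cmod (emb j x))\<^sup>2)"
  have small: "cmod (emb j x) < 1" if "j < n" for j
  proof -
    have "(cmod (emb j x))\<^sup>2 \<le> (\<Sum>j<n. (cmod (emb j x))\<^sup>2)" using that by (intro member_le_sum) auto
    then have "(cmod (emb j x))\<^sup>2 < 1" using lt by linarith
    then show ?thesis by (simp add: power_less_one_iff)
  qed
  have "cmod (\<Prod>j<n. emb j x) = cmod (emb 0 x) * (\<Prod>j\<in>{..<n} - {0}. cmod (emb j x))"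
    unfolding prod_norm[symmetric] using degree_pos by (intro prod.remove) auto
  also have "\<dots> \<le> cmod (emb 0 x) * 1"
    using small by (intro mult_left_mono prod_le_1) (auto intro: less_imp_le)
  finally have "cmod (\<Prod>j<n. emb j x) < 1" using small[OF degree_pos] by simp
  moreover obtain z where z: "(\<Prod>j<n. emb j x) = of_int z"
    using trace_norm_integer(2)[OF x(1,2)] by (elim Ints_cases)
  ultimately have "z = 0" by simp
  then have "\<exists>j<n. emb j x = 0" using z by auto
  then show False using embedding_nonzero[OF emb_in x(1,3)] by blast
qed

lemma ex_integral_family: "\<exists>b. integral_family b \<and> det (emb_mat b) \<noteq> 0"
proof -
  obtain b where b: "\<And>i. i < n \<Longrightarrow> b i \<in> K" "rat_independent n b" using ex_independent by blast
  have "\<exists>c::int. c \<noteq> 0 \<and> algebraic_int (of_int c * b i)" if "i < n" for i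
    by (rule algebraic_multiple_integral[OF algebraic_in_field[OF b(1)[OF that]]])
  then obtain c :: "nat \<Rightarrow> int" where c: "\<And>i. i < n \<Longrightarrow> c i \<noteq> 0" "\<And>i. i < n \<Longrightarrow> algebraic_int (of_int (c i) * b i)"
    by metis
  let ?b = "\<lambda>i. of_int (c i) * b i"
  have "integral_family ?b" using b(1) c(2) by (auto simp: integral_family_def intro: mult_closed of_int_closed)
  moreover have "rat_independent n ?b"
    unfolding rat_independent_def
  proof (intro allI impI)
    fix q i assume q: "(\<Sum>i<n. of_rat (q i) * ?b i) = 0" and i: "i < n"
    have "(\<Sum>i<n. of_rat (q i * of_int (c i)) * b i) = 0" using q by (simp add: of_rat_mult mult.assoc)
    then have "q i * of_int (c i) = 0"
      using b(2)[unfolded rat_independent_def, rule_format, of "\<lambda>i. q i * of_int (c i)" i] i by simp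
    then show "q i = 0" using c(1)[OF i] by simp
  qed
  ultimately show ?thesis using det_independent[of ?b] by (auto simp: integral_family_def)
qed

lemma det_replace_row:
  assumes b: "\<And>i. i < n \<Longrightarrow> b i \<in> K" and k: "k < n" and y: "y = (\<Sum>i<n. of_rat (q i) * b i)"
  shows "det (emb_mat (b(k := y))) = of_rat (q k) * det (emb_mat b)"
proof -
  let ?A = "(emb_mat b)\<^sup>T"
  let ?v = "vec n (\<lambda>i. of_rat (q i))"
  have A: "?A \<in> carrier_mat n n" by simp
  have v: "?v \<in> carrier_vec n" by simp
  have Av: "(?A *\<^sub>v ?v) $ j = emb j y" if "j < n" for j
    unfolding y using that embedding_rat_combination[OF emb_in[OF that], of "{..<n}" b q] b
    by (simp add: emb_mat_def scalar_prod_def lessThan_atLeast0 mult.commute)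
  have "(emb_mat (b(k := y)))\<^sup>T = replace_col ?A (?A *\<^sub>v ?v) k"
    using Av k by (intro eq_matI) (auto simp: emb_mat_def replace_col_def)
  then have "det ((emb_mat (b(k := y)))\<^sup>T) = of_rat (q k) * det ?A"
    using cramer_lemma_mat[OF A v k] k by simp
  then show ?thesis by (simp add: det_transpose[of _ n])
qed

text \<open>An integral family of least nonzero discriminant is an integral basis: a noninteger
  coordinate of an integer of \<open>K\<close> could be replaced by its fractional part, which would
  decrease the discriminant.\<close>
lemma integral_basis_exists: 
  "\<exists>b. integral_family b \<and> det (emb_mat b) \<noteq> 0 \<and>
    (\<forall>x\<in>K. algebraic_int x \<longrightarrow> (\<exists>c::nat \<Rightarrow> int. x = (\<Sum>i<n. of_int (c i) * b i)))"
proof -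
  define P where "P m \<longleftrightarrow> (\<exists>b. integral_family b \<and> det (emb_mat b) \<noteq> 0 \<and> (cmod (det (emb_mat b)))\<^sup>2 = real m)" for m
  have "\<exists>m. P m" using ex_integral_family discriminant_natural unfolding P_def by blast
  then have "P (LEAST m. P m)" by (rule LeastI_ex)
  then obtain b where b: "integral_family b" "det (emb_mat b) \<noteq> 0"
    "(cmod (det (emb_mat b)))\<^sup>2 = real (LEAST m. P m)" unfolding P_def by blast
  have bK: "\<And>i. i < n \<Longrightarrow> b i \<in> K" using b(1) by (simp add: integral_family_def)
  have ind: "rat_independent n b" using det_independent[of b, OF bK] b(2) by blast
  have "\<exists>c::nat \<Rightarrow> int. x = (\<Sum>i<n. of_int (c i) * b i)" if x: "x \<in> K" "algebraic_int x" for x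
  proof -
    obtain q where q: "x = (\<Sum>i<n. of_rat (q i) * b i)" using independent_spans[OF ind bK x(1)] by blast
    have "q k = of_int \<lfloor>q k\<rfloor>" if k: "k < n" for k
    proof (rule ccontr)
      assume ne: "q k \<noteq> of_int \<lfloor>q k\<rfloor>"
      define q' where "q' = q(k := q k - of_int \<lfloor>q k\<rfloor>)"
      define y where "y = x - of_int \<lfloor>q k\<rfloor> * b k"
      have fr: "0 < q' k" "q' k < 1" using ne unfolding q'_def by (simp_all add: less_le) linarith+
      have y: "y = (\<Sum>i<n. of_rat (q' i) * b i)"
      proof -
        have "(\<Sum>i<n. of_rat (q' i) * b i) = (\<Sum>i<n. of_rat (q i) * b i - (if i = k then of_int \<lfloor>q k\<rfloor> * b k else 0))"
          by (intro sum.cong refl) (auto simp: q'_def of_rat_diff algebra_simps)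
        then show ?thesis using k by (simp add: y_def q sum_subtractf)
      qed
      have yx: "y = x + of_int (- \<lfloor>q k\<rfloor>) * b k" by (simp add: y_def)
      have "b k \<in> K" "algebraic_int (b k)" using b(1) k by (simp_all add: integral_family_def)
      then have "y \<in> K" "algebraic_int y"
        unfolding yx using x
        by (intro add_closed mult_closed of_int_closed algebraic_int_add_mult algebraic_int_of_int; simp)+
      then have fam: "integral_family (b(k := y))" using b(1) by (simp add: integral_family_def)
      have det: "det (emb_mat (b(k := y))) = of_rat (q' k) * det (emb_mat b)" by (rule det_replace_row[OF bK k y])
      then have nz: "det (emb_mat (b(k := y))) \<noteq> 0" using fr b(2) by simp
      obtain m where m: "(cmod (det (emb_mat (b(k := y)))))\<^sup>2 = real m" using discriminant_natural[OF fam nz] by blast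
      then have "P m" unfolding P_def using fam nz by blast
      then have "(LEAST m. P m) \<le> m" by (rule Least_le)
      then have "(cmod (det (emb_mat b)))\<^sup>2 \<le> (cmod (det (emb_mat (b(k := y)))))\<^sup>2" using m b(3) by simp
      then have "cmod (det (emb_mat b)) \<le> cmod (det (emb_mat (b(k := y))))" by (rule power2_le_imp_le) simp
      also have "\<dots> = real_of_rat (q' k) * cmod (det (emb_mat b))"
      proof -
        have "cmod (of_rat (q' k)) = \<bar>real_of_rat (q' k)\<bar>" by (metis norm_of_real of_real_of_rat)
        then show ?thesis using fr by (simp add: det norm_mult)
      qed
      finally have "1 \<le> real_of_rat (q' k)" using b(2) by simp
      then show False using fr(2) by (simp add: of_rat_less_1_iff not_le[symmetric])
    qed
    then have "x = (\<Sum>i<n. of_int \<lfloor>q i\<rfloor> * b i)" unfolding q by (intro sum.cong refl) (metis lessThan_iff of_rat_of_int_eq)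
    then show ?thesis by (intro exI[of _ "\<lambda>i. \<lfloor>q i\<rfloor>"])
  qed
  then show ?thesis using b(1,2) by blast
qed

lemma independent_inj_int:
  assumes "rat_independent n b"
  shows "inj_on (\<lambda>c. \<Sum>i<n. of_int (c i) * b i) ({..<n} \<rightarrow>\<^sub>E (UNIV :: int set))"
proof (rule inj_onI)
  fix c c' :: "nat \<Rightarrow> int"
  assume c: "c \<in> {..<n} \<rightarrow>\<^sub>E UNIV" "c' \<in> {..<n} \<rightarrow>\<^sub>E UNIV"
    and eq: "(\<Sum>i<n. of_int (c i) * b i) = (\<Sum>i<n. of_int (c' i) * b i)"
  have "(\<Sum>i<n. of_rat (of_int (c i - c' i)) * b i) = 0"
    using eq by (simp add: of_rat_diff left_diff_distrib sum_subtractf)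
  then have "of_int (c i - c' i) = (0::rat)" if "i < n" for i
    using assms[unfolded rat_independent_def, rule_format, of "\<lambda>i. of_int (c i - c' i)" i] that by simp
  then show "c = c'" by (intro PiE_ext[OF c]) simp
qed

lemma integral_combination:
  assumes "integral_family b"
  shows "(\<Sum>i<n. of_int (c i) * b i) \<in> K" "algebraic_int (\<Sum>i<n. of_int (c i) * b i)"
  using assms unfolding integral_family_def
  by (auto intro!: sum_closed mult_closed of_int_closed algebraic_int_sum algebraic_int_add_mult(2) algebraic_int_of_int)

lemma is_integral_basisI:
  assumes n: "nf_degree K = n" and b: "integral_family b" "det (emb_mat b) \<noteq> 0"
    and span: "\<And>x. x \<in> K \<Longrightarrow> algebraic_int x \<Longrightarrow> \<exists>c::nat \<Rightarrow> int. x = (\<Sum>i<n. of_int (c i) * b i)"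
  shows "is_integral_basis K b"
  unfolding is_integral_basis_def n
proof (intro bij_betw_imageI)
  show "inj_on (\<lambda>c. \<Sum>i<n. of_int (c i) * b i) ({..<n} \<rightarrow>\<^sub>E (UNIV :: int set))"
    using det_independent[of b] b by (intro independent_inj_int) (auto simp: integral_family_def)
next
  show "(\<lambda>c. \<Sum>i<n. of_int (c i) * b i) ` ({..<n} \<rightarrow>\<^sub>E (UNIV :: int set)) = ring_of_integers K"
  proof (intro equalityI subsetI)
    fix x assume "x \<in> (\<lambda>c. \<Sum>i<n. of_int (c i) * b i) ` ({..<n} \<rightarrow>\<^sub>E (UNIV :: int set))"
    then show "x \<in> ring_of_integers K"
      using integral_combination[OF b(1)] by (auto simp: ring_of_integers_def)
  next
    fix x assume "x \<in> ring_of_integers K"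
    then obtain c :: "nat \<Rightarrow> int" where "x = (\<Sum>i<n. of_int (c i) * b i)"
      using span by (auto simp: ring_of_integers_def)
    then show "x \<in> (\<lambda>c. \<Sum>i<n. of_int (c i) * b i) ` ({..<n} \<rightarrow>\<^sub>E (UNIV :: int set))"
      by (intro image_eqI[of _ _ "restrict c {..<n}"]) auto
  qed
qed

lemma is_integral_basisD:
  assumes n: "nf_degree K = n" and b: "is_integral_basis K b"
  shows "integral_family b" "det (emb_mat b) \<noteq> 0"
    "x \<in> K \<Longrightarrow> algebraic_int x \<Longrightarrow> \<exists>c::nat \<Rightarrow> int. x = (\<Sum>i<n. of_int (c i) * b i)"
proof -
  let ?B = "{..<n} \<rightarrow>\<^sub>E (UNIV :: int set)"
  have inj: "inj_on (\<lambda>c. \<Sum>i<n. of_int (c i) * b i) ?B"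
    and im: "(\<lambda>c. \<Sum>i<n. of_int (c i) * b i) ` ?B = ring_of_integers K"
    using b unfolding is_integral_basis_def n bij_betw_def by auto
  have mem: "(\<Sum>i<n. of_int (c i) * b i) \<in> ring_of_integers K" for c :: "nat \<Rightarrow> int"
  proof -
    have "(\<Sum>i<n. of_int (c i) * b i) = (\<Sum>i<n. of_int (restrict c {..<n} i) * b i)" by (intro sum.cong) auto
    also have "\<dots> \<in> ring_of_integers K" unfolding im[symmetric] by (rule imageI) (simp add: PiE_iff extensional_def)
    finally show ?thesis .
  qed
  show fam: "integral_family b"
    unfolding integral_family_def
  proof (intro allI impI)
    fix k assume "k < n"
    have "(\<Sum>i<n. of_int (if i = k then 1 else 0) * b i) = (\<Sum>i<n. if i = k then b i else 0)"
      by (intro sum.cong) auto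
    then have "b k \<in> ring_of_integers K" using mem[of "\<lambda>i. if i = k then 1 else 0"] \<open>k < n\<close> by simp
    then show "b k \<in> K \<and> algebraic_int (b k)" by (simp add: ring_of_integers_def)
  qed
  show "\<exists>c::nat \<Rightarrow> int. x = (\<Sum>i<n. of_int (c i) * b i)" if "x \<in> K" "algebraic_int x"
  proof -
    have "x \<in> ring_of_integers K" using that by (simp add: ring_of_integers_def)
    then show ?thesis unfolding im[symmetric] by blast
  qed
  have "rat_independent n b"
    unfolding rat_independent_def
  proof (intro allI impI)
    fix q i assume q: "(\<Sum>i<n. of_rat (q i) * b i) = 0" and i: "i < n"
    obtain d :: int where d: "d \<noteq> 0" "\<forall>i<n. of_int d * q i \<in> \<int>" using common_denominator by blast
    have "\<exists>z. i < n \<longrightarrow> of_int d * q i = of_int z" for i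
      using d(2) by (cases "i < n") (auto elim: Ints_cases)
    then obtain z where z: "\<And>i. i < n \<Longrightarrow> of_int d * q i = of_int (z i)" by metis
    let ?z = "restrict z {..<n}" and ?o = "restrict (\<lambda>_. 0 :: int) {..<n}"
    have "(\<Sum>i<n. of_int (?z i) * b i) = (\<Sum>i<n. of_rat (of_int d * q i) * b i)"
      using z by (intro sum.cong) simp_all
    also have "\<dots> = of_int d * (\<Sum>i<n. of_rat (q i) * b i)"
      by (simp add: sum_distrib_left of_rat_mult mult.assoc)
    also have "\<dots> = (\<Sum>i<n. of_int (?o i) * b i)" using q by simp
    finally have "?z = ?o" by (intro inj_onD[OF inj]) auto
    then have "z i = 0" using i by (metis lessThan_iff restrict_apply')
    then show "q i = 0" using z[OF i] d(1) by simp
  qed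
  then show "det (emb_mat b) \<noteq> 0" using det_independent[of b] fam by (auto simp: integral_family_def)
qed

text \<open>The determinants differ by the integral determinant of the base change as a
  factor.\<close>
lemma discriminant_basis_change:
  assumes b: "integral_family b" "det (emb_mat b) \<noteq> 0"
    and b': "\<And>x. x \<in> K \<Longrightarrow> algebraic_int x \<Longrightarrow> \<exists>c::nat \<Rightarrow> int. x = (\<Sum>i<n. of_int (c i) * b' i)"
    and b'K: "integral_family b'"
  shows "cmod (det (emb_mat b')) \<le> cmod (det (emb_mat b))"
proof -
  have "\<exists>c::nat \<Rightarrow> int. b i = (\<Sum>k<n. of_int (c k) * b' k)" if "i < n" for i
    using b' b(1) that by (simp add: integral_family_def)
  then obtain U :: "nat \<Rightarrow> nat \<Rightarrow> int" where U: "\<And>i. i < n \<Longrightarrow> b i = (\<Sum>k<n. of_rat (of_int (U i k)) * b' k)"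
    by (simp only: of_rat_of_int_eq) metis
  have eq: "emb_mat b = mat n n (\<lambda>(i, k). of_rat (of_int (U i k))) * emb_mat b'"
    using b'K U by (intro emb_mat_combination) (auto simp: integral_family_def)
  have "det (mat n n (\<lambda>(i, k). complex_of_rat (of_int (U i k)))) \<in> \<int>" by (intro det_integer) simp
  then obtain u where u: "det (mat n n (\<lambda>(i, k). complex_of_rat (of_int (U i k)))) = of_int u" by (elim Ints_cases)
  have d: "det (emb_mat b) = of_int u * det (emb_mat b')"
    unfolding eq by (subst det_mult[of _ n]) (simp_all only: u mat_carrier emb_mat_carrier)
  then have "u \<noteq> 0" using b(2) by auto
  then have "1 \<le> cmod (of_int u)" by simp
  then have "1 * cmod (det (emb_mat b')) \<le> cmod (of_int u) * cmod (det (emb_mat b'))" by (intro mult_right_mono) auto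
  then show ?thesis using d by (simp add: norm_mult)
qed

text \<open>The squared absolute value of the determinant is the Gram determinant, whose entries are
  sums over the set of all embeddings.\<close>
lemma discriminant_independent_of_enumeration:
  assumes "bij_betw emb' {..<n} (embeddings K)"
  shows "cmod (det (mat n n (\<lambda>(i, j). emb' j (b i)))) = cmod (det (emb_mat b))"
proof -
  have "(\<Sum>j<n. emb' j x * cnj (emb' j y)) = (\<Sum>j<n. emb j x * cnj (emb j y))" for x y
    using sum.reindex_bij_betw[OF assms, of "\<lambda>s. s x * cnj (s y)"] sum.reindex_bij_betw[OF emb_bij, of "\<lambda>s. s x * cnj (s y)"]
    by simp
  then have "complex_of_real ((cmod (det (mat n n (\<lambda>(i, j). emb' j (b i)))))\<^sup>2) = complex_of_real ((cmod (det (emb_mat b)))\<^sup>2)"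
    unfolding emb_mat_def det_gram[symmetric, of n "\<lambda>i j. emb' j (b i)"] det_gram[symmetric, of n "\<lambda>i j. emb j (b i)"] by simp
  then have "(cmod (det (mat n n (\<lambda>(i, j). emb' j (b i)))))\<^sup>2 = (cmod (det (emb_mat b)))\<^sup>2"
    by (simp only: of_real_eq_iff)
  then show ?thesis by (simp add: power2_eq_iff_nonneg)
qed

lemma nf_discriminant_eq:
  assumes n: "nf_degree K = n"
  shows "\<exists>b. integral_family b \<and> det (emb_mat b) \<noteq> 0 \<and> nf_discriminant K = (cmod (det (emb_mat b)))\<^sup>2"
proof -
  obtain b where b: "integral_family b" "det (emb_mat b) \<noteq> 0"
    "\<And>x. x \<in> K \<Longrightarrow> algebraic_int x \<Longrightarrow> \<exists>c::nat \<Rightarrow> int. x = (\<Sum>i<n. of_int (c i) * b i)"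
    using integral_basis_exists by blast
  have "nf_discriminant K = (cmod (det (emb_mat b)))\<^sup>2"
    unfolding nf_discriminant_def n
  proof (rule the_equality)
    show "\<exists>\<alpha> \<tau>. is_integral_basis K \<alpha> \<and> bij_betw \<tau> {..<n} (embeddings K) \<and>
       (cmod (det (emb_mat b)))\<^sup>2 = (cmod (det (mat n n (\<lambda>(i, j). \<tau> j (\<alpha> i)))))\<^sup>2"
      using is_integral_basisI[OF n b] emb_bij unfolding emb_mat_def by blast
  next
    fix d assume "\<exists>\<alpha> \<tau>. is_integral_basis K \<alpha> \<and> bij_betw \<tau> {..<n} (embeddings K) \<and>
       d = (cmod (det (mat n n (\<lambda>(i, j). \<tau> j (\<alpha> i)))))\<^sup>2"
    then obtain a \<tau> where a: "is_integral_basis K a" "bij_betw \<tau> {..<n} (embeddings K)"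
      "d = (cmod (det (mat n n (\<lambda>(i, j). \<tau> j (a i)))))\<^sup>2" by blast
    note a' = is_integral_basisD[OF n a(1)]
    have "cmod (det (emb_mat a)) = cmod (det (emb_mat b))"
      by (intro order.antisym discriminant_basis_change a' b)
    then show "d = (cmod (det (emb_mat b)))\<^sup>2"
      using a(3) discriminant_independent_of_enumeration[OF a(2)] by simp
  qed
  then show ?thesis using b by blast
qed

end

section \<open>A basis of small algebraic integers\<close>

context embedded_number_field
begin

definition small_integers :: "real \<Rightarrow> complex set" where
  "small_integers B = {x \<in> K. algebraic_int x \<and> (\<forall>j<n. cmod (emb j x) \<le> B)}"

text \<open>A family of the greatest possible length \<open>d\<close>; lengths are bounded by
  \<open>n\<close>.\<close>
lemma maximal_independent_family:
  assumes V: "V \<subseteq> K"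
  shows "\<exists>d w. d \<le> n \<and> rat_independent d w \<and> (\<forall>i<d. w i \<in> V) \<and>
     (\<forall>x\<in>V. \<exists>q. x = (\<Sum>i<d. of_rat (q i) * w i))"
proof -
  define P where "P d \<longleftrightarrow> (\<exists>w. rat_independent d w \<and> (\<forall>i<d. w i \<in> V))" for d
  have bound: "d \<le> n" if "P d" for d
    using that V independent_le_degree unfolding P_def by blast
  have "P 0" by (simp add: P_def rat_independent_def)
  then have Pd: "P (GREATEST d. P d)" using GreatestI_nat[of P 0 n] bound by blast
  define d where "d = (GREATEST d. P d)"
  obtain w where w: "rat_independent d w" "\<And>i. i < d \<Longrightarrow> w i \<in> V" using Pd unfolding d_def P_def by blast
  have "\<exists>q. x = (\<Sum>i<d. of_rat (q i) * w i)" if x: "x \<in> V" for x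
  proof (rule ccontr)
    assume no: "\<nexists>q. x = (\<Sum>i<d. of_rat (q i) * w i)"
    have "rat_independent (Suc d) (w(d := x))" by (rule independent_extend[OF w(1) no])
    then have "P (Suc d)" unfolding P_def using w(2) x by (intro exI[of _ "w(d := x)"]) (auto simp: less_Suc_eq)
    then have "Suc d \<le> d" unfolding d_def using Greatest_le_nat[of P "Suc d" n] bound unfolding d_def by blast
    then show False by simp
  qed
  then show ?thesis using w bound[OF Pd] unfolding d_def by blast
qed

text \<open>If \<open>N\<close> lattice points lie in a subspace of dimension \<open>d \<le>
  n/2\<close>, the upper bound grows at most like \<open>S\<^sup>n\<^sup>/\<^sup>2\<close> and the
  lower one like \<open>S\<^sup>n\<close>. So \<open>S\<close> cannot be large.\<close>
lemma packing_contradiction: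
  fixes S D H N :: real
  assumes dn: "2 * d \<le> n" and n2: "2 \<le> n" and S: "1 \<le> S" and D: "0 < D" "D\<^sup>2 \<le> H"
    and lower: "(S / 2) ^ n / D \<le> N"
    and upper: "N \<le> (2 * real (d + 1) * (real n * (real n * S)) + 2) ^ d"
  shows "S ^ n \<le> (16 * real n ^ 3) ^ n * H"
proof -
  have n1: "1 \<le> real n" using n2 by simp
  have H: "0 < H" using D by (metis less_le_trans zero_less_power)
  have N: "0 \<le> N" by (rule order.trans[OF _ lower]) (use S D in simp)
  have nS: "1 \<le> real n * S" using mult_mono[of 1 "real n" 1 S] n1 S by simp
  have "2 * real (d + 1) * (real n * (real n * S)) + 2 \<le> 4 * real n ^ 3 * S"
  proof -
    have "real (d + 1) \<le> real n" using dn n2 by linarith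
    then have "2 * real (d + 1) * (real n * (real n * S)) \<le> 2 * real n * (real n * (real n * S))"
      using nS by (intro mult_right_mono) auto
    moreover have "1 * (1 * 1) \<le> real n * (real n * (real n * S))"
      using n1 nS by (intro mult_mono) auto
    ultimately have "2 * real (d + 1) * (real n * (real n * S)) + 2 \<le> 4 * (real n * (real n * (real n * S)))" by linarith
    also have "\<dots> = 4 * real n ^ 3 * S" by (simp add: power3_eq_cube)
    finally show ?thesis .
  qed
  then have "(2 * real (d + 1) * (real n * (real n * S)) + 2) ^ d \<le> (4 * real n ^ 3 * S) ^ d"
    using S by (intro power_mono) auto
  then have "N\<^sup>2 \<le> ((4 * real n ^ 3 * S) ^ d)\<^sup>2" using upper N by (intro power_mono) auto
  also have "\<dots> = (4 * real n ^ 3 * S) ^ (2 * d)" by (simp add: power_mult[symmetric] mult.commute)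
  also have "\<dots> \<le> (4 * real n ^ 3 * S) ^ n"
  proof (rule power_increasing[OF dn])
    have "1 * (1 * 1) \<le> 4 * (real n ^ 3 * S)" using n1 S by (intro mult_mono one_le_power) auto
    then show "1 \<le> 4 * real n ^ 3 * S" by simp
  qed
  finally have up: "N\<^sup>2 \<le> (4 * real n ^ 3 * S) ^ n" .
  have "((S / 2) ^ n)\<^sup>2 / H \<le> ((S / 2) ^ n)\<^sup>2 / D\<^sup>2"
    using D H by (intro divide_left_mono mult_pos_pos) auto
  also have "\<dots> = ((S / 2) ^ n / D)\<^sup>2" by (simp only: power_divide)
  also have "\<dots> \<le> N\<^sup>2" using lower S D by (intro power_mono) auto
  also note up
  finally have "((S / 2) ^ n)\<^sup>2 \<le> (4 * real n ^ 3 * S) ^ n * H" using H by (simp add: divide_le_eq)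
  moreover have "((S / 2) ^ n)\<^sup>2 = (S * S / 4) ^ n"
    by (simp add: power2_eq_square flip: power_mult_distrib)
  ultimately have "(S * S / 4) ^ n \<le> (4 * real n ^ 3 * S) ^ n * H" by simp
  moreover have "(S * S / 4) ^ n = (S / 4) ^ n * S ^ n" unfolding power_mult_distrib[symmetric] by simp
  moreover have "(4 * real n ^ 3 * S) ^ n * H = ((4 * real n ^ 3) ^ n * H) * S ^ n" unfolding power_mult_distrib by simp
  ultimately have "(S / 4) ^ n * S ^ n \<le> ((4 * real n ^ 3) ^ n * H) * S ^ n" by simp
  moreover have "0 < S ^ n" using S by simp
  ultimately have "(S / 4) ^ n \<le> (4 * real n ^ 3) ^ n * H" by (simp only: mult_le_cancel_right_pos)
  then have "4 ^ n * (S / 4) ^ n \<le> 4 ^ n * ((4 * real n ^ 3) ^ n * H)" by simp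
  also have "4 ^ n * (S / 4) ^ n = S ^ n" unfolding power_mult_distrib[symmetric] by simp
  also have "4 ^ n * ((4 * real n ^ 3) ^ n * H) = (16 * real n ^ 3) ^ n * H"
    unfolding mult.assoc[symmetric] power_mult_distrib[symmetric] by simp
  finally show ?thesis .
qed

text \<open>All integers of \<open>K\<close> with conjugates at most \<open>n S\<close> are
  combinations of the \<open>d\<close> members of a maximal independent family \<open>w\<close> of
  such integers. Their number is bounded below by the count of lattice points and above by packing
  in the coordinates with respect to \<open>w\<close>.\<close>
lemma many_small_independent:
  assumes b: "integral_family b" "det (emb_mat b) \<noteq> 0"
    and disc: "(cmod (det (emb_mat b)))\<^sup>2 \<le> H" and H: "1 \<le> H"
    and S: "1 \<le> S" "(16 * real n ^ 3) ^ n * H < S ^ n" and n2: "2 \<le> n"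
  shows "\<exists>d w. n < 2 * d \<and> d \<le> n \<and> rat_independent d w \<and> (\<forall>i<d. w i \<in> small_integers (real n * S))"
proof -
  define B where "B = real n * S"
  have B: "2 \<le> B" unfolding B_def using mult_mono[of 2 "real n" 1 S] S(1) n2 by simp
  obtain d w where w: "d \<le> n" "rat_independent d w" "\<And>i. i < d \<Longrightarrow> w i \<in> small_integers B"
    "\<And>x. x \<in> small_integers B \<Longrightarrow> \<exists>q. x = (\<Sum>i<d. of_rat (q i) * w i)"
    using maximal_independent_family[of "small_integers B"] by (auto simp: small_integers_def)
  have wK: "\<And>i. i < d \<Longrightarrow> w i \<in> K" using w(3) by (simp add: small_integers_def)
  have bK: "\<And>i. i < n \<Longrightarrow> b i \<in> K" using b(1) by (simp add: integral_family_def)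
  have ind: "rat_independent n b" using det_independent[of b, OF bK] b(2) by blast
  obtain C :: "(nat \<Rightarrow> int) set" where C: "finite C" "C \<subseteq> {..<n} \<rightarrow>\<^sub>E UNIV"
    "(S / 2) ^ n / cmod (det (emb_mat b)) \<le> real (card C)"
    "\<And>c j. c \<in> C \<Longrightarrow> j < n \<Longrightarrow> cmod (\<Sum>i<n. of_int (c i) * emb j (b i)) \<le> real n * S"
  proof -
    have real: "(\<Sum>j<n. emb j (b i) * cnj (emb j (b k))) \<in> \<real>" if "i < n" "k < n" for i k
      using that by (intro gram_real bK)
    have "0 < S" using S(1) by simp
    from lattice_points_of_matrix[of n "\<lambda>i j. emb j (b i)" S, OF real b(2)[unfolded emb_mat_def] this]
    show ?thesis using that unfolding emb_mat_def by blast
  qed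
  define elt where "elt c = (\<Sum>i<n. of_int (c i) * b i)" for c :: "nat \<Rightarrow> int"
  have emb_elt: "emb j (elt c) = (\<Sum>i<n. of_int (c i) * emb j (b i))" if "j < n" for j c
    using embedding_rat_combination[OF emb_in[OF that], of "{..<n}" b "\<lambda>i. of_int (c i)"] bK by (simp add: elt_def)
  have elt_int: "elt c \<in> K \<and> algebraic_int (elt c)" for c
    unfolding elt_def using integral_combination[OF b(1)] by blast
  have elt_small: "elt c \<in> small_integers B" if "c \<in> C" for c
    using that C(4) elt_int by (simp add: small_integers_def emb_elt B_def)
  have inj_elt: "inj_on elt C"
    using inj_on_subset[OF independent_inj_int[OF ind] C(2)] by (simp add: elt_def[abs_def])
  have "\<exists>Q. \<forall>c\<in>C. elt c = (\<Sum>i<d. of_rat (Q c i) * w i)" using w(4) elt_small by (intro bchoice) blast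
  then obtain Q where Q: "\<And>c. c \<in> C \<Longrightarrow> elt c = (\<Sum>i<d. of_rat (Q c i) * w i)" by blast
  define V where "V = (\<lambda>c. (\<lambda>i. real_of_rat (Q c i))) ` C"
  have embQ: "(\<Sum>i<d. complex_of_real (real_of_rat (Q c i)) * emb j (w i)) = emb j (elt c)" if "c \<in> C" "j < n" for c j
    using embedding_rat_combination[OF emb_in[OF that(2)], of "{..<d}" w "Q c"] wK Q[OF that(1)]
    by (simp add: of_real_of_rat)
  have injQ: "inj_on (\<lambda>c. (\<lambda>i. real_of_rat (Q c i))) C"
  proof (rule inj_onI)
    fix c c' assume c: "c \<in> C" "c' \<in> C" "(\<lambda>i. real_of_rat (Q c i)) = (\<lambda>i. real_of_rat (Q c' i))"
    then have "Q c i = Q c' i" for i using fun_cong[OF c(3), of i] by simp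
    then have "elt c = elt c'" using Q c(1,2) by simp
    then show "c = c'" using inj_elt c(1,2) by (simp add: inj_on_def)
  qed
  have "real (card V) \<le> (2 * real (d + 1) * (real n * B) + 2) ^ d"
  proof (rule packing_bound[where a = "\<lambda>i j. emb j (w i)"])
    show "0 \<le> B" using B by simp
    show "cmod (\<Sum>i<d. of_real (x i) * emb j (w i)) \<le> B" if "x \<in> V" "j < n" for x j
      using that elt_small by (auto simp: V_def embQ small_integers_def)
    show "1 \<le> (\<Sum>j<n. (cmod (\<Sum>i<d. of_real (x i - y i) * emb j (w i)))\<^sup>2)"
      if "x \<in> V" "y \<in> V" "x \<noteq> y" for x y
    proof -
      obtain c c' where c: "c \<in> C" "c' \<in> C" "x = (\<lambda>i. real_of_rat (Q c i))" "y = (\<lambda>i. real_of_rat (Q c' i))"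
        using \<open>x \<in> V\<close> \<open>y \<in> V\<close> unfolding V_def by blast
      have "c \<noteq> c'" using c \<open>x \<noteq> y\<close> by auto
      then have ne: "elt c + - elt c' \<noteq> 0" using inj_elt c(1,2) by (auto simp: inj_on_def)
      have K2: "elt c \<in> K" "elt c' \<in> K" "- elt c' \<in> K" using elt_int uminus_closed by auto
      have "(\<Sum>i<d. complex_of_real (x i - y i) * emb j (w i)) = emb j (elt c + - elt c')" if "j < n" for j
      proof -
        have "(\<Sum>i<d. complex_of_real (x i - y i) * emb j (w i)) = emb j (elt c) - emb j (elt c')"
          unfolding embQ[OF c(1) that, symmetric] embQ[OF c(2) that, symmetric] c(3,4)
          by (simp add: left_diff_distrib sum_subtractf)
        also have "\<dots> = emb j (elt c + - elt c')"
          using K2 by (simp only: embedding_hom(1,5)[OF emb_in[OF that]]) simp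
        finally show ?thesis .
      qed
      then show ?thesis
        using integral_separation[of "elt c + - elt c'"] ne add_closed[OF K2(1,3)] elt_int
        by (simp add: algebraic_int_add_mult(1)[of "elt c" "- elt c'", simplified] algebraic_int_minus)
    qed
  qed
  then have card: "real (card C) \<le> (2 * real (d + 1) * (real n * B) + 2) ^ d"
    using card_image[OF injQ] by (simp add: V_def)
  have "n < 2 * d"
  proof (rule ccontr)
    assume "\<not> n < 2 * d"
    then have dn: "2 * d \<le> n" by simp
    have "S ^ n \<le> (16 * real n ^ 3) ^ n * H"
      using packing_contradiction[OF dn n2 S(1) _ disc C(3)] card b(2) by (simp add: B_def)
    then show False using S(2) by simp
  qed
  then show ?thesis using w(1-3) unfolding B_def by blast
qed

lemma extend_to_basis:
  assumes u: "rat_independent m u" "\<And>i. i < m \<Longrightarrow> u i \<in> K"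
  shows "\<exists>e. rat_independent n e \<and> (\<forall>i<n. e i \<in> K) \<and> (\<forall>i<m. e i = u i)"
proof -
  define P where "P k \<longleftrightarrow> (\<exists>e. rat_independent k e \<and> (\<forall>i<k. e i \<in> K) \<and> (\<forall>i<m. e i = u i))" for k
  have "P k" if "m \<le> k" "k \<le> n" for k
    using that
  proof (induction k rule: dec_induct)
    case base show ?case using u unfolding P_def by blast
  next
    case (step k)
    then obtain e where e: "rat_independent k e" "\<forall>i<k. e i \<in> K" "\<forall>i<m. e i = u i" unfolding P_def by auto
    have "\<exists>x\<in>K. \<nexists>q. x = (\<Sum>i<k. of_rat (q i) * e i)"
      using degree_le_spanning[where d = k and a = e] step.prems by (metis Suc_le_lessD not_le)
    then obtain x where x: "x \<in> K" "\<nexists>q. x = (\<Sum>i<k. of_rat (q i) * e i)" by blast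
    then show ?case unfolding P_def using e step.hyps independent_extend[OF e(1) x(2)]
      by (intro exI[of _ "e(k := x)"]) (auto simp: less_Suc_eq)
  qed
  then show ?thesis using independent_le_degree[OF u] unfolding P_def by blast
qed

text \<open>Otherwise a nonzero linear form \<open>\<phi>\<close> on \<open>K\<close> vanishes on
  all products \<open>w i * w k\<close>. The bilinear form \<open>\<phi>(x y)\<close> is
  nondegenerate because \<open>K\<close> is a field, so a subspace on which it vanishes has
  dimension at most \<open>n/2\<close>.\<close>
lemma products_span:
  assumes w: "rat_independent d w" "\<And>i. i < d \<Longrightarrow> w i \<in> K" and d: "n < 2 * d"
    and m: "rat_independent m u" "\<And>i. i < m \<Longrightarrow> u i \<in> K"
      "\<And>i k. i < d \<Longrightarrow> k < d \<Longrightarrow> \<exists>q. w i * w k = (\<Sum>l<m. of_rat (q l) * u l)"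
  shows "m = n"
proof (rule ccontr)
  assume "m \<noteq> n"
  moreover have "m \<le> n" by (rule independent_le_degree[OF m(1,2)])
  ultimately have mn: "m < n" by simp
  \<comment> \<open>a basis that begins with \<open>u\<close>; the form \<open>\<phi>\<close> is the coordinate with index \<open>m\<close>\<close>
  obtain e where e: "rat_independent n e" "\<And>i. i < n \<Longrightarrow> e i \<in> K" "\<And>i. i < m \<Longrightarrow> e i = u i"
    using extend_to_basis[OF m(1,2)] by auto
  \<comment> \<open>a basis that begins with \<open>w\<close>\<close>
  obtain f where f: "rat_independent n f" "\<And>i. i < n \<Longrightarrow> f i \<in> K" "\<And>i. i < d \<Longrightarrow> f i = w i"
    using extend_to_basis[OF w] by auto
  have "\<exists>c. \<forall>x\<in>K. x = (\<Sum>i<n. of_rat (c x i) * e i)"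
    by (intro bchoice ballI independent_spans[OF e(1,2)])
  then obtain c where c: "\<And>x. x \<in> K \<Longrightarrow> x = (\<Sum>i<n. of_rat (c x i) * e i)" by blast
  define \<phi> where "\<phi> x = c x m" for x
  have coord: "c x i = q i" if "x = (\<Sum>i<n. of_rat (q i) * e i)" "x \<in> K" "i < n" for x q i
  proof -
    have "(\<Sum>i<n. of_rat (c x i - q i) * e i) = 0"
      using c[OF that(2)] that(1) by (simp add: of_rat_diff left_diff_distrib sum_subtractf)
    then have "c x i - q i = 0" using e(1)[unfolded rat_independent_def, rule_format, of "\<lambda>i. c x i - q i" i] that(3) by simp
    then show ?thesis by simp
  qed
  have lin: "\<phi> (\<Sum>i\<in>I. of_rat (q i) * z i) = (\<Sum>i\<in>I. q i * \<phi> (z i))" if "\<And>i. i \<in> I \<Longrightarrow> z i \<in> K" for I :: "nat set" and q z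
  proof -
    have "(\<Sum>i\<in>I. of_rat (q i) * z i) = (\<Sum>i\<in>I. \<Sum>l<n. of_rat (q i * c (z i) l) * e l)"
    proof (intro sum.cong refl)
      fix i assume "i \<in> I"
      then have "of_rat (q i) * z i = of_rat (q i) * (\<Sum>l<n. of_rat (c (z i) l) * e l)" using c that by metis
      then show "of_rat (q i) * z i = (\<Sum>l<n. of_rat (q i * c (z i) l) * e l)"
        by (simp add: sum_distrib_left of_rat_mult mult.assoc)
    qed
    also have "\<dots> = (\<Sum>l<n. of_rat (\<Sum>i\<in>I. q i * c (z i) l) * e l)"
      by (subst sum.swap) (simp add: of_rat_sum sum_distrib_right)
    finally show ?thesis unfolding \<phi>_def
      by (rule coord) (use mn that in \<open>auto intro: sum_closed mult_closed of_rat_closed\<close>)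
  qed
  have zero_prod: "\<phi> (w i * w k) = 0" if "i < d" "k < d" for i k
  proof -
    obtain q where q: "w i * w k = (\<Sum>l<m. of_rat (q l) * u l)" using m(3) \<open>i < d\<close> \<open>k < d\<close> by blast
    have "(\<Sum>l<m. of_rat (q l) * u l) = (\<Sum>l<m. of_rat (q l) * e l)" using e(3) by simp
    also have "\<dots> = (\<Sum>l<n. of_rat (if l < m then q l else 0) * e l)"
      using mn by (intro sum.mono_neutral_cong_left) auto
    finally have eq: "w i * w k = (\<Sum>l<n. of_rat (if l < m then q l else 0) * e l)" using q by simp
    have "c (w i * w k) m = (if m < m then q m else 0)"
      by (rule coord[OF eq mult_closed[OF w(2)[OF \<open>i < d\<close>] w(2)[OF \<open>k < d\<close>]] mn])
    then show ?thesis by (simp add: \<phi>_def)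
  qed
  \<comment> \<open>a nonzero combination of the \<open>w i\<close> orthogonal to the last \<open>n - d\<close> members of \<open>f\<close>, hence to all\<close>
  have "n - d < d" using d by simp
  from underdetermined_system[OF this, of "\<lambda>k i. \<phi> (f (d + k) * w i)"] obtain q where
    q: "\<exists>i<d. q i \<noteq> (0::rat)" "\<And>k. k < n - d \<Longrightarrow> (\<Sum>i<d. \<phi> (f (d + k) * w i) * q i) = 0" by blast
  define x where "x = (\<Sum>i<d. of_rat (q i) * w i)"
  have xK: "x \<in> K" unfolding x_def by (intro sum_closed mult_closed of_rat_closed w(2)) simp
  have x0: "x \<noteq> 0" using q(1) w(1) unfolding x_def rat_independent_def by blast
  have prod: "\<phi> (f k * x) = (\<Sum>i<d. q i * \<phi> (f k * w i))" if "k < n" for k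
  proof -
    have eq: "f k * x = (\<Sum>i<d. of_rat (q i) * (f k * w i))" by (simp add: x_def sum_distrib_left mult_ac)
    show ?thesis unfolding eq by (rule lin) (use that w(2) f(2) in \<open>auto intro: mult_closed\<close>)
  qed
  have orth: "\<phi> (f k * x) = 0" if k: "k < n" for k
  proof (cases "k < d")
    case True
    then show ?thesis unfolding prod[OF k] using f(3) zero_prod by (intro sum.neutral) auto
  next
    case False
    then show ?thesis unfolding prod[OF k] using q(2)[of "k - d"] k by (simp add: mult.commute)
  qed
  have all0: "\<phi> y = 0" if y: "y \<in> K" for y
  proof -
    have "y * inverse x \<in> K" by (intro mult_closed y inverse_closed xK x0)
    from independent_spans[OF f(1,2) this] obtain p where p: "y * inverse x = (\<Sum>k<n. of_rat (p k) * f k)" by blast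
    have "y = (y * inverse x) * x" using x0 by simp
    also have "\<dots> = (\<Sum>k<n. of_rat (p k) * (f k * x))" by (simp add: p sum_distrib_right mult.assoc)
    finally have eq: "y = (\<Sum>k<n. of_rat (p k) * (f k * x))" .
    have "\<phi> y = (\<Sum>k<n. p k * \<phi> (f k * x))"
      by (subst eq, rule lin) (use f(2) xK in \<open>auto intro: mult_closed\<close>)
    then show ?thesis using orth by simp
  qed
  have "e m = (\<Sum>l<n. of_rat (if l = m then 1 else 0) * e l)"
  proof -
    have "(\<Sum>l<n. of_rat (if l = m then 1 else 0) * e l) = (\<Sum>l<n. if l = m then e l else 0)"
      by (intro sum.cong) auto
    then show ?thesis using mn by simp
  qed
  then have "c (e m) m = (if m = m then 1 else 0)" by (rule coord[OF _ e(2)[OF mn] mn])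
  then show False using all0[OF e(2)[OF mn]] by (simp add: \<phi>_def)
qed

text \<open>Products of two members of the family of \<open>many_small_independent\<close>; this
  squares the bound for the conjugates.\<close>
lemma small_basis:
  assumes b: "integral_family b" "det (emb_mat b) \<noteq> 0"
    and disc: "(cmod (det (emb_mat b)))\<^sup>2 \<le> H" and H: "1 \<le> H"
    and S: "1 \<le> S" "(16 * real n ^ 3) ^ n * H < S ^ n" and n2: "2 \<le> n"
  shows "\<exists>\<omega>. det (emb_mat \<omega>) \<noteq> 0 \<and> (\<forall>i<n. \<omega> i \<in> small_integers ((real n * S)\<^sup>2))"
proof -
  let ?B = "real n * S"
  obtain d w where w: "n < 2 * d" "d \<le> n" "rat_independent d w" "\<And>i. i < d \<Longrightarrow> w i \<in> small_integers ?B"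
    using many_small_independent[OF assms] by blast
  have wK: "w i \<in> K" if "i < d" for i using w(4)[OF that] by (simp add: small_integers_def)
  define V where "V = {w i * w k | i k. i < d \<and> k < d}"
  have VK: "V \<subseteq> K" using wK by (auto simp: V_def intro: mult_closed)
  have Vs: "V \<subseteq> small_integers (?B\<^sup>2)"
  proof
    fix x assume "x \<in> V"
    then obtain i k where ik: "i < d" "k < d" "x = w i * w k" by (auto simp: V_def)
    have "cmod (emb j x) \<le> ?B\<^sup>2" if j: "j < n" for j
    proof -
      have "emb j x = emb j (w i) * emb j (w k)"
        unfolding ik(3) by (rule embedding_hom(2)[OF emb_in[OF j] wK[OF ik(1)] wK[OF ik(2)]])
      moreover have "cmod (emb j (w i)) \<le> ?B" "cmod (emb j (w k)) \<le> ?B"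
        using w(4)[OF ik(1)] w(4)[OF ik(2)] j by (simp_all add: small_integers_def)
      ultimately show ?thesis using S(1) by (auto simp: norm_mult power2_eq_square intro!: mult_mono)
    qed
    moreover have "algebraic_int x"
      using w(4)[OF ik(1)] w(4)[OF ik(2)] by (simp add: ik(3) small_integers_def algebraic_int_add_mult)
    ultimately show "x \<in> small_integers (?B\<^sup>2)" using \<open>x \<in> V\<close> VK by (auto simp: small_integers_def)
  qed
  obtain m u where u: "m \<le> n" "rat_independent m u" "\<And>i. i < m \<Longrightarrow> u i \<in> V"
    "\<And>x. x \<in> V \<Longrightarrow> \<exists>q. x = (\<Sum>i<m. of_rat (q i) * u i)"
    using maximal_independent_family[OF VK] by blast
  have "m = n"
  proof (rule products_span[OF w(3) wK w(1) u(2)])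
    show "\<And>i. i < m \<Longrightarrow> u i \<in> K" using u(3) VK by blast
    show "\<exists>q. w i * w k = (\<Sum>l<m. of_rat (q l) * u l)" if "i < d" "k < d" for i k
      using u(4) that by (auto simp: V_def)
  qed
  then show ?thesis using u(2,3) VK Vs det_independent[of u] by (intro exI[of _ u]) auto
qed

end

section \<open>Generic generators and the code of a field\<close>

lemma genericity_cong:
  assumes "\<And>m. m < n * r \<Longrightarrow> x m = y m" "1 \<le> r"
  shows "genericity n r x = genericity n r y"
proof -
  have "hermite_jacobian r m m' x = hermite_jacobian r m m' y" if "m' < n * r" for m m'
    unfolding hermite_jacobian_def using assms index_less[of "m' div r"] that
    by (auto simp: less_mult_imp_div_less intro!: arg_cong2[of _ _ _ _ "(*)"] prod.cong)
  then have "mat (n * r) (n * r) (\<lambda>(m, m'). hermite_jacobian r m m' x) =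
     mat (n * r) (n * r) (\<lambda>(m, m'). hermite_jacobian r m m' y)"
    by (intro eq_matI) auto
  moreover have "binary_form r i x = binary_form r i y" if "i < n" for i
    unfolding binary_form_def using assms(1) index_less[OF that] by (intro sum.cong) auto
  then have "(\<Prod>i<n. \<Prod>i'<i. binary_form r i x - binary_form r i' x) =
    (\<Prod>i<n. \<Prod>i'<i. binary_form r i y - binary_form r i' y)"
    by (intro prod.cong refl) simp
  ultimately show ?thesis by (simp add: genericity_def)
qed

lemma hermite_factor_integral: "coeff (hermite_factor i j k) l \<in> \<int>"
  by (auto simp: hermite_factor_def hermite_value_def hermite_slope_def coeff_pCons split: nat.split)

lemma hermite_factor_bound:
  assumes "cmod t \<le> W" "1 \<le> W"
  shows "cmod (poly (hermite_factor i j k) t) \<le> 6 * W ^ 3"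
proof -
  let ?p = "hermite_factor i j k"
  have "poly ?p t = (\<Sum>e\<le>3. coeff ?p e * t ^ e)"
    unfolding poly_altdef using degree_hermite_factor[of i j k]
    by (intro sum.mono_neutral_left) (auto simp: coeff_eq_0)
  then have "cmod (poly ?p t) \<le> (\<Sum>e\<le>3. cmod (coeff ?p e * t ^ e))" by (simp only: norm_sum)
  also have "\<dots> \<le> (\<Sum>e\<le>3. cmod (coeff ?p e) * W ^ 3)"
  proof (rule sum_mono)
    fix e :: nat assume "e \<in> {..3}"
    then have "W ^ e \<le> W ^ 3" using assms(2) by (intro power_increasing) auto
    moreover have "cmod t ^ e \<le> W ^ e" using assms(1) by (intro power_mono) auto
    ultimately show "cmod (coeff ?p e * t ^ e) \<le> cmod (coeff ?p e) * W ^ 3"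
      by (simp add: norm_mult norm_power mult_left_mono)
  qed
  also have "\<dots> = (\<Sum>e\<le>3. cmod (coeff ?p e)) * W ^ 3" by (rule sum_distrib_right[symmetric])
  also have "\<dots> \<le> 6 * W ^ 3"
    using assms(2)
    by (intro mult_right_mono) (auto simp: hermite_factor_def hermite_value_def hermite_slope_def numeral_3_eq_3)
  finally show ?thesis .
qed

context embedded_number_field
begin

lemma integral_poly:
  assumes "\<And>i. coeff p i \<in> \<int>" "x \<in> K" "algebraic_int x"
  shows "poly p x \<in> K \<and> algebraic_int (poly p x) \<and> (\<forall>j<n. emb j (poly p x) = poly p (emb j x))"
  using assms(1)
proof (induction p)
  case 0
  then show ?case using embedding_hom(4)[OF emb_in] zero_closed by simp
next
  case (pCons a p)
  have "coeff (pCons a p) 0 \<in> \<int>" "\<And>i. coeff (pCons a p) (Suc i) \<in> \<int>" using pCons.prems by blast+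
  then obtain z where z: "a = of_int z" and p: "\<And>i. coeff p i \<in> \<int>" by (auto elim: Ints_cases)
  note IH = pCons.IH[OF p]
  have "poly (pCons a p) x \<in> K" using IH assms(2) by (auto simp: z intro!: add_closed mult_closed of_int_closed)
  moreover have "algebraic_int (poly (pCons a p) x)"
    using IH assms(3) by (simp add: z algebraic_int_add_mult algebraic_int_of_int)
  moreover have "emb j (poly (pCons a p) x) = poly (pCons a p) (emb j x)" if j: "j < n" for j
    using IH assms(2) embedding_hom(6)[OF emb_in[OF j], of "of_int z"] j
    by (simp add: z embedding_hom(1,2)[OF emb_in[OF j]] of_int_closed mult_closed)
  ultimately show ?case by blast
qed

definition conjugate_point :: "nat \<Rightarrow> (nat \<Rightarrow> complex) \<Rightarrow> nat \<Rightarrow> complex" where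
  "conjugate_point r k m = emb (m div r) (k (m mod r))"

text \<open>The coordinates of the conjugate points are linear in the coefficients of the elements
  with respect to the basis \<open>\<omega>\<close>, and complex coefficients reach the hypercube,
  as the matrix of \<open>\<omega>\<close> is invertible. So genericity is not identically zero in
  the coefficients, and it is nonzero for some natural coefficients up to its degree.\<close>
lemma generic_small_elements:
  assumes \<omega>: "det (emb_mat \<omega>) \<noteq> 0" "\<And>i. i < n \<Longrightarrow> \<omega> i \<in> small_integers B"
    and r: "1 \<le> r" "n \<le> 2 ^ r" and B: "0 \<le> B"
  shows "\<exists>k. (\<forall>i<r. k i \<in> small_integers (real n * real (n * r * (3 * r) + n * n) * B)) \<and>
    genericity n r (conjugate_point r k) \<noteq> 0"
proof -
  define E where "E = n * r * (3 * r) + n * n"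
  \<comment> \<open>the conjugate points of the elements with coefficients \<open>u (k * n + l)\<close>, \<open>l < n\<close>\<close>
  define L where "L u m = (\<Sum>l<n. u ((m mod r) * n + l) * emb (m div r) (\<omega> l))" for u :: "nat \<Rightarrow> complex" and m
  have "line_poly E (\<lambda>u. genericity n r (L u))"
    unfolding E_def
  proof (rule line_poly_compose_linear[OF line_poly_genericity[OF r(1)]])
    fix u v t m
    show "L (\<lambda>i. u i + t * v i) m = L u m + t * L v m"
      by (simp add: L_def distrib_right sum.distrib sum_distrib_left mult.assoc)
  qed
  moreover have "\<exists>u. genericity n r (L u) \<noteq> 0"
  proof -
    let ?A = "(emb_mat \<omega>)\<^sup>T"
    have "det ?A \<noteq> 0" using \<omega>(1) by (simp add: det_transpose[of _ n])
    then have "\<exists>v. \<forall>i<n. (\<Sum>l<n. ?A $$ (i, l) * v l) = hypercube_point r (i * r + k)" for k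
      by (intro det_nonzero_solve) simp_all
    then obtain v where v: "\<And>k i. i < n \<Longrightarrow> (\<Sum>l<n. ?A $$ (i, l) * v k l) = hypercube_point r (i * r + k)" by metis
    define u where "u m = v (m div n) (m mod n)" for m
    have "L u m = hypercube_point r m" if m: "m < n * r" for m
    proof -
      have i: "m div r < n" using m by (simp add: less_mult_imp_div_less)
      have "L u m = (\<Sum>l<n. ?A $$ (m div r, l) * v (m mod r) l)"
        unfolding L_def u_def using i degree_pos by (intro sum.cong) (simp_all add: emb_mat_def)
      then show ?thesis using v[OF i, of "m mod r"] by simp
    qed
    from genericity_cong[OF this r(1)] have "genericity n r (L u) = genericity n r (hypercube_point r)" by simp
    then show ?thesis using genericity_hypercube[OF r(2)] by metis
  qed
  ultimately obtain a u where a: "\<forall>k<n * r. a k \<le> E"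
    "genericity n r (L (\<lambda>k. if k < n * r then of_nat (a k) else u k)) \<noteq> 0"
    using schwartz_zippel[of E "\<lambda>u. genericity n r (L u)" _ "n * r"] by blast
  define k where "k i = (\<Sum>l<n. of_nat (a (i * n + l)) * \<omega> l)" for i
  have \<omega>K: "\<And>l. l < n \<Longrightarrow> \<omega> l \<in> K" using \<omega>(2) by (simp add: small_integers_def)
  have emb_k: "emb j (k i) = (\<Sum>l<n. of_nat (a (i * n + l)) * emb j (\<omega> l))" if "j < n" for i j
    using embedding_rat_combination[OF emb_in[OF that], of "{..<n}" \<omega> "\<lambda>l. of_nat (a (i * n + l))"] \<omega>K
    by (simp add: k_def)
  have "k i \<in> small_integers (real n * real E * B)" if i: "i < r" for i
  proof -
    have "k i \<in> K" unfolding k_def using \<omega>K by (intro sum_closed mult_closed of_nat_closed) auto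
    moreover have "algebraic_int (k i)"
    proof -
      have "algebraic_int (of_int (int (a (i * n + l))) * \<omega> l)" if "l \<in> {..<n}" for l
        using \<omega>(2)[of l] that by (intro algebraic_int_add_mult algebraic_int_of_int) (simp add: small_integers_def)
      then show ?thesis unfolding k_def by (intro algebraic_int_sum) simp
    qed
    moreover have "cmod (emb j (k i)) \<le> real n * real E * B" if j: "j < n" for j
    proof -
      have "cmod (emb j (k i)) \<le> (\<Sum>l<n. cmod (of_nat (a (i * n + l)) * emb j (\<omega> l)))"
        unfolding emb_k[OF j] by (rule norm_sum)
      also have "\<dots> \<le> (\<Sum>l<n. real E * B)"
      proof (rule sum_mono)
        fix l assume "l \<in> {..<n}"
        then have "real (a (i * n + l)) \<le> real E" "cmod (emb j (\<omega> l)) \<le> B"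
          using a(1) index_less[OF i, of l n] \<omega>(2) j by (auto simp: small_integers_def mult.commute[of n])
        then show "cmod (of_nat (a (i * n + l)) * emb j (\<omega> l)) \<le> real E * B"
          by (simp add: norm_mult mult_mono)
      qed
      finally show ?thesis by simp
    qed
    ultimately show ?thesis by (simp add: small_integers_def)
  qed
  moreover have "genericity n r (conjugate_point r k) \<noteq> 0"
  proof -
    have "conjugate_point r k m = L (\<lambda>k. if k < n * r then of_nat (a k) else u k) m" if m: "m < n * r" for m
    proof -
      have i: "m div r < n" "m mod r < r" using m r by (simp_all add: less_mult_imp_div_less)
      show ?thesis unfolding conjugate_point_def L_def emb_k[OF i(1)]
        using index_less[OF i(2), of _ n] by (intro sum.cong) (auto simp: mult.commute[of n])
    qed
    from genericity_cong[OF this r(1)] show ?thesis using a(2) by simp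
  qed
  ultimately show ?thesis unfolding E_def by blast
qed

text \<open>The sum is the trace of an algebraic integer, namely the product of the factors at the
  elements \<open>k l\<close>.\<close>
lemma hermite_sum_conjugates:
  assumes k: "\<And>i. i < r \<Longrightarrow> k i \<in> small_integers W" and W: "1 \<le> W" and r: "1 \<le> r"
  shows "\<exists>y::int. hermite_sum n r m (conjugate_point r k) = of_int y \<and> \<bar>real_of_int y\<bar> \<le> real n * (6 * W ^ 3) ^ r"
proof -
  let ?p = "hermite_factor (m div r) (m mod r)"
  define h where "h = (\<Prod>l<r. poly (?p l) (k l))"
  have kK: "k l \<in> K" "algebraic_int (k l)" if "l < r" for l using k[OF that] by (simp_all add: small_integers_def)
  note ip = integral_poly[OF hermite_factor_integral[of "m div r" "m mod r"] kK]
  have hK: "h \<in> K" unfolding h_def using ip by (intro prod_closed) simp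
  have hI: "algebraic_int h" unfolding h_def using ip by (intro algebraic_int_prod) simp
  have cp: "conjugate_point r k (j * r + l) = emb j (k l)" if "l < r" for j l
    using that by (simp add: conjugate_point_def)
  have eh: "emb j h = (\<Prod>l<r. poly (?p l) (conjugate_point r k (j * r + l)))" if j: "j < n" for j
    unfolding h_def using ip j
    by (subst embedding_prod[OF emb_in[OF j]]) (auto simp: cp intro!: prod.cong)
  have sum: "hermite_sum n r m (conjugate_point r k) = (\<Sum>j<n. emb j h)"
    unfolding hermite_sum_def using eh by simp
  obtain y where y: "(\<Sum>j<n. emb j h) = of_int y" using trace_norm_integer(1)[OF hK hI] by (elim Ints_cases)
  have "cmod (emb j h) \<le> (6 * W ^ 3) ^ r" if j: "j < n" for j
  proof -
    have "cmod (emb j h) = (\<Prod>l<r. cmod (poly (?p l) (emb j (k l))))"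
      unfolding eh[OF j] prod_norm[symmetric] by (intro prod.cong) (auto simp: cp)
    also have "\<dots> \<le> (\<Prod>l<r. 6 * W ^ 3)"
      using k j W by (intro prod_mono conjI hermite_factor_bound) (auto simp: small_integers_def)
    finally show ?thesis by simp
  qed
  then have "cmod (\<Sum>j<n. emb j h) \<le> (\<Sum>j<n. (6 * W ^ 3) ^ r)"
    by (intro order.trans[OF norm_sum] sum_mono) simp
  then have "\<bar>real_of_int y\<bar> \<le> real n * (6 * W ^ 3) ^ r" unfolding y by simp
  then show ?thesis using sum y by auto
qed

text \<open>If the conjugates of \<open>x\<close> are distinct, its powers are a basis.\<close>
lemma image_of_embedding:
  assumes x: "x \<in> K" "inj_on (\<lambda>j. emb j x) {..<n}"
  shows "emb 0 ` K = rat_adjoin (emb 0 x)"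
proof -
  have e: "emb 0 \<in> embeddings K" by (rule emb_in[OF degree_pos])
  have ind: "rat_independent n (\<lambda>i. x ^ i)"
    using det_powers[OF x(2,1)] det_independent[of "\<lambda>i. x ^ i"] power_closed[OF x(1)] by simp
  have "K \<subseteq> rat_adjoin x"
  proof
    fix y assume "y \<in> K"
    then obtain q where "y = (\<Sum>i<n. of_rat (q i) * x ^ i)"
      using independent_spans[OF ind power_closed[OF x(1)]] by blast
    then have "y = rpoly (\<Sum>i<n. monom (q i) i) x" by (simp add: rpoly_sum)
    then show "y \<in> rat_adjoin x" by (auto simp: rat_adjoin_def)
  qed
  then have "K = rat_adjoin x" using rat_adjoin_subset[OF x(1)] by blast
  then have "emb 0 ` K = emb 0 ` rat_adjoin x" by simp
  also have "\<dots> = rat_adjoin (emb 0 x)"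
    unfolding rat_adjoin_def image_image by (simp add: embedding_rpoly[OF e x(1)])
  finally show ?thesis .
qed

lemma binary_form_conjugates:
  assumes "\<And>i. i < r \<Longrightarrow> k i \<in> K" "j < n"
  shows "binary_form r j (conjugate_point r k) = emb j (\<Sum>i<r. of_rat (2 ^ i) * k i)"
proof -
  have "emb j (\<Sum>i<r. of_rat (2 ^ i) * k i) = (\<Sum>i<r. of_rat (2 ^ i) * emb j (k i))"
    by (rule embedding_rat_combination[OF emb_in[OF assms(2)]]) (simp add: assms(1))
  then show ?thesis by (simp add: binary_form_def conjugate_point_def of_rat_power)
qed

text \<open>The code of \<open>K\<close>: the integers \<open>y\<close>, and the value of the binary
  form, which belongs to a finite set that depends on \<open>y\<close> only.\<close>
lemma field_data:
  assumes n: "nf_degree K = n" and disc: "nf_discriminant K \<le> H" and H: "1 \<le> H"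
    and S: "1 \<le> S" "(16 * real n ^ 3) ^ n * H < S ^ n" and n2: "2 \<le> n"
    and r: "1 \<le> r" "n \<le> 2 ^ r"
    and W: "1 \<le> W" "real n * real (n * r * (3 * r) + n * n) * (real n * S)\<^sup>2 \<le> W"
  shows "\<exists>(y::nat \<Rightarrow> int) z s. (\<forall>m<n * r. \<bar>real_of_int (y m)\<bar> \<le> real n * (6 * W ^ 3) ^ r) \<and>
    genericity n r z \<noteq> 0 \<and> (\<forall>m<n * r. hermite_sum n r m z = of_int (y m)) \<and>
    s \<in> embeddings K \<and> s ` K = rat_adjoin (binary_form r 0 z)"
proof -
  obtain b where b: "integral_family b" "det (emb_mat b) \<noteq> 0" "nf_discriminant K = (cmod (det (emb_mat b)))\<^sup>2"
    using nf_discriminant_eq[OF n] by blast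
  obtain \<omega> where \<omega>: "det (emb_mat \<omega>) \<noteq> 0" "\<And>i. i < n \<Longrightarrow> \<omega> i \<in> small_integers ((real n * S)\<^sup>2)"
    using small_basis[OF b(1,2) _ H S n2] disc b(3) by auto
  obtain k where k0: "\<And>i. i < r \<Longrightarrow> k i \<in> small_integers (real n * real (n * r * (3 * r) + n * n) * (real n * S)\<^sup>2)"
    and gen: "genericity n r (conjugate_point r k) \<noteq> 0"
    using generic_small_elements[OF \<omega> r] by auto
  have k: "k i \<in> small_integers W" if "i < r" for i
    using k0[OF that] W(2) unfolding small_integers_def by (auto intro: order.trans)
  have kK: "k i \<in> K" if "i < r" for i using k[OF that] by (simp add: small_integers_def)
  have "\<exists>y. \<forall>m. hermite_sum n r m (conjugate_point r k) = of_int (y m) \<and> \<bar>real_of_int (y m)\<bar> \<le> real n * (6 * W ^ 3) ^ r"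
    using hermite_sum_conjugates[of r k W, OF k W(1) r(1)] by (intro choice) blast
  then obtain y where y: "\<And>m. hermite_sum n r m (conjugate_point r k) = of_int (y m)"
    "\<And>m. \<bar>real_of_int (y m)\<bar> \<le> real n * (6 * W ^ 3) ^ r" by blast
  define x where "x = (\<Sum>i<r. of_rat (2 ^ i) * k i)"
  have xK: "x \<in> K" unfolding x_def using kK by (intro sum_closed mult_closed of_rat_closed) auto
  have bf: "binary_form r j (conjugate_point r k) = emb j x" if "j < n" for j
    unfolding x_def by (rule binary_form_conjugates[OF kK that])
  have "inj_on (\<lambda>j. emb j x) {..<n}"
    using generic_distinct[OF gen] bf by (intro inj_onI) (metis lessThan_iff)
  then have "emb 0 ` K = rat_adjoin (binary_form r 0 (conjugate_point r k))"
    using image_of_embedding[OF xK] bf[OF degree_pos] by simp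
  then show ?thesis using y gen emb_in[OF degree_pos] by blast
qed

end

section \<open>Counting\<close>

lemma number_field_embedded:
  assumes "number_field K"
  shows "\<exists>emb. embedded_number_field K (nf_degree K) emb"
proof -
  interpret complex_number_field K "nf_degree K" by (rule number_field_concrete[OF assms])
  obtain emb where "bij_betw emb {..<nf_degree K} (embeddings K)"
    using ex_bij_betw_nat_finite[OF card_embeddings(1)] card_embeddings(2) by (auto simp: lessThan_atLeast0)
  then show ?thesis by (intro exI[of _ emb]) unfold_locales
qed

text \<open>The isomorphism is the first embedding followed by the inverse of the second.\<close>
lemma isomorphic_of_common_image:
  assumes K: "number_field K" and L: "number_field L"
    and s: "s \<in> embeddings K" and s': "s' \<in> embeddings L" and eq: "s ` K = s' ` L"
  shows "(K, L) \<in> nf_isomorphism"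
proof -
  interpret FK: complex_number_field K "nf_degree K" by (rule number_field_concrete[OF K])
  interpret FL: complex_number_field L "nf_degree L" by (rule number_field_concrete[OF L])
  have bij: "bij_betw s K (s ` K)" "bij_betw s' L (s' ` L)"
    using FK.embedding_inj[OF s] FL.embedding_inj[OF s'] by (simp_all add: inj_on_imp_bij_betw)
  define h where "h = (\<lambda>x. inv_into L s' (s x))"
  have hb: "bij_betw h K L"
    using bij_betw_trans[OF bij(1), of "inv_into L s'" L] bij_betw_inv_into[OF bij(2)] eq by (simp add: h_def o_def)
  have hL: "h x \<in> L" if "x \<in> K" for x using bij_betwE[OF hb] that by blast
  have sh: "s' (h x) = s x" if "x \<in> K" for x
    using that eq unfolding h_def by (metis f_inv_into_f imageI)
  have det: "h x = z" if "x \<in> K" "z \<in> L" "s' z = s x" for x z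
    using inj_onD[OF FL.embedding_inj[OF s'] _ hL[OF that(1)] that(2)] sh[OF that(1)] that(3) by simp
  have "h 1 = 1"
    by (rule det) (simp_all add: FK.one_closed FL.one_closed FK.embedding_hom(3)[OF s] FL.embedding_hom(3)[OF s'])
  moreover have "h (x * y) = h x * h y \<and> h (x + y) = h x + h y" if "x \<in> K" "y \<in> K" for x y
    using that hL
    by (intro conjI det) (simp_all add: FK.mult_closed FL.mult_closed FK.add_closed FL.add_closed sh
        FK.embedding_hom(1,2)[OF s] FL.embedding_hom(1,2)[OF s'])
  ultimately have "h \<in> ring_iso (subfield_ring K) (subfield_ring L)"
    using hb hL by (simp add: ring_iso_def Ring.ring_hom_def complex_field_simps)
  then show ?thesis using K L by (auto simp: nf_isomorphism_def is_ring_iso_def)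
qed

lemma nf_isomorphism_sym: assumes "(K, L) \<in> nf_isomorphism" shows "(L, K) \<in> nf_isomorphism"
proof -
  interpret F: Ring.field complex_field by (rule field_from_type_algebra)
  have "subring K complex_field"
    using assms subfieldE(1) by (auto simp: nf_isomorphism_def number_field_def)
  from ring_iso_sym[OF F.subring_is_ring[OF this]] assms show ?thesis by (auto simp: nf_isomorphism_def)
qed

lemma nf_isomorphism_trans:
  "(K, L) \<in> nf_isomorphism \<Longrightarrow> (L, M) \<in> nf_isomorphism \<Longrightarrow> (K, M) \<in> nf_isomorphism"
  unfolding nf_isomorphism_def using ring_iso_trans by blast

text \<open>A map whose fibres lie within classes.\<close>
lemma card_quotient_le:
  assumes sym: "\<And>x y. (x, y) \<in> R \<Longrightarrow> (y, x) \<in> R" and trans: "\<And>x y z. (x, y) \<in> R \<Longrightarrow> (y, z) \<in> R \<Longrightarrow> (x, z) \<in> R"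
    and f: "f ` A \<subseteq> Z" "finite Z" and inj: "\<And>x y. x \<in> A \<Longrightarrow> y \<in> A \<Longrightarrow> f x = f y \<Longrightarrow> (x, y) \<in> R"
  shows "finite (A // R) \<and> card (A // R) \<le> card Z"
proof -
  define T where "T z = R `` {SOME x. x \<in> A \<and> f x = z}" for z
  have "T (f x) = R `` {x}" if x: "x \<in> A" for x
  proof -
    let ?y = "SOME y. y \<in> A \<and> f y = f x"
    have "?y \<in> A \<and> f ?y = f x" by (rule someI[of _ x]) (use x in simp)
    then have "(x, ?y) \<in> R" using inj[OF x] by simp
    then have "R `` {?y} = R `` {x}" using sym trans by blast
    then show ?thesis by (simp add: T_def)
  qed
  then have "A // R = T ` (f ` A)" by (auto simp: quotient_def image_iff)
  moreover have "finite (f ` A)" using f finite_subset by blast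
  ultimately show ?thesis using card_image_le[of "f ` A" T] card_mono[OF f(2,1)] by auto
qed

lemma class_count:
  assumes H: "1 \<le> H" and S: "1 \<le> S" "(16 * real n ^ 3) ^ n * H < S ^ n" and n2: "2 \<le> n"
    and r: "1 \<le> r" "n \<le> 2 ^ r"
    and W: "1 \<le> W" "real n * real (n * r * (3 * r) + n * n) * (real n * S)\<^sup>2 \<le> W"
  shows "finite (nf_classes n H) \<and>
    real (card (nf_classes n H)) \<le> (2 * (real n * (6 * W ^ 3) ^ r) + 1) ^ (n * r) * (3 * real r * (real n * real r + 1)) ^ (n * r)"
proof -
  define T where "T = real n * (6 * W ^ 3) ^ r"
  have T0: "0 \<le> T" using W(1) by (simp add: T_def)
  define A where "A = {K. number_field K \<and> nf_degree K = n \<and> nf_discriminant K \<le> H}"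
  define Y where "Y = {..<n * r} \<rightarrow>\<^sub>E {- \<lfloor>T\<rfloor>..\<lfloor>T\<rfloor>}"
  have "\<exists>R. finite R \<and> card R \<le> (3 * r * (n * r + 1)) ^ (n * r) \<and>
    (\<forall>z. genericity n r z \<noteq> 0 \<and> (\<forall>m<n * r. hermite_sum n r m z = of_int (y m)) \<longrightarrow> binary_form r 0 z \<in> R)"
    for y :: "nat \<Rightarrow> int" using n2 by (intro hermite_system_bound r(1)) simp
  then obtain R where R: "\<And>y. finite (R y)" "\<And>y. card (R y) \<le> (3 * r * (n * r + 1)) ^ (n * r)"
    "\<And>y z. genericity n r z \<noteq> 0 \<Longrightarrow> (\<And>m. m < n * r \<Longrightarrow> hermite_sum n r m z = of_int (y m)) \<Longrightarrow> binary_form r 0 z \<in> R y"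
    by metis
  have "\<exists>p. p \<in> Sigma Y R \<and> (\<exists>s\<in>embeddings K. s ` K = rat_adjoin (snd p))" if K: "K \<in> A" for K
  proof -
    have K: "number_field K" "nf_degree K = n" "nf_discriminant K \<le> H" using K by (simp_all add: A_def)
    obtain emb where "embedded_number_field K n emb" using number_field_embedded[OF K(1)] K(2) by auto
    from embedded_number_field.field_data[OF this K(2,3) H S n2 r W] obtain y :: "nat \<Rightarrow> int" and z s where
      d: "\<And>m. m < n * r \<Longrightarrow> \<bar>real_of_int (y m)\<bar> \<le> T" "genericity n r z \<noteq> 0"
        "\<And>m. m < n * r \<Longrightarrow> hermite_sum n r m z = of_int (y m)"
        "s \<in> embeddings K" "s ` K = rat_adjoin (binary_form r 0 z)" unfolding T_def by blast
    let ?y = "restrict y {..<n * r}"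
    have "?y \<in> Y"
    proof -
      have "- \<lfloor>T\<rfloor> \<le> y m \<and> y m \<le> \<lfloor>T\<rfloor>" if "m < n * r" for m using d(1)[OF that] by linarith
      then show ?thesis by (simp add: Y_def PiE_iff)
    qed
    moreover have "binary_form r 0 z \<in> R ?y" by (rule R(3)[OF d(2)]) (simp add: d(3))
    ultimately have "(?y, binary_form r 0 z) \<in> Sigma Y R" by simp
    then show ?thesis using d(4,5) by (metis snd_conv)
  qed
  then obtain f where f: "\<And>K. K \<in> A \<Longrightarrow> f K \<in> Sigma Y R"
    "\<And>K. K \<in> A \<Longrightarrow> \<exists>s\<in>embeddings K. s ` K = rat_adjoin (snd (f K))" by metis
  have finY: "finite Y" unfolding Y_def by (intro finite_PiE) auto
  have "finite (A // nf_isomorphism) \<and> card (A // nf_isomorphism) \<le> card (Sigma Y R)"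
  proof (rule card_quotient_le[OF nf_isomorphism_sym nf_isomorphism_trans])
    show "f ` A \<subseteq> Sigma Y R" using f(1) by blast
    show "finite (Sigma Y R)" using finY R(1) by auto
    fix K L assume KL: "K \<in> A" "L \<in> A" "f K = f L"
    obtain s where s: "s \<in> embeddings K" "s ` K = rat_adjoin (snd (f K))" using f(2)[OF KL(1)] by blast
    obtain s' where s': "s' \<in> embeddings L" "s' ` L = rat_adjoin (snd (f L))" using f(2)[OF KL(2)] by blast
    show "(K, L) \<in> nf_isomorphism"
      using KL s s' by (intro isomorphic_of_common_image[of K L s s']) (simp_all add: A_def)
  qed
  moreover have "A // nf_isomorphism = nf_classes n H" by (simp add: A_def nf_classes_def)
  moreover have "real (card (Sigma Y R)) \<le> (2 * T + 1) ^ (n * r) * (3 * real r * (real n * real r + 1)) ^ (n * r)"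
  proof -
    have "card (Sigma Y R) = (\<Sum>y\<in>Y. card (R y))" using finY R(1) by (intro card_SigmaI) auto
    also have "\<dots> \<le> card Y * (3 * r * (n * r + 1)) ^ (n * r)"
      using sum_bounded_above[of Y "\<lambda>y. card (R y)"] R(2) by simp
    finally have "real (card (Sigma Y R)) \<le> real (card Y) * real ((3 * r * (n * r + 1)) ^ (n * r))"
      by (metis of_nat_le_iff of_nat_mult)
    also have "real ((3 * r * (n * r + 1)) ^ (n * r)) = (3 * real r * (real n * real r + 1)) ^ (n * r)"
      by (simp only: of_nat_power of_nat_mult of_nat_add of_nat_numeral of_nat_1)
    also have "real (card Y) = real (nat (2 * \<lfloor>T\<rfloor> + 1)) ^ (n * r)" by (simp add: Y_def card_PiE)
    also have "real (nat (2 * \<lfloor>T\<rfloor> + 1)) ^ (n * r) \<le> (2 * T + 1) ^ (n * r)"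
    proof (rule power_mono)
      show "real (nat (2 * \<lfloor>T\<rfloor> + 1)) \<le> 2 * T + 1" using T0 by linarith
    qed simp
    finally show ?thesis by (simp add: mult_right_mono)
  qed
  ultimately show ?thesis unfolding T_def by force
qed

text \<open>The constant \<open>2\<close> comes from \<open>ln 2 \<ge> 1/2\<close>.\<close>
lemma binary_length:
  assumes "2 \<le> n"
  shows "\<exists>r\<ge>1. n \<le> 2 ^ r \<and> r \<le> n \<and> real r \<le> 2 * ln (real n) + 1"
proof -
  define r where "r = (LEAST r. n \<le> 2 ^ r)"
  have nr: "n \<le> 2 ^ r" unfolding r_def by (rule LeastI[of _ n]) (simp add: less_imp_le)
  have rn: "r \<le> n" unfolding r_def by (rule Least_le) (simp add: less_imp_le)
  have r1: "1 \<le> r" using nr assms by (cases r) auto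
  have "\<not> n \<le> 2 ^ (r - 1)" using not_less_Least[of "r - 1" "\<lambda>r. n \<le> 2 ^ r"] r1 unfolding r_def by simp
  then have "2 ^ (r - 1) \<le> n" by simp
  then have "(2::real) ^ (r - 1) \<le> real n" by (metis of_nat_le_iff of_nat_numeral of_nat_power)
  then have "ln ((2::real) ^ (r - 1)) \<le> ln (real n)" using assms by simp
  then have "real (r - 1) * ln 2 \<le> ln (real n)" by (simp add: ln_realpow)
  moreover have "(1/2::real) \<le> ln 2"
  proof -
    have "exp (1/2::real) ^ 2 = exp 1" by (simp flip: exp_of_nat_mult)
    also have "\<dots> \<le> 2 ^ 2" using exp_le by simp
    finally have "exp (1/2::real) \<le> 2" by (rule power2_le_imp_le) simp
    then show ?thesis by (subst ln_ge_iff) simp_all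
  qed
  then have "real (r - 1) * (1/2) \<le> real (r - 1) * ln 2" by (intro mult_left_mono) auto
  ultimately have "real (r - 1) \<le> 2 * ln (real n)" by simp
  then show ?thesis using nr rn r1 by (intro exI[of _ r]) auto
qed

text \<open>Each of the \<open>n r\<close> factors is at most \<open>(n\<^sup>4\<^sup>6
  h\<^sup>6)\<^sup>r\<close>, and \<open>h\<^sup>n = H\<close>. With \<open>r \<le> 3 ln n\<close>
  the exponents \<open>46 n r\<^sup>2\<close> of \<open>n\<close> and \<open>6 r\<^sup>2\<close> of
  \<open>H\<close> are within the claim.\<close>
lemma final_estimate:
  fixes n r :: nat and H h W S :: real
  assumes n: "2000 \<le> n" and H: "1 \<le> H" and r: "1 \<le> r" "r \<le> n" "real r \<le> 2 * ln (real n) + 1"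
    and h: "h = H powr (1 / real n)" and W: "W = real n ^ 13 * h\<^sup>2"
  shows "(2 * (real n * (6 * W ^ 3) ^ r) + 1) ^ (n * r) * (3 * real r * (real n * real r + 1)) ^ (n * r) \<le>
    real n powr (2000 * real n * (ln (real n)) ^ 3) * H powr (2000 * (ln (real n)) ^ 3)"
proof -
  let ?x = "real n"
  have x: "2000 \<le> ?x" using n by simp
  have h1: "1 \<le> h" unfolding h using H by (simp add: ge_one_powr_ge_zero)
  have hp: "1 \<le> h ^ k" for k by (rule one_le_power[OF h1])
  have xp: "1 \<le> ?x ^ k" for k using x by (intro one_le_power) simp
  have "6 * W ^ 3 = 6 * ?x ^ 39 * h ^ 6" by (simp add: W power_mult_distrib flip: power_mult)
  also have "\<dots> \<le> ?x * ?x ^ 39 * h ^ 6" using x h1 by (intro mult_right_mono) auto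
  also have "\<dots> = ?x ^ 40 * h ^ 6" by (simp flip: power_Suc)
  finally have W3: "6 * W ^ 3 \<le> ?x ^ 40 * h ^ 6" .
  have W0: "0 \<le> 6 * W ^ 3" using h1 by (simp add: W)
  have "2 * (?x * (6 * W ^ 3) ^ r) + 1 \<le> 2 * (?x * (?x ^ 40 * h ^ 6) ^ r) + 1"
    using W3 W0 by (intro add_right_mono mult_left_mono power_mono) auto
  also have "\<dots> \<le> 3 * (?x * (?x ^ 40 * h ^ 6) ^ r)"
  proof -
    have "1 * 1 \<le> ?x * (?x ^ 40 * h ^ 6) ^ r"
      using x mult_mono[OF xp[of 40] hp[of 6]] by (intro mult_mono one_le_power) auto
    then show ?thesis by simp
  qed
  also have "\<dots> = (3 * ?x) * (?x ^ 40 * h ^ 6) ^ r" by simp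
  also have "\<dots> \<le> ?x ^ 2 * (?x ^ 40 * h ^ 6) ^ r"
    using x h1 by (intro mult_right_mono) (auto simp: power2_eq_square)
  finally have A: "2 * (?x * (6 * W ^ 3) ^ r) + 1 \<le> ?x ^ 2 * (?x ^ 40 * h ^ 6) ^ r" .
  have "3 * real r * (?x * real r + 1) \<le> 3 * ?x * (?x * ?x + ?x * ?x)"
    using r(2) x mult_mono[of 1 ?x 1 ?x] by (intro mult_mono add_mono) auto
  also have "\<dots> = 6 * ?x ^ 3" by (simp add: power3_eq_cube)
  also have "\<dots> \<le> ?x * ?x ^ 3" using x by (intro mult_right_mono) auto
  finally have B: "3 * real r * (?x * real r + 1) \<le> ?x ^ 4" by (simp flip: power_Suc)
  have "(2 * (?x * (6 * W ^ 3) ^ r) + 1) * (3 * real r * (?x * real r + 1)) \<le> (?x ^ 2 * (?x ^ 40 * h ^ 6) ^ r) * ?x ^ 4"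
    using A B W0 h1 by (intro mult_mono) auto
  also have "\<dots> = ?x ^ 6 * (?x ^ 40 * h ^ 6) ^ r" by (simp add: mult_ac flip: power_add)
  also have "\<dots> \<le> (?x ^ 6) ^ r * (?x ^ 40 * h ^ 6) ^ r"
    using r(1) xp[of 6] h1 power_increasing[of 1 r "?x ^ 6"] by (intro mult_right_mono) auto
  also have "\<dots> = (?x ^ 46 * h ^ 6) ^ r" by (simp add: mult.assoc[symmetric] flip: power_mult_distrib power_add)
  finally have C: "(2 * (?x * (6 * W ^ 3) ^ r) + 1) * (3 * real r * (?x * real r + 1)) \<le> (?x ^ 46 * h ^ 6) ^ r" .
  have "(2 * (?x * (6 * W ^ 3) ^ r) + 1) ^ (n * r) * (3 * real r * (?x * real r + 1)) ^ (n * r) =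
    ((2 * (?x * (6 * W ^ 3) ^ r) + 1) * (3 * real r * (?x * real r + 1))) ^ (n * r)"
    by (simp only: power_mult_distrib)
  also have "\<dots> \<le> ((?x ^ 46 * h ^ 6) ^ r) ^ (n * r)"
    using C W0 by (intro power_mono) auto
  also have "\<dots> = ?x ^ (46 * (r * (n * r))) * h ^ (6 * (r * (n * r)))"
    by (simp only: power_mult_distrib power_mult[symmetric] mult.assoc)
  also have "?x ^ (46 * (r * (n * r))) = ?x powr (46 * ?x * real r ^ 2)"
    using x by (subst powr_realpow[symmetric]) (simp_all add: power2_eq_square mult_ac)
  also have "h ^ (6 * (r * (n * r))) = H powr (6 * real r ^ 2)"
  proof -
    have "h ^ (6 * (r * (n * r))) = H powr (1 / ?x * real (6 * (r * (n * r))))"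
      unfolding h using H x by (subst powr_realpow[symmetric]) (simp_all add: powr_powr)
    also have "1 / ?x * real (6 * (r * (n * r))) = 6 * real r ^ 2" using x by (simp add: power2_eq_square)
    finally show ?thesis .
  qed
  also have "?x powr (46 * ?x * real r ^ 2) * H powr (6 * real r ^ 2) \<le>
      ?x powr (2000 * ?x * (ln ?x) ^ 3) * H powr (2000 * (ln ?x) ^ 3)"
  proof -
    have l1: "1 \<le> ln ?x" using x exp_le by (simp add: ln_ge_iff)
    have "real r \<le> 3 * ln ?x" using r(3) l1 by linarith
    then have "real r ^ 2 \<le> (3 * ln ?x) ^ 2" by (intro power_mono) auto
    also have "\<dots> = 9 * (ln ?x) ^ 2" by (simp add: power_mult_distrib)
    also have "\<dots> \<le> 9 * (ln ?x) ^ 3" using l1 power_increasing[of 2 3 "ln ?x"] by simp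
    finally have r2: "real r ^ 2 \<le> 9 * (ln ?x) ^ 3" .
    have l3: "0 \<le> (ln ?x) ^ 3" using l1 by simp
    have "?x * real r ^ 2 \<le> ?x * (9 * (ln ?x) ^ 3)" using r2 by (intro mult_left_mono) auto
    moreover have "0 \<le> ?x * (ln ?x) ^ 3" using l3 by simp
    ultimately have "46 * (?x * real r ^ 2) \<le> 2000 * (?x * (ln ?x) ^ 3)" by linarith
    then have le1: "46 * ?x * real r ^ 2 \<le> 2000 * ?x * (ln ?x) ^ 3" by (simp only: mult.assoc)
    have le2: "6 * real r ^ 2 \<le> 2000 * (ln ?x) ^ 3" using r2 l3 by linarith
    have "1 \<le> ?x" using x by simp
    then show ?thesis by (intro mult_mono[OF powr_mono[OF le1] powr_mono[OF le2 H]]) simp_all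
  qed
  finally show ?thesis .
qed

theorem theorem2:
  shows "\<exists>C::real. C > 0 \<and>
    (\<forall>(n::nat) (H::nat). real n \<ge> C \<and> H \<ge> 1 \<longrightarrow>
       finite (nf_classes n (real H)) \<and>
       real (card (nf_classes n (real H)))
         \<le> real n powr (C * real n * (ln (real n)) ^ 3) * real H powr (C * (ln (real n)) ^ 3))"
proof (intro exI[of _ 2000] conjI allI impI)
  show "(0::real) < 2000" by simp
next
  fix n H :: nat assume nH: "2000 \<le> real n \<and> 1 \<le> H"
  then have n: "2000 \<le> n" and H: "1 \<le> real H" by auto
  let ?x = "real n"
  define h where "h = real H powr (1 / ?x)"
  \<comment> \<open>just above the threshold \<open>16 n\<^sup>3 H\<^sup>1\<^sup>/\<^sup>n\<close> of \<open>many_small_independent\<close>\<close>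
  define S where "S = 17 * ?x ^ 3 * h"
  \<comment> \<open>a bound for the conjugates of generic elements: \<open>n \<cdot> 4 n\<^sup>3 \<cdot> (17 n\<^sup>4 h)\<^sup>2\<close>, where \<open>1156 \<le> n\<close>\<close>
  define W where "W = ?x ^ 13 * h\<^sup>2"
  obtain r where r: "1 \<le> r" "n \<le> 2 ^ r" "r \<le> n" "real r \<le> 2 * ln ?x + 1"
    using binary_length[of n] n by auto
  have h1: "1 \<le> h" unfolding h_def using H by (simp add: ge_one_powr_ge_zero)
  have hn: "h ^ n = real H" unfolding h_def using H n by (subst powr_realpow[symmetric]) (simp_all add: powr_powr)
  have x: "2000 \<le> ?x" using n by simp
  have x3: "1 \<le> ?x ^ 3" using x by (intro one_le_power) simp
  have S1: "1 \<le> S" unfolding S_def using mult_mono[of 1 "17 * ?x ^ 3" 1 h] x3 h1 by simp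
  have S2: "(16 * ?x ^ 3) ^ n * real H < S ^ n"
  proof -
    have "(16 * ?x ^ 3) ^ n < (17 * ?x ^ 3) ^ n" using x n by (intro power_strict_mono) auto
    then have "(16 * ?x ^ 3) ^ n * real H < (17 * ?x ^ 3) ^ n * real H"
      using H by (intro mult_strict_right_mono) auto
    then show ?thesis unfolding S_def power_mult_distrib[of _ h] hn .
  qed
  have W1: "1 \<le> W" unfolding W_def using mult_mono[of 1 "?x ^ 13" 1 "h\<^sup>2"] x h1 by simp
  have W2: "?x * real (n * r * (3 * r) + n * n) * (?x * S)\<^sup>2 \<le> W"
  proof -
    have "real (n * r * (3 * r) + n * n) \<le> ?x * ?x * (3 * ?x) + ?x * ?x * ?x"
    proof -
      have "real (n * r * (3 * r)) \<le> ?x * ?x * (3 * ?x)" using r(3) by (auto intro!: mult_mono)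
      moreover have "real (n * n) \<le> ?x * ?x * ?x" using x by simp
      ultimately show ?thesis by simp
    qed
    also have "\<dots> = 4 * ?x ^ 3" by (simp add: power3_eq_cube)
    finally have "?x * real (n * r * (3 * r) + n * n) * (?x * S)\<^sup>2 \<le> ?x * (4 * ?x ^ 3) * (?x * S)\<^sup>2"
      by (intro mult_right_mono mult_left_mono) auto
    also have "\<dots> = 1156 * ?x ^ 12 * h\<^sup>2"
      by (simp add: S_def power_mult_distrib eval_nat_numeral)
    also have "\<dots> \<le> ?x * ?x ^ 12 * h\<^sup>2" using x by (intro mult_right_mono) auto
    also have "\<dots> = W" by (simp add: W_def flip: power_Suc)
    finally show ?thesis .
  qed
  have "2 \<le> n" using n by simp
  note count = class_count[OF H S1 S2 this r(1,2) W1 W2]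
  show "finite (nf_classes n (real H))" using count by blast
  have "real (card (nf_classes n (real H))) \<le>
    (2 * (?x * (6 * W ^ 3) ^ r) + 1) ^ (n * r) * (3 * real r * (?x * real r + 1)) ^ (n * r)"
    using count by blast
  also have "\<dots> \<le> ?x powr (2000 * ?x * (ln ?x) ^ 3) * real H powr (2000 * (ln ?x) ^ 3)"
    by (rule final_estimate[OF n H r(1,3,4) h_def W_def])
  finally show "real (card (nf_classes n (real H))) \<le>
    ?x powr (2000 * ?x * (ln ?x) ^ 3) * real H powr (2000 * (ln ?x) ^ 3)" .
qed

end
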